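(* Let $\mathcal{A}=\mathbb{C}\langle x,x^*\mid x^*x+xx^*=1\rangle$ and let $y=y^*\in\mathcal{A}$. The following are equivalent: (i) $y\in\mathcal{A}_+$, i.e. $\pi(y)\geq 0$ for every finite-dimensional $*$-representation $\pi$ of $\mathcal{A}$; (ii) $y\in\sum\mathfrak{A}^2$; (iii) there exists $c\in Z(\mathcal{A})$, $c\neq 0$, such that $c^*c\cdot y\in\sum\mathcal{A}^2$.
   Context: $\mathcal{A}$ is the complex $*$-algebra generated by one element $x$ subject to the relation $x^*x+xx^*=1$. A finite-dimensional $*$-representation is a unital $*$-homomorphism $\pi:\mathcal{A}\to M_k(\mathbb{C})$ (with conjugate transpose as involution), and $\pi(y)\ge 0$ means positive semidefinite. $\mathcal{A}_+$ denotes the set of hermitian $y$ with $\pi(y)\ge0$ for all such $\pi$. $Z(\mathcal{A})$ is the center of $\mathcal{A}$; it is an integral domain (isomorphic to $\mathbb{C}[uv,u\bar v]$ in a faithful representation into $2\times 2$ matrices over $\mathbb{C}[u,v,\bar v]$ with $u=\bar u$, $u^2+v\bar v=1$), and $\mathfrak{A}=\mathcal{A}(Z(\mathcal{A}))^{-1}$ is the localization of $\mathcal{A}$ at the nonzero central elements, into which $\mathcal{A}$ embeds; the involution extends to $\mathfrak{A}$. For a $*$-algebra $\mathcal{B}$, $\sum\mathcal{B}^2$ denotes the set of finite sums $\sum_i b_i^*b_i$, $b_i\in\mathcal{B}$. *)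

theory Defs
  imports Complex_Main "Jordan_Normal_Form.Schur_Decomposition"
begin

section \<open>The free *-algebra on one generator x (elements = finitely supported
  coefficient functions on words; letter True = x, letter False = x*)\<close>

type_synonym fa = "bool list \<Rightarrow> complex"

definition fa_carrier :: "fa set" where
  "fa_carrier = {p. finite {w. p w \<noteq> 0}}"

definition fa_add :: "fa \<Rightarrow> fa \<Rightarrow> fa" where
  "fa_add p q = (\<lambda>w. p w + q w)"

definition fa_diff :: "fa \<Rightarrow> fa \<Rightarrow> fa" where
  "fa_diff p q = (\<lambda>w. p w - q w)"

definition fa_zero :: fa where
  "fa_zero = (\<lambda>w. 0)"

definition fa_smult :: "complex \<Rightarrow> fa \<Rightarrow> fa" where
  "fa_smult a p = (\<lambda>w. a * p w)"

definition fa_one :: fa where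
  "fa_one = (\<lambda>w. if w = [] then 1 else 0)"

definition fa_gen :: "bool \<Rightarrow> fa" where
  "fa_gen b = (\<lambda>w. if w = [b] then 1 else 0)"

definition fa_mult :: "fa \<Rightarrow> fa \<Rightarrow> fa" where
  "fa_mult p q = (\<lambda>w. \<Sum>i\<le>length w. p (take i w) * q (drop i w))"

definition fa_star :: "fa \<Rightarrow> fa" where
  "fa_star p = (\<lambda>w. cnj (p (rev (map Not w))))"

abbreviation fa_x :: fa where "fa_x \<equiv> fa_gen True"
abbreviation fa_xstar :: fa where "fa_xstar \<equiv> fa_gen False"

definition rel :: fa where
  "rel = fa_diff (fa_add (fa_mult fa_xstar fa_x) (fa_mult fa_x fa_xstar)) fa_one"

text \<open>Two-sided ideal generated by the relator; A = fa_carrier / rel_ideal.\<close>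
inductive_set rel_ideal :: "fa set" where
  zero: "fa_zero \<in> rel_ideal"
| add: "p \<in> rel_ideal \<Longrightarrow> q \<in> rel_ideal \<Longrightarrow> fa_add p q \<in> rel_ideal"
| gen: "a \<in> fa_carrier \<Longrightarrow> b \<in> fa_carrier \<Longrightarrow> fa_mult (fa_mult a rel) b \<in> rel_ideal"

definition A_eq :: "fa \<Rightarrow> fa \<Rightarrow> bool" where
  "A_eq p q \<longleftrightarrow> fa_diff p q \<in> rel_ideal"

definition A_hermitian :: "fa \<Rightarrow> bool" where
  "A_hermitian y \<longleftrightarrow> y \<in> fa_carrier \<and> A_eq (fa_star y) y"

definition A_central :: "fa \<Rightarrow> bool" where
  "A_central c \<longleftrightarrow> c \<in> fa_carrier \<and> (\<forall>b\<in>fa_carrier. A_eq (fa_mult c b) (fa_mult b c))"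

definition A_sos :: "fa \<Rightarrow> bool" where
  "A_sos y \<longleftrightarrow> (\<exists>as. set as \<subseteq> fa_carrier \<and>
     A_eq y (foldr (\<lambda>a acc. fa_add (fa_mult (fa_star a) a) acc) as fa_zero))"

text \<open>Unital *-homomorphisms A \<rightarrow> M_k(C), given on representatives
  (hence required to vanish on the ideal).\<close>
definition star_rep :: "nat \<Rightarrow> (fa \<Rightarrow> complex mat) \<Rightarrow> bool" where
  "star_rep k \<pi> \<longleftrightarrow>
     (\<forall>p\<in>fa_carrier. \<pi> p \<in> carrier_mat k k) \<and>
     \<pi> fa_one = 1\<^sub>m k \<and>
     (\<forall>p\<in>fa_carrier. \<forall>q\<in>fa_carrier. \<pi> (fa_add p q) = \<pi> p + \<pi> q) \<and>
     (\<forall>a p. p \<in> fa_carrier \<longrightarrow> \<pi> (fa_smult a p) = a \<cdot>\<^sub>m \<pi> p) \<and>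
     (\<forall>p\<in>fa_carrier. \<forall>q\<in>fa_carrier. \<pi> (fa_mult p q) = \<pi> p * \<pi> q) \<and>
     (\<forall>p\<in>fa_carrier. \<pi> (fa_star p) = mat_adjoint (\<pi> p)) \<and>
     (\<forall>p\<in>rel_ideal. \<pi> p = 0\<^sub>m k k)"

definition psd_mat :: "nat \<Rightarrow> complex mat \<Rightarrow> bool" where
  "psd_mat k M \<longleftrightarrow> M \<in> carrier_mat k k \<and>
     (\<forall>v\<in>carrier_vec k. conjugate v \<bullet> (M *\<^sub>v v) \<in> \<real> \<and> 0 \<le> Re (conjugate v \<bullet> (M *\<^sub>v v)))"

definition A_pos :: "fa \<Rightarrow> bool" where
  "A_pos y \<longleftrightarrow> (\<forall>k \<pi>. star_rep k \<pi> \<longrightarrow> psd_mat k (\<pi> y))"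

text \<open>Fractions a c^{-1} are pairs (a, c) with a in A, c in Z(A), c \<noteq> 0 in A.\<close>
definition loc_denom :: "fa \<Rightarrow> bool" where
  "loc_denom c \<longleftrightarrow> A_central c \<and> \<not> A_eq c fa_zero"

definition loc_eq :: "fa \<times> fa \<Rightarrow> fa \<times> fa \<Rightarrow> bool" where
  "loc_eq f g \<longleftrightarrow> (case f of (a, c) \<Rightarrow> case g of (b, d) \<Rightarrow>
     (\<exists>s. loc_denom s \<and> A_eq (fa_mult s (fa_diff (fa_mult a d) (fa_mult b c))) fa_zero))"

definition loc_add :: "fa \<times> fa \<Rightarrow> fa \<times> fa \<Rightarrow> fa \<times> fa" where
  "loc_add f g = (case f of (a, c) \<Rightarrow> case g of (b, d) \<Rightarrow>
     (fa_add (fa_mult a d) (fa_mult b c), fa_mult c d))"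

definition loc_mult :: "fa \<times> fa \<Rightarrow> fa \<times> fa \<Rightarrow> fa \<times> fa" where
  "loc_mult f g = (case f of (a, c) \<Rightarrow> case g of (b, d) \<Rightarrow> (fa_mult a b, fa_mult c d))"

definition loc_star :: "fa \<times> fa \<Rightarrow> fa \<times> fa" where
  "loc_star f = (case f of (a, c) \<Rightarrow> (fa_star a, fa_star c))"

definition loc_sos :: "fa \<Rightarrow> bool" where
  "loc_sos y \<longleftrightarrow> (\<exists>fs. (\<forall>(a, c)\<in>set fs. a \<in> fa_carrier \<and> loc_denom c) \<and>
     loc_eq (y, fa_one) (foldr (\<lambda>f acc. loc_add (loc_mult (loc_star f) f) acc) fs (fa_zero, fa_one)))"

end

theory Submission
  imports Defs "HOL-Computational_Algebra.Squarefree" "HOL-Computational_Algebra.Polynomial_Factorial"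
    "HOL-Computational_Algebra.Field_as_Ring"
begin

text \<open>For \<open>|l| < 1/2\<close> there is, up to equivalence, one irreducible two-dimensional representation of \<open>A\<close> with
  \<open>x\<^sup>2 = l\<close>. These representations separate the elements of \<open>A\<close>, and an element is central iff it acts
  as a scalar in each of them. For hermitian \<open>y\<close> the trace \<open>t\<close> and the determinant \<open>n\<close> are real
  polynomials in \<open>Re l\<close> and \<open>Im l\<close>, and Cayley--Hamilton reads \<open>t y = y\<^sup>2 + n\<close>, so it suffices to
  write \<open>t\<close> and \<open>t n\<close>, up to a square factor, as sums of squares. Both are nonnegative on the disc,
  so they lie in the cone generated by the squares and by \<open>1 - 4|l|\<^sup>2\<close> after multiplication with a
  square (an Artin type theorem), and \<open>1 - 4|l|\<^sup>2\<close> is the square of \<open>1 - 2x\<^sup>*x\<close> in \<open>A\<close>.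

  Artin's theorem needs no model theory here: an ordering of the field of rational functions
  in which \<open>h\<close> is negative and \<open>1 - 4|l|\<^sup>2\<close> is positive specializes at a point of the closed disc, and
  blowing up at that point finds real points near it where \<open>h\<close> is negative.

  Conversely, a sum of squares in the localization has \<open>t, n \<ge> 0\<close> on a dense set of \<open>l\<close>, hence on the
  closed disc. In an arbitrary representation \<open>x\<^sup>2\<close> is normal with eigenvalues in the closed disc and
  commutes with \<open>y\<close>, and on each of its eigenspaces \<open>t y = y\<^sup>2 + n\<close> gives \<open>y \<ge> 0\<close>.\<close>

subsection \<open>Evaluation of bivariate polynomials\<close>

text \<open>The obstacle in the Artin type theorem is that a place forgets signs: \<open>h\<close>
  may vanish at the standard part of the generic point, so real points with \<open>h < 0\<close>
  must be found nearby. The blow-ups are controlled by two numbers: the contact of the curve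
  \<open>f = 0\<close> with the line \<open>x = 0\<close>, that is the order at 0 of
  \<open>f(0,Y)\<close>, and, while it is stationary, the order at 0 of some \<open>D(x)\<close> in
  the ideal of \<open>f\<close> and its derivative in \<open>y\<close>, which acts as a
  discriminant. If the standard part lies on the boundary circle, the points found must also fall
  inside the disc; coordinates in which the circle becomes the line \<open>x = 0\<close> reduce this
  to keeping the sign of one coordinate. The two-dimensional representations are taken over the open
  disc because at \<open>|l| = 1/2\<close> the elements \<open>1\<close>, \<open>x\<close>,
  \<open>x*\<close>, \<open>x x*\<close> become dependent in them. Eigenvalues on the circle still
  occur in general representations; they are reached by continuity of \<open>t\<close> and
  \<open>n\<close>, which are polynomials although the matrix entries contain square roots.\<close>

text \<open>The inner variable of a \<open>real poly poly\<close> is \<open>x\<close>, the outer one is \<open>y\<close>.\<close>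
definition ev :: "(real \<Rightarrow> 'e::comm_ring_1) \<Rightarrow> 'e \<Rightarrow> 'e \<Rightarrow> real poly poly \<Rightarrow> 'e" where
  "ev \<iota> x y f = poly (map_poly (\<lambda>p. poly (map_poly \<iota> p) x) f) y"

lemma comm_ring_hom_poly_map:
  fixes h :: "'a::comm_ring_1 \<Rightarrow> 'b::comm_ring_1"
  assumes "comm_ring_hom h"
  shows "comm_ring_hom (\<lambda>p. poly (map_poly h p) x)"
proof -
  interpret comm_ring_hom h by fact
  interpret m: map_poly_comm_ring_hom h ..
  show ?thesis
    by unfold_locales (simp_all only: m.hom_add m.hom_mult m.hom_zero m.hom_one poly_add poly_mult poly_0 poly_1)
qed

text \<open>Three targets occur: the reals for values at points, \<open>real poly poly\<close>
  itself for substitutions, and a field carrying an ordering, in the end the rational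
  functions.\<close>

locale real_alg =
  fixes \<iota> :: "real \<Rightarrow> 'e::comm_ring_1"
  assumes \<iota>_hom: "comm_ring_hom \<iota>"
begin

lemma \<iota>_0: "\<iota> 0 = 0" and \<iota>_1: "\<iota> 1 = 1"
  and \<iota>_add: "\<iota> (a + b) = \<iota> a + \<iota> b" and \<iota>_mult: "\<iota> (a * b) = \<iota> a * \<iota> b"
  and \<iota>_minus: "\<iota> (a - b) = \<iota> a - \<iota> b" and \<iota>_uminus: "\<iota> (- a) = - \<iota> a"
  and \<iota>_power: "\<iota> (a ^ n) = \<iota> a ^ n"
proof -
  interpret h: comm_ring_hom \<iota> by (rule \<iota>_hom)
  show "\<iota> 0 = 0" "\<iota> 1 = 1" "\<iota> (a + b) = \<iota> a + \<iota> b" "\<iota> (a * b) = \<iota> a * \<iota> b"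
    "\<iota> (a - b) = \<iota> a - \<iota> b" "\<iota> (- a) = - \<iota> a" "\<iota> (a ^ n) = \<iota> a ^ n"
    by (simp_all add: h.hom_add h.hom_mult h.hom_minus h.hom_uminus h.hom_power)
qed

definition uev :: "'e \<Rightarrow> real poly \<Rightarrow> 'e" where "uev x p = poly (map_poly \<iota> p) x"

lemma uev_hom: "comm_ring_hom (uev x)"
  unfolding uev_def by (rule comm_ring_hom_poly_map[OF \<iota>_hom])

lemma uev_pCons [simp]: "uev x (pCons a p) = \<iota> a + x * uev x p"
  unfolding uev_def map_poly_simps by (auto simp: \<iota>_0)

lemma uev_0 [simp]: "uev x 0 = 0" by (simp add: uev_def)

lemma ev_alt: "ev \<iota> x y f = poly (map_poly (uev x) f) y"
proof -
  have "uev x = (\<lambda>p. poly (map_poly \<iota> p) x)" by (simp add: fun_eq_iff uev_def)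
  then show ?thesis by (simp add: ev_def)
qed

lemma ev_0 [simp]: "ev \<iota> x y 0 = 0" by (simp add: ev_def)

lemma ev_pCons [simp]: "ev \<iota> x y (pCons p f) = uev x p + y * ev \<iota> x y f"
  unfolding ev_alt map_poly_simps by auto

lemma ev_hom: "comm_ring_hom (ev \<iota> x y)"
  using comm_ring_hom_poly_map[OF uev_hom] by (simp add: ev_alt[abs_def])

lemma ev_add: "ev \<iota> x y (f + g) = ev \<iota> x y f + ev \<iota> x y g"
  and ev_mult: "ev \<iota> x y (f * g) = ev \<iota> x y f * ev \<iota> x y g"
  and ev_minus: "ev \<iota> x y (f - g) = ev \<iota> x y f - ev \<iota> x y g"
  and ev_uminus: "ev \<iota> x y (- f) = - ev \<iota> x y f"
  and ev_1: "ev \<iota> x y 1 = 1"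
  and ev_power: "ev \<iota> x y (f ^ n) = ev \<iota> x y f ^ n"
proof -
  interpret h: comm_ring_hom "ev \<iota> x y" by (rule ev_hom)
  show "ev \<iota> x y (f + g) = ev \<iota> x y f + ev \<iota> x y g" "ev \<iota> x y (f * g) = ev \<iota> x y f * ev \<iota> x y g"
   "ev \<iota> x y (f - g) = ev \<iota> x y f - ev \<iota> x y g" "ev \<iota> x y (- f) = - ev \<iota> x y f" "ev \<iota> x y 1 = 1"
   "ev \<iota> x y (f ^ n) = ev \<iota> x y f ^ n"
    by (simp_all only: h.hom_add h.hom_mult h.hom_minus h.hom_uminus h.hom_power h.hom_one)
qed

lemma uev_mult: "uev x (f * g) = uev x f * uev x g"
  and uev_1 [simp]: "uev x 1 = 1"
  and uev_power: "uev x (f ^ n) = uev x f ^ n"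
proof -
  interpret h: comm_ring_hom "uev x" by (rule uev_hom)
  show "uev x (f * g) = uev x f * uev x g" "uev x 1 = 1" "uev x (f ^ n) = uev x f ^ n"
    by (simp_all only: h.hom_mult h.hom_power h.hom_one)
qed

lemmas ev_simps = ev_add ev_mult ev_minus ev_uminus ev_1 ev_power

lemma ev_const: "ev \<iota> x y [:[:r:]:] = \<iota> r" by simp

lemma ev_sum: "ev \<iota> x y (\<Sum>i\<in>A. F i) = (\<Sum>i\<in>A. ev \<iota> x y (F i))"
  by (induction A rule: infinite_finite_induct) (auto simp: ev_add)

end

lemma poly_bounded_sum:
  fixes p :: "'a::comm_semiring_1 poly"
  assumes "degree p \<le> n"
  shows "poly p x = (\<Sum>i\<le>n. coeff p i * x ^ i)"
  unfolding poly_altdef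
  by (rule sum.mono_neutral_left) (use assms in \<open>auto simp: coeff_eq_0\<close>)

abbreviation polyX :: "real poly poly" where "polyX \<equiv> [:[:0,1:]:]"
abbreviation polyY :: "real poly poly" where "polyY \<equiv> [:0,1:]"
abbreviation polyC :: "real \<Rightarrow> real poly poly" where "polyC r \<equiv> [:[:r:]:]"

interpretation polyC: real_alg polyC
  by (unfold_locales) (auto simp: one_pCons)

interpretation evr: real_alg "\<lambda>r::real. r"
  by (unfold_locales) auto

lemma uev_real [simp]: "evr.uev = (\<lambda>x p. poly p x)"
  by (simp add: fun_eq_iff evr.uev_def)

abbreviation rv :: "real poly poly \<Rightarrow> real \<Rightarrow> real \<Rightarrow> real" where
  "rv f x y \<equiv> ev (\<lambda>r. r) x y f"

abbreviation sub :: "real poly poly \<Rightarrow> real poly poly \<Rightarrow> real poly poly \<Rightarrow> real poly poly" where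
  "sub P Q f \<equiv> ev polyC P Q f"

context real_alg
begin

lemma ev_sub: "ev \<iota> x y (sub P Q f) = ev \<iota> (ev \<iota> x y P) (ev \<iota> x y Q) f"
proof (induction f)
  case 0 then show ?case by simp
next
  case (pCons p f)
  have "ev \<iota> x y (polyC.uev P p) = uev (ev \<iota> x y P) p"
    by (induction p) (auto simp: ev_simps ev_const)
  with pCons show ?case by (simp add: ev_simps)
qed

lemma ev_polyX: "ev \<iota> x y polyX = x" and ev_polyY: "ev \<iota> x y polyY = y"
  by (simp_all add: \<iota>_0 \<iota>_1)

text \<open>The bounds are uniform, so the double sum runs over a rectangle and monomials can be
  rescaled one at a time, in the blow-up and in the chord chart.\<close>

lemma ev_sum_form:
  assumes "degree f \<le> N" "\<And>i. degree (coeff f i) \<le> M"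
  shows "ev \<iota> x y f = (\<Sum>i\<le>N. \<Sum>j\<le>M. \<iota> (coeff (coeff f i) j) * x ^ j * y ^ i)"
proof -
  have a: "uev x p = (\<Sum>j\<le>M. \<iota> (coeff p j) * x ^ j)" if "degree p \<le> M" for p
  proof -
    have "degree (map_poly \<iota> p) \<le> M" using that degree_map_poly_le order_trans by blast
    then have "poly (map_poly \<iota> p) x = (\<Sum>j\<le>M. coeff (map_poly \<iota> p) j * x ^ j)"
      by (rule poly_bounded_sum)
    then show ?thesis by (simp only: uev_def coeff_map_poly[of \<iota>, OF \<iota>_0])
  qed
  have "degree (map_poly (uev x) f) \<le> N"
    using assms(1) degree_map_poly_le order_trans by blast
  then have "ev \<iota> x y f = (\<Sum>i\<le>N. coeff (map_poly (uev x) f) i * y ^ i)"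
    unfolding ev_alt by (rule poly_bounded_sum)
  also have "\<dots> = (\<Sum>i\<le>N. (\<Sum>j\<le>M. \<iota> (coeff (coeff f i) j) * x ^ j) * y ^ i)"
    by (simp only: a[OF assms(2)] coeff_map_poly[of "uev x", OF uev_0])
  finally show ?thesis by (simp add: sum_distrib_right)
qed

end

lemma exists_degree_bound:
  fixes f :: "real poly poly"
  obtains N where "degree f \<le> N" "\<And>i. degree (coeff f i) \<le> N"
proof (rule that)
  let ?N = "degree f + (\<Sum>i\<le>degree f. degree (coeff f i))"
  show "degree f \<le> ?N" by (rule le_add1)
  show "degree (coeff f i) \<le> ?N" for i
  proof (cases "i \<le> degree f")
    case True
    have "degree (coeff f i) \<le> (\<Sum>i\<le>degree f. degree (coeff f i))"
      using member_le_sum[of i "{..degree f}" "\<lambda>i. degree (coeff f i)"] True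
      by (simp only: atMost_iff finite_atMost zero_le)
    then show ?thesis by (rule trans_le_add2)
  next
    case False
    then have "coeff f i = 0" by (intro coeff_eq_0) linarith
    then show ?thesis by (simp only: degree_0 zero_le)
  qed
qed

lemma exists_nonroot_between:
  fixes p :: "real poly" assumes "p \<noteq> 0" "a < b"
  shows "\<exists>x. a < x \<and> x < b \<and> poly p x \<noteq> 0"
proof (rule ccontr)
  assume "\<not> ?thesis"
  then have "{a<..<b} \<subseteq> {x. poly p x = 0}"
    by auto
  then have "finite {a<..<b}" using poly_roots_finite[OF assms(1)] finite_subset by blast
  then show False using infinite_Ioo[OF assms(2)] by simp
qed

text \<open>Choose \<open>x\<close> off the roots of the leading coefficient in \<open>y\<close>;
  then a nonzero polynomial in \<open>y\<close> remains, with finitely many roots.\<close>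

lemma rv_nonzero_in_box:
  assumes "q \<noteq> 0" "a < b" "c < d"
  shows "\<exists>x y. a < x \<and> x < b \<and> c < y \<and> y < d \<and> rv q x y \<noteq> 0"
proof -
  from assms(1) have "lead_coeff q \<noteq> 0" by simp
  from exists_nonroot_between[OF this assms(2)] obtain x where x: "a < x" "x < b" "poly (lead_coeff q) x \<noteq> 0" by blast
  let ?q = "map_poly (\<lambda>p. poly p x) q"
  have "coeff ?q (degree q) \<noteq> 0" using x by (simp add: coeff_map_poly)
  then have "?q \<noteq> 0" by (metis coeff_0)
  from exists_nonroot_between[OF this assms(3)] obtain y where "c < y" "y < d" "poly ?q y \<noteq> 0" by blast
  moreover have "rv q x y = poly ?q y" by (simp add: evr.ev_alt)
  ultimately show ?thesis using x by metis
qed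

lemma tendsto_rv [tendsto_intros]:
  fixes g h :: "'a \<Rightarrow> real"
  assumes "(g \<longlongrightarrow> a) F" "(h \<longlongrightarrow> b) F"
  shows "((\<lambda>z. rv f (g z) (h z)) \<longlongrightarrow> rv f a b) F"
proof (induction f)
  case 0 then show ?case by simp
next
  case (pCons p f)
  then show ?case using assms by (simp) (intro tendsto_intros)
qed

lemma rv_neg_box:
  assumes "rv f x y < 0"
  shows "\<exists>e>0. \<forall>x' y'. \<bar>x' - x\<bar> < e \<longrightarrow> \<bar>y' - y\<bar> < e \<longrightarrow> rv f x' y' < 0"
proof -
  have id: "((\<lambda>z. z) \<longlongrightarrow> (x, y)) (nhds (x, y))" by (rule filterlim_ident)
  have "((\<lambda>z. rv f (fst z) (snd z)) \<longlongrightarrow> rv f x y) (nhds x \<times>\<^sub>F nhds y)"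
    using tendsto_rv[OF tendsto_fst[OF id] tendsto_snd[OF id]] by (simp add: nhds_prod)
  then have "\<forall>\<^sub>F z in nhds x \<times>\<^sub>F nhds y. rv f (fst z) (snd z) < 0"
    using assms order_tendstoD(2) by blast
  then obtain P Q where P: "eventually P (nhds x)" "eventually Q (nhds y)" and
    PQ: "\<And>a b. P a \<Longrightarrow> Q b \<Longrightarrow> rv f a b < 0"
    unfolding eventually_prod_filter by auto
  from P obtain d1 d2 where "d1 > 0" "\<And>a. dist a x < d1 \<Longrightarrow> P a" "d2 > 0" "\<And>a. dist a y < d2 \<Longrightarrow> Q a"
    unfolding eventually_nhds_metric by auto
  with PQ show ?thesis by (intro exI[of _ "min d1 d2"]) (auto simp: dist_real_def)
qed

subsection \<open>Orderings and blow-ups\<close>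

text \<open>A field ordering with its place: \<open>near x a\<close> means that \<open>x\<close> is finite with standard part \<open>a\<close>.\<close>
locale real_place = real_alg \<iota> for \<iota> :: "real \<Rightarrow> 'e::field" +
  fixes pos :: "'e \<Rightarrow> bool" and near :: "'e \<Rightarrow> real \<Rightarrow> bool"
  assumes near_const: "near (\<iota> r) r"
    and near_add: "near x a \<Longrightarrow> near y b \<Longrightarrow> near (x + y) (a + b)"
    and near_mult: "near x a \<Longrightarrow> near y b \<Longrightarrow> near (x * y) (a * b)"
    and near_or_inverse: "x \<noteq> 0 \<Longrightarrow> (\<exists>a. near x a) \<or> near (inverse x) 0"
    and pos_add: "pos x \<Longrightarrow> pos y \<Longrightarrow> pos (x + y)"
    and pos_mult: "pos x \<Longrightarrow> pos y \<Longrightarrow> pos (x * y)"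
    and pos_cases: "x \<noteq> 0 \<Longrightarrow> pos x \<or> pos (- x)"
    and not_pos_zero: "\<not> pos 0"
    and pos_near: "near x a \<Longrightarrow> 0 < a \<Longrightarrow> pos x"
begin

lemma pos_uminus_iff: "pos (- x) \<longleftrightarrow> x \<noteq> 0 \<and> \<not> pos x"
  using pos_add[of x "- x"] pos_cases[of x] not_pos_zero by auto

lemma pos_one: "pos 1"
  using pos_near[OF near_const, of 1] by (simp add: \<iota>_1)

lemma pos_power: "pos x \<Longrightarrow> pos (x ^ n)"
  by (induction n) (auto simp: pos_one pos_mult)

lemma pos_square: "x \<noteq> 0 \<Longrightarrow> pos (x * x)"
  using pos_cases[of x] pos_mult[of x x] pos_mult[of "- x" "- x"] by auto

lemma pos_mult_cancel: assumes "pos a" "pos (a * b)" shows "pos b"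
proof (rule ccontr)
  assume "\<not> pos b"
  moreover have "b \<noteq> 0" using assms not_pos_zero by auto
  ultimately have "pos (- b)" by (simp add: pos_uminus_iff)
  from pos_mult[OF assms(1) this] have "pos (- (a * b))" by simp
  then show False using assms(2) by (simp add: pos_uminus_iff)
qed

lemma pos_inverse: assumes "pos x" shows "pos (inverse x)"
proof -
  have "x \<noteq> 0" using assms not_pos_zero by auto
  then have "x * inverse x = 1" by simp
  then show ?thesis using pos_mult_cancel[of x "inverse x"] assms pos_one by simp
qed

lemma pos_divide: "pos x \<Longrightarrow> pos y \<Longrightarrow> pos (x / y)"
  by (simp add: divide_inverse pos_mult pos_inverse)

lemma near_uminus: "near x a \<Longrightarrow> near (- x) (- a)"
  using near_mult[OF near_const[of "-1"], of x a] by (simp add: \<iota>_uminus \<iota>_1)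

lemma near_diff: "near x a \<Longrightarrow> near y b \<Longrightarrow> near (x - y) (a - b)"
  using near_add[of x a "- y" "- b"] near_uminus[of y b] by simp

lemma near_pos_nonneg: "near x a \<Longrightarrow> pos x \<Longrightarrow> 0 \<le> a"
  using pos_near[OF near_uminus, of x a] pos_uminus_iff[of x] by (cases "a < 0") auto

lemma near_uev: "near x a \<Longrightarrow> near (uev x p) (poly p a)"
proof (induction p)
  case 0 then show ?case using near_const[of 0] by (simp add: \<iota>_0)
next
  case (pCons c p) then show ?case by (simp add: near_add near_mult near_const)
qed

lemma near_ev: "near x a \<Longrightarrow> near y b \<Longrightarrow> near (ev \<iota> x y f) (rv f a b)"
proof (induction f)
  case 0 then show ?case using near_const[of 0] by (simp add: \<iota>_0)
next
  case (pCons c p) then show ?case by (simp add: near_add near_mult near_uev)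
qed

lemma ev_neg_near_nonpos: "near x a \<Longrightarrow> near y b \<Longrightarrow> pos (- ev \<iota> x y f) \<Longrightarrow> rv f a b \<le> 0"
  using near_pos_nonneg[OF near_uminus[OF near_ev]] by fastforce

text \<open>A nonzero polynomial is a power of the variable times a factor that does not vanish at 0,
  and the latter has a definite sign on infinitesimals.\<close>
lemma univariate_neg_witness:
  assumes x: "near x 0" "pos x" and neg: "pos (- uev x p)" and "0 < d"
  shows "\<exists>t. 0 < t \<and> t < d \<and> poly p t < 0"
proof -
  have p0: "p \<noteq> 0" using neg not_pos_zero by auto
  define k where "k = order 0 p"
  from order_decomp[OF p0, of 0] obtain q where q: "p = [:0, 1:] ^ k * q" "\<not> [:- 0, 1:] dvd q"
    unfolding k_def by auto
  have q0: "poly q 0 \<noteq> 0" using q(2) poly_eq_0_iff_dvd[of q 0] by simp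
  have "- uev x p = x ^ k * (- uev x q)"
    unfolding q(1) by (simp add: uev_mult uev_power \<iota>_0 \<iota>_1)
  then have "pos (- uev x q)" using neg pos_mult_cancel[OF pos_power[OF x(2)]] by metis
  then have "poly q 0 \<le> 0" using near_pos_nonneg[OF near_uminus[OF near_uev[OF x(1)]]] by fastforce
  with q0 have "poly q 0 < 0" by simp
  moreover have "(poly q \<longlongrightarrow> poly q 0) (at_right 0)" by (intro tendsto_intros)
  ultimately have "\<forall>\<^sub>F t in at_right 0. poly q t < 0" by (simp add: order_tendstoD(2))
  then obtain b where b: "b > 0" "\<And>t. 0 < t \<Longrightarrow> t < b \<Longrightarrow> poly q t < 0"
    unfolding eventually_at_right_field by auto
  define t where "t = min b d / 2"
  have t: "0 < t" "t < b" "t < d" using b \<open>0 < d\<close> by (auto simp: t_def)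
  have "poly p t < 0" unfolding q(1) using b(2)[OF t(1,2)] t(1) by (simp add: poly_power mult_pos_neg)
  with t show ?thesis by auto
qed

end

section \<open>Restriction to the line x = 0 and blowing up at the origin\<close>

definition spec0 :: "real poly poly \<Rightarrow> real poly" where
  "spec0 f = map_poly (\<lambda>p. poly p 0) f"

lemma coeff_spec0 [simp]: "coeff (spec0 f) i = poly (coeff f i) 0"
  by (simp add: spec0_def coeff_map_poly)

lemma spec0_hom: "comm_ring_hom spec0"
proof -
  interpret m: map_poly_comm_ring_hom "\<lambda>p::real poly. poly p 0" ..
  have "spec0 = map_poly (\<lambda>p::real poly. poly p 0)" by (simp add: fun_eq_iff spec0_def)
  then show ?thesis using m.comm_ring_hom_axioms by simp
qed

lemma spec0_mult: "spec0 (f * g) = spec0 f * spec0 g"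
  and spec0_power: "spec0 (f ^ n) = spec0 f ^ n"
  and spec0_sum: "spec0 (\<Sum>i\<in>A. F i) = (\<Sum>i\<in>A. spec0 (F i))"
proof -
  interpret h: comm_ring_hom spec0 by (rule spec0_hom)
  show "spec0 (f * g) = spec0 f * spec0 g" "spec0 (f ^ n) = spec0 f ^ n" "spec0 (\<Sum>i\<in>A. F i) = (\<Sum>i\<in>A. spec0 (F i))"
    by (simp_all only: h.hom_mult h.hom_power h.hom_sum)
qed

lemma spec0_pCons [simp]: "spec0 (pCons p f) = pCons (poly p 0) (spec0 f)"
  by (rule poly_eqI) (simp add: coeff_pCons split: nat.split)

lemma spec0_0 [simp]: "spec0 0 = 0"
  by (rule poly_eqI) simp

lemma spec0_1 [simp]: "spec0 1 = 1"
  by (simp add: one_pCons)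

lemma rv_at_0: "rv f 0 y = poly (spec0 f) y"
  by (induction f) simp_all

lemma coeff_order_0_nonzero:
  fixes p :: "real poly"
  assumes "p \<noteq> 0" shows "coeff p (order 0 p) \<noteq> 0"
proof -
  from order_decomp[OF assms, of 0] obtain q where
    q: "p = [:0, 1:] ^ order 0 p * q" "\<not> [:- 0, 1:] dvd q" by auto
  have "p = monom 1 (order 0 p) * q" using q(1) by (simp add: monom_altdef)
  then have "coeff p (order 0 p) = coeff q 0" by (metis coeff_monom_mult diff_self_eq_0 mult_1 order_refl)
  then show ?thesis using q(2) poly_eq_0_iff_dvd[of q 0] by (simp add: poly_0_coeff_0)
qed

text \<open>The \<open>b i\<close> are the coefficients of the lowest homogeneous part of \<open>f\<close>, which has degree \<open>\<mu>\<close>.\<close>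
lemma blow_up:
  assumes "spec0 f \<noteq> 0"
  defines "m \<equiv> order 0 (spec0 f)"
  obtains \<mu> b where "\<mu> \<le> m" "\<exists>i\<le>\<mu>. b i \<noteq> (0::real)" "\<mu> = m \<Longrightarrow> b m \<noteq> 0"
    "\<And>P Q. \<exists>g. sub (polyX * P) (polyX * Q) f = polyX ^ \<mu> * g \<and>
       spec0 g = (\<Sum>i\<le>\<mu>. smult (b i) (spec0 P ^ (\<mu> - i) * spec0 Q ^ i))"
proof -
  obtain N where N: "degree f \<le> N" "\<And>i. degree (coeff f i) \<le> N" using exists_degree_bound[of f] by blast
  define a where "a i j = coeff (coeff f i) j" for i j
  have a0: "a i j = 0" if "i > N \<or> j > N" for i j
  proof (cases "i > N")
    case True
    then have "coeff f i = 0" using N(1) by (intro coeff_eq_0) linarith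
    then show ?thesis by (simp add: a_def)
  next
    case False
    then have "j > N" using that by simp
    then show ?thesis unfolding a_def using N(2)[of i] by (intro coeff_eq_0) linarith
  qed
  \<comment> \<open>The monomial \<open>y^m\<close> occurs in \<open>f\<close>, so the lowest degree
    of \<open>f\<close> is at most \<open>m\<close>.\<close>
  have am: "a m 0 \<noteq> 0" using coeff_order_0_nonzero[OF assms(1)] by (simp add: a_def m_def poly_0_coeff_0)
  define \<mu> where "\<mu> = (LEAST k. \<exists>i j. a i j \<noteq> 0 \<and> i + j = k)"
  have ex: "\<exists>i j. a i j \<noteq> 0 \<and> i + j = m" using am by (intro exI[of _ m] exI[of _ 0]) simp
  have mm: "\<mu> \<le> m" unfolding \<mu>_def by (rule Least_le) (rule ex)
  obtain i0 j0 where ij: "a i0 j0 \<noteq> 0" "i0 + j0 = \<mu>"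
    using LeastI[of "\<lambda>k. \<exists>i j. a i j \<noteq> 0 \<and> i + j = k", OF ex] unfolding \<mu>_def[symmetric] by blast
  have ge: "\<mu> \<le> i + j" if "a i j \<noteq> 0" for i j
    unfolding \<mu>_def by (rule Least_le) (use that in blast)
  have mN: "m \<le> N" using am a0[of m 0] by (meson not_le_imp_less)
  define b where "b i = a i (\<mu> - i)" for i
  have "\<exists>i\<le>\<mu>. b i \<noteq> 0" using ij by (intro exI[of _ i0]) (auto simp: b_def)
  moreover have "b m \<noteq> 0" if "\<mu> = m" using am that by (simp add: b_def)
  moreover have "\<exists>g. sub (polyX * P) (polyX * Q) f = polyX ^ \<mu> * g \<and>
       spec0 g = (\<Sum>i\<le>\<mu>. smult (b i) (spec0 P ^ (\<mu> - i) * spec0 Q ^ i))" for P Q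
  proof (intro exI conjI)
    \<comment> \<open>The truncated exponent \<open>i + j - \<mu>\<close> is harmless:
      \<open>a i j\<close> vanishes for \<open>i + j < \<mu>\<close>.\<close>
    let ?g = "\<Sum>i\<le>N. \<Sum>j\<le>N. polyC (a i j) * polyX ^ (i + j - \<mu>) * P ^ j * Q ^ i"
    have "sub (polyX * P) (polyX * Q) f =
        (\<Sum>i\<le>N. \<Sum>j\<le>N. polyC (a i j) * (polyX * P) ^ j * (polyX * Q) ^ i)"
      unfolding a_def using N by (rule polyC.ev_sum_form)
    also have "\<dots> = (\<Sum>i\<le>N. \<Sum>j\<le>N. polyX ^ \<mu> * (polyC (a i j) * polyX ^ (i + j - \<mu>) * P ^ j * Q ^ i))"
    proof (intro sum.cong refl)
      fix i j
      show "polyC (a i j) * (polyX * P) ^ j * (polyX * Q) ^ i =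
         polyX ^ \<mu> * (polyC (a i j) * polyX ^ (i + j - \<mu>) * P ^ j * Q ^ i)"
      proof (cases "a i j = 0")
        case False
        have "polyX ^ \<mu> * polyX ^ (i + j - \<mu>) = polyX ^ i * polyX ^ j"
          using ge[OF False] by (simp only: power_add[symmetric] le_add_diff_inverse)
        moreover have "polyX ^ \<mu> * (polyC (a i j) * polyX ^ (i + j - \<mu>) * P ^ j * Q ^ i)
           = polyC (a i j) * (polyX ^ \<mu> * polyX ^ (i + j - \<mu>)) * P ^ j * Q ^ i"
          by (simp only: ac_simps)
        ultimately show ?thesis by (simp only: power_mult_distrib ac_simps)
      qed simp
    qed
    finally show "sub (polyX * P) (polyX * Q) f = polyX ^ \<mu> * ?g"
      by (simp only: sum_distrib_left)
    have sX: "spec0 (polyX ^ k) = (if k = 0 then 1 else 0)" for k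
      by (simp add: spec0_power)
    \<comment> \<open>Setting \<open>x = 0\<close> keeps exactly the terms with
      \<open>i + j = \<mu>\<close>.\<close>
    have "spec0 ?g = (\<Sum>i\<le>N. \<Sum>j\<le>N. if i + j = \<mu> then smult (a i j) (spec0 P ^ j * spec0 Q ^ i) else 0)"
      unfolding spec0_sum
    proof (intro sum.cong refl)
      fix i j
      show "spec0 (polyC (a i j) * polyX ^ (i + j - \<mu>) * P ^ j * Q ^ i) =
        (if i + j = \<mu> then smult (a i j) (spec0 P ^ j * spec0 Q ^ i) else 0)"
        unfolding spec0_mult sX unfolding spec0_power using ge[of i j] by (cases "a i j = 0") auto
    qed
    also have "\<dots> = (\<Sum>i\<le>N. if i \<le> \<mu> then smult (b i) (spec0 P ^ (\<mu> - i) * spec0 Q ^ i) else 0)"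
    proof (intro sum.cong refl)
      fix i
      have "(\<Sum>j\<le>N. if i + j = \<mu> then smult (a i j) (spec0 P ^ j * spec0 Q ^ i) else 0) =
        (\<Sum>j\<le>N. if j = \<mu> - i then (if i \<le> \<mu> then smult (a i j) (spec0 P ^ j * spec0 Q ^ i) else 0) else 0)"
        by (intro sum.cong refl) auto
      also have "\<dots> = (if i \<le> \<mu> then smult (b i) (spec0 P ^ (\<mu> - i) * spec0 Q ^ i) else 0)"
        using mm mN unfolding sum.delta[OF finite_atMost] b_def by (cases "i \<le> \<mu>") auto
      finally show "(\<Sum>j\<le>N. if i + j = \<mu> then smult (a i j) (spec0 P ^ j * spec0 Q ^ i) else 0) =
        (if i \<le> \<mu> then smult (b i) (spec0 P ^ (\<mu> - i) * spec0 Q ^ i) else 0)" .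
    qed
    also have "\<dots> = (\<Sum>i\<le>\<mu>. smult (b i) (spec0 P ^ (\<mu> - i) * spec0 Q ^ i))"
      by (rule sum.mono_neutral_cong_right) (use mm mN in auto)
    finally show "spec0 ?g = (\<Sum>i\<le>\<mu>. smult (b i) (spec0 P ^ (\<mu> - i) * spec0 Q ^ i))" .
  qed
  ultimately show ?thesis using that mm by blast
qed

lemma uev_polyX [simp]: "polyC.uev polyX p = [:p:]"
  by (induction p) auto

text \<open>Chain rule for the derivative in \<open>y\<close>. A single term arises because
  \<open>polyX\<close> is constant in \<open>y\<close>.\<close>

lemma pderiv_sub: "pderiv (sub polyX Q f) = sub polyX Q (pderiv f) * pderiv Q"
proof (induction f)
  case 0 then show ?case by simp
next
  case (pCons p f)
  then show ?case
    by (simp add: pderiv_pCons pderiv_add pderiv_mult polyC.ev_add algebra_simps)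
qed

section \<open>A Bezout identity with the derivative\<close>

lemma prime_divisor_pos_degree:
  fixes g :: "real poly poly"
  assumes "g \<noteq> 0" "degree g > 0"
  shows "\<exists>p. prime_elem p \<and> p dvd g \<and> degree p > 0"
proof (rule ccontr)
  assume no: "\<not> ?thesis"
  obtain A where A: "\<And>p. p \<in># A \<Longrightarrow> prime_elem p" "normalize (prod_mset A) = normalize g"
    using prime_factorization_exists[OF assms(1)] by blast
  then have dvd: "g dvd prod_mset A" "prod_mset A dvd g" by (auto simp: associatedD1 associatedD2)
  then have nz: "prod_mset A \<noteq> 0" using assms(1) by auto
  have "degree p = 0" if "p \<in># A" for p
  proof -
    have "p dvd g" using dvd_prod_mset[OF that] dvd(2) by (rule dvd_trans)
    then have "\<not> 0 < degree p" using A(1)[OF that] exI[of _ p] no by (intro notI) (rule notE[OF no], intro exI conjI)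
    then show ?thesis by (simp only: not_gr_zero)
  qed
  then have "degree (prod_mset A) = 0"
  proof (induction A)
    case (add x A)
    have "degree (x * prod_mset A) \<le> degree x + degree (prod_mset A)" by (rule degree_mult_le)
    then show ?case using add by simp
  qed simp
  then show False using dvd_imp_degree_le[OF dvd(1) nz] assms(2) by simp
qed

text \<open>\<open>D\<close> takes the place of the discriminant of \<open>r\<close> in
  \<open>y\<close>. A nonzero element \<open>g\<close> of least degree in the ideal of
  \<open>r\<close> and \<open>pderiv r\<close> divides every element up to a factor from the
  coefficient ring, by pseudo-division. A prime factor of \<open>g\<close> of positive degree would
  thus divide \<open>r\<close> and \<open>pderiv r\<close>, hence occur twice in
  \<open>r\<close>.\<close>

lemma squarefree_bezout_pderiv:
  fixes r :: "real poly poly"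
  assumes "squarefree r" "degree r > 0"
  obtains u v D where "u * r + v * pderiv r = [:D:]" "D \<noteq> 0"
proof -
  define I where "I = {u * r + v * pderiv r | u v. True}"
  have r0: "r \<noteq> 0" using assms by auto
  have "r \<in> I" unfolding I_def by (rule CollectI, rule exI[of _ 1], rule exI[of _ 0]) simp
  have "pderiv r \<in> I" unfolding I_def by (rule CollectI, rule exI[of _ 0], rule exI[of _ 1]) simp
  have lin: "s * x - t * y \<in> I" if xy: "x \<in> I" "y \<in> I" for s t x y
  proof -
    obtain a b a' b' where "x = a * r + b * pderiv r" "y = a' * r + b' * pderiv r"
      using xy unfolding I_def by blast
    then have "s * x - t * y = (s * a - t * a') * r + (s * b - t * b') * pderiv r"
      by (simp add: algebra_simps)
    then show ?thesis unfolding I_def by blast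
  qed
  obtain g where g: "g \<in> I" "g \<noteq> 0" and min: "\<And>h. h \<in> I \<Longrightarrow> h \<noteq> 0 \<Longrightarrow> degree g \<le> degree h"
    using ex_has_least_nat[of "\<lambda>h. h \<in> I \<and> h \<noteq> 0" r degree] \<open>r \<in> I\<close> r0 by blast
  have dvd: "\<exists>c. c \<noteq> 0 \<and> g dvd smult c h" if h: "h \<in> I" for h
  proof -
    obtain q s where qs: "pseudo_divmod h g = (q, s)" by (cases "pseudo_divmod h g")
    define c where "c = coeff g (degree g) ^ (Suc (degree h) - degree g)"
    have eq: "smult c h = g * q + s" and s: "s = 0 \<or> degree s < degree g"
      using pseudo_divmod[OF g(2) qs] by (auto simp: c_def)
    have "s = [:c:] * h - q * g" using eq by (simp add: algebra_simps)
    then have "s \<in> I" using lin[OF h g(1)] by metis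
    then have "s = 0" using min[of s] s by fastforce
    moreover have "c \<noteq> 0" using g(2) by (simp add: c_def)
    ultimately show ?thesis using eq by auto
  qed
  have "degree g = 0"
  proof (rule ccontr)
    assume "degree g \<noteq> 0"
    then obtain p where p: "prime_elem p" "p dvd g" "degree p > 0"
      using prime_divisor_pos_degree g(2) by blast
    have pI: "p dvd h" if h: "h \<in> I" for h
    proof -
      from dvd[OF h] obtain c where c: "c \<noteq> 0" "g dvd smult c h" by blast
      then have "p dvd [:c:] * h" using p(2) by (auto intro: dvd_trans)
      then have "p dvd [:c:] \<or> p dvd h" using p(1) prime_elem_dvd_multD by blast
      moreover have "\<not> p dvd [:c:]"
      proof
        assume "p dvd [:c:]"
        then have "degree p \<le> degree [:c:]" by (rule dvd_imp_degree_le) (use c(1) in auto)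
        then show False using p(3) by simp
      qed
      ultimately show ?thesis by blast
    qed
    from pI[OF \<open>r \<in> I\<close>] obtain t where t: "r = p * t" by (elim dvdE)
    have "p dvd p * pderiv t + t * pderiv p" using pI[OF \<open>pderiv r \<in> I\<close>] by (simp add: t pderiv_mult)
    then have "p dvd t * pderiv p" by (simp add: dvd_add_right_iff)
    \<comment> \<open>In characteristic 0 the derivative of \<open>p\<close> is nonzero and of
      smaller degree.\<close>
    moreover have "\<not> p dvd pderiv p"
    proof
      assume a: "p dvd pderiv p"
      have "pderiv p \<noteq> 0" using p(3) by (simp add: pderiv_eq_0_iff)
      then have "degree p \<le> degree (pderiv p)" using a by (intro dvd_imp_degree_le)
      then show False using p(3) by (simp add: degree_pderiv)
    qed
    ultimately have "p dvd t" using p(1) prime_elem_dvd_multD by blast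
    then have "p ^ 2 dvd r" unfolding t power2_eq_square by (rule mult_dvd_mono[OF dvd_refl])
    then have "p dvd 1" using assms(1) squarefreeD by blast
    then show False using p(1) by (simp add: prime_elem_def)
  qed
  then obtain D where "g = [:D:]" by (rule degree_eq_zeroE)
  moreover obtain u v where "g = u * r + v * pderiv r" using g(1) unfolding I_def by blast
  ultimately show ?thesis using that[of u v D] g(2) by auto
qed

section \<open>Real points of negative sign near an infinitesimal point\<close>

context real_place
begin

text \<open>In the open quadrant powers of a coordinate are positive, so the factor split off by a
  blow-up does not change the sign; arbitrarily small \<open>d\<close> keeps images under the
  blow-up map close to 0.\<close>

definition has_neg_witnesses :: "real poly poly \<Rightarrow> bool" where
  "has_neg_witnesses f \<longleftrightarrow> (\<forall>\<xi> \<eta>. near \<xi> 0 \<longrightarrow> near \<eta> 0 \<longrightarrow> pos \<xi> \<longrightarrow> pos \<eta> \<longrightarrow> pos (- ev \<iota> \<xi> \<eta> f) \<longrightarrow>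
     (\<forall>d>0. \<exists>x y. 0 < x \<and> x < d \<and> 0 < y \<and> y < d \<and> rv f x y < 0))"

lemma has_neg_witnessesD:
  assumes "has_neg_witnesses f" "near \<xi> 0" "near \<eta> 0" "pos \<xi>" "pos \<eta>" "pos (- ev \<iota> \<xi> \<eta> f)" "0 < d"
  shows "\<exists>x y. 0 < x \<and> x < d \<and> 0 < y \<and> y < d \<and> rv f x y < 0"
  using assms unfolding has_neg_witnesses_def by blast

lemma witness_from_x_axis:
  assumes "0 < x" "x < d" "rv f x 0 < 0" "0 < d"
  shows "\<exists>x y. 0 < x \<and> x < d \<and> 0 < y \<and> y < d \<and> rv f x y < 0"
proof -
  from rv_neg_box[OF assms(3)] obtain e where e: "e > 0"
    "\<And>x' y'. \<bar>x' - x\<bar> < e \<Longrightarrow> \<bar>y' - 0\<bar> < e \<Longrightarrow> rv f x' y' < 0" by blast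
  have "rv f x (min e d / 2) < 0" by (rule e(2)) (use e assms in auto)
  then show ?thesis using e assms by (intro exI[of _ x] exI[of _ "min e d / 2"]) auto
qed

lemma witness_from_y_axis:
  assumes "0 < y" "y < d" "rv f 0 y < 0" "0 < d"
  shows "\<exists>x y. 0 < x \<and> x < d \<and> 0 < y \<and> y < d \<and> rv f x y < 0"
proof -
  from rv_neg_box[OF assms(3)] obtain e where e: "e > 0"
    "\<And>x' y'. \<bar>x' - 0\<bar> < e \<Longrightarrow> \<bar>y' - y\<bar> < e \<Longrightarrow> rv f x' y' < 0" by blast
  have "rv f (min e d / 2) y < 0" by (rule e(2)) (use e assms in auto)
  then show ?thesis using e assms by (intro exI[of _ "min e d / 2"] exI[of _ y]) auto
qed

text \<open>Here \<open>f\<close> does not vanish at the origin, so its sign there is its sign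
  nearby.\<close>

lemma witnesses_order_0:
  assumes "order 0 (spec0 f) = 0" "spec0 f \<noteq> 0"
  shows "has_neg_witnesses f"
  unfolding has_neg_witnesses_def
proof (intro allI impI)
  fix \<xi> \<eta> d assume a: "near \<xi> 0" "near \<eta> 0" "pos \<xi>" "pos \<eta>" "pos (- ev \<iota> \<xi> \<eta> f)" and d: "(0::real) < d"
  have "poly (spec0 f) 0 \<noteq> 0" using assms by (simp add: order_root)
  moreover have "rv f 0 0 \<le> 0" using ev_neg_near_nonpos[OF a(1,2,5)] .
  ultimately have "rv f 0 0 < 0" unfolding rv_at_0 by linarith
  then obtain e where e: "e > 0" "\<And>x' y'. \<bar>x' - 0\<bar> < e \<Longrightarrow> \<bar>y' - 0\<bar> < e \<Longrightarrow> rv f x' y' < 0"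
    using rv_neg_box by blast
  have "rv f (min e d / 2) (min e d / 2) < 0" by (rule e(2)) (use e d in auto)
  then show "\<exists>x y. 0 < x \<and> x < d \<and> 0 < y \<and> y < d \<and> rv f x y < 0"
    using e d by (intro exI[of _ "min e d / 2"]) auto
qed

text \<open>Write \<open>f = g(x) + y e1(x,y)\<close> with \<open>e1(0,0) \<noteq> 0\<close>. If
  \<open>e1(0,0) < 0\<close>, points on the y-axis work, as \<open>g(0) = 0\<close>. Otherwise
  \<open>\<eta> e1\<close> is positive, so \<open>g(\<xi>)\<close> has to be negative, and the case
  of one variable gives points on the x-axis. Continuity moves both into the open quadrant.\<close>

lemma witnesses_order_1:
  assumes "order 0 (spec0 f) = 1" "spec0 f \<noteq> 0"
  shows "has_neg_witnesses f"
  unfolding has_neg_witnesses_def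
proof (intro allI impI)
  fix \<xi> \<eta> d assume a: "near \<xi> 0" "near \<eta> 0" "pos \<xi>" "pos \<eta>" "pos (- ev \<iota> \<xi> \<eta> f)" and d: "(0::real) < d"
  obtain g e1 where f: "f = pCons g e1" using pCons_cases by blast
  have "coeff (spec0 f) 1 \<noteq> 0" using coeff_order_0_nonzero[OF assms(2)] assms(1) by simp
  then have c: "rv e1 0 0 \<noteq> 0" by (simp add: f rv_at_0 poly_0_coeff_0)
  have "poly (spec0 f) 0 = 0" using assms by (simp add: order_root)
  then have g0: "poly g 0 = 0" by (simp add: f)
  show "\<exists>x y. 0 < x \<and> x < d \<and> 0 < y \<and> y < d \<and> rv f x y < 0"
  proof (cases "rv e1 0 0 < 0")
    case True
    then obtain e where e: "e > 0" "\<And>x' y'. \<bar>x' - 0\<bar> < e \<Longrightarrow> \<bar>y' - 0\<bar> < e \<Longrightarrow> rv e1 x' y' < 0"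
      using rv_neg_box by blast
    define y where "y = min e d / 2"
    have y: "0 < y" "y < d" "y < e" using e d by (auto simp: y_def)
    have "rv e1 0 y < 0" by (rule e(2)) (use e y in auto)
    then have "rv f 0 y < 0" using y by (simp add: f g0 mult_pos_neg)
    then show ?thesis using witness_from_y_axis y d by blast
  next
    case False
    then have "pos (ev \<iota> \<xi> \<eta> e1)" using c pos_near[OF near_ev[OF a(1,2)], of e1] by simp
    then have "pos (\<eta> * ev \<iota> \<xi> \<eta> e1)" using a(4) pos_mult by blast
    from pos_add[OF a(5) this] have "pos (- uev \<xi> g)" by (simp add: f)
    from univariate_neg_witness[OF a(1,3) this d] obtain x where x: "0 < x" "x < d" "poly g x < 0" by blast
    then have "rv f x 0 < 0" by (simp add: f)
    then show ?thesis using witness_from_x_axis x d by blast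
  qed
qed

text \<open>With Bezout datum \<open>D\<close>, the pair (order at 0 of \<open>f(0,Y)\<close>, order at 0 of \<open>D\<close>) drops
  lexicographically under a blow-up.\<close>
lemma witnesses_bezout:
  assumes IH: "\<And>g. spec0 g \<noteq> 0 \<Longrightarrow> order 0 (spec0 g) < m \<Longrightarrow> has_neg_witnesses g"
    and "2 \<le> m" "spec0 f \<noteq> 0" "order 0 (spec0 f) = m"
    and "u * f + v * pderiv f = [:D:]" "D \<noteq> 0"
  shows "has_neg_witnesses f"
  using assms(3-)
proof (induction "order 0 D" arbitrary: f u v D rule: less_induct)
  case less
  note f = less.prems
  show ?case
    unfolding has_neg_witnesses_def
  proof (intro allI impI)
    fix \<xi> \<eta> d assume a: "near \<xi> 0" "near \<eta> 0" "pos \<xi>" "pos \<eta>" "pos (- ev \<iota> \<xi> \<eta> f)" and d: "(0::real) < d"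
    have nz: "\<xi> \<noteq> 0" "\<eta> \<noteq> 0" using a not_pos_zero by auto
    obtain \<mu> b where \<mu>: "\<mu> \<le> m" "\<exists>i\<le>\<mu>. b i \<noteq> (0::real)" "\<mu> = m \<Longrightarrow> b m \<noteq> 0" and
      bu: "\<And>P Q. \<exists>g. sub (polyX * P) (polyX * Q) f = polyX ^ \<mu> * g \<and>
       spec0 g = (\<Sum>i\<le>\<mu>. smult (b i) (spec0 P ^ (\<mu> - i) * spec0 Q ^ i))"
      using blow_up[OF f(1)] unfolding f(2) by blast
    \<comment> \<open>The slope of the point selects the chart:
      \<open>(x, x (c + \<sigma> y))\<close> if it is finite with standard part \<open>c\<close>,
      and \<open>(x y, x)\<close> if it is infinite.\<close>
    define z where "z = \<eta> / \<xi>"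
    have z: "z \<noteq> 0" "pos z" "\<eta> = \<xi> * z" using nz a by (auto simp: z_def pos_divide)
    show "\<exists>x y. 0 < x \<and> x < d \<and> 0 < y \<and> y < d \<and> rv f x y < 0"
    proof (cases "\<exists>c. near z c")
      case True
      then obtain c where c: "near z c" by blast
      have c0: "0 \<le> c" using near_pos_nonneg[OF c z(2)] .
      \<comment> \<open>The orientation \<open>\<sigma>\<close> makes the new coordinate
        \<open>t\<close> positive or zero. For \<open>c = 0\<close> it has to be 1, because the
        second coordinate \<open>x \<sigma> y\<close> of a witness must be positive.\<close>
      obtain \<sigma> :: real where \<sigma>: "\<sigma> * \<sigma> = 1" "pos (\<iota> \<sigma> * (z - \<iota> c)) \<or> z - \<iota> c = 0" "c = 0 \<Longrightarrow> \<sigma> = 1"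
      proof (cases "pos (z - \<iota> c) \<or> z - \<iota> c = 0")
        case True
        then show ?thesis using that[of 1] by (simp add: \<iota>_1)
      next
        case False
        then have "pos (- (z - \<iota> c))" using pos_uminus_iff by blast
        moreover have "c \<noteq> 0" using False z by (auto simp: \<iota>_0)
        ultimately show ?thesis using that[of "-1"] by (simp add: \<iota>_1 \<iota>_uminus)
      qed
      define t where "t = \<iota> \<sigma> * (z - \<iota> c)"
      have "near t (\<sigma> * (c - c))" unfolding t_def by (intro near_mult near_diff near_const c)
      then have t: "near t 0" by simp
      have zt: "z = \<iota> c + \<iota> \<sigma> * t"
      proof -
        have "\<iota> \<sigma> * t = \<iota> (\<sigma> * \<sigma>) * (z - \<iota> c)" by (simp only: t_def \<iota>_mult ac_simps)
        then show ?thesis by (simp add: \<sigma>(1) \<iota>_1)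
      qed
      define Q where "Q = [:[:c:], [:\<sigma>:]:]"
      obtain g where g: "sub (polyX * 1) (polyX * Q) f = polyX ^ \<mu> * g"
        "spec0 g = (\<Sum>i\<le>\<mu>. smult (b i) (spec0 1 ^ (\<mu> - i) * spec0 Q ^ i))" using bu by blast
      have evg: "ev \<iota> \<xi> \<eta> f = \<xi> ^ \<mu> * ev \<iota> \<xi> t g"
      proof -
        have "ev \<iota> \<xi> t (sub (polyX * 1) (polyX * Q) f) = \<xi> ^ \<mu> * ev \<iota> \<xi> t g"
          unfolding g(1) by (simp add: ev_mult ev_power \<iota>_0 \<iota>_1)
        moreover have "ev \<iota> \<xi> t Q = z" by (simp add: Q_def zt mult.commute \<iota>_0)
        ultimately show ?thesis by (simp only: ev_sub ev_mult ev_1 ev_polyX z(3) mult_1_right)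
      qed
      have rvg: "rv f x (x * (c + \<sigma> * y)) = x ^ \<mu> * rv g x y" for x y
      proof -
        have "rv (sub (polyX * 1) (polyX * Q) f) x y = x ^ \<mu> * rv g x y"
          unfolding g(1) by (simp add: evr.ev_mult evr.ev_power)
        moreover have "rv Q x y = c + \<sigma> * y" by (simp add: Q_def mult.commute)
        ultimately show ?thesis by (simp only: evr.ev_sub evr.ev_mult evr.ev_1 evr.ev_polyX mult_1_right)
      qed
      have neg: "pos (- ev \<iota> \<xi> t g)"
        using pos_mult_cancel[OF pos_power[OF a(3)], of \<mu> "- ev \<iota> \<xi> t g"] a(5) evg by simp
      \<comment> \<open>\<open>G\<close> is the lowest homogeneous part of \<open>f\<close> on the
        line \<open>x = 1\<close>. On the exceptional line \<open>g\<close> is \<open>G\<close>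
        after an affine change of variable, so its order is bounded by the degree of
        \<open>G\<close>.\<close>
      define G where "G = (\<Sum>i\<le>\<mu>. monom (b i) i)"
      have cG: "coeff G i = (if i \<le> \<mu> then b i else 0)" for i
        by (simp add: G_def coeff_sum)
      have G0: "G \<noteq> 0" using \<mu>(2) cG by (metis coeff_0)
      have dG: "degree G \<le> \<mu>" by (rule degree_le) (simp add: cG)
      have \<sigma>0: "\<sigma> \<noteq> 0" using \<sigma>(1) by auto
      have sg: "spec0 g = pcompose G [:c, \<sigma>:]"
        unfolding g(2) by (simp add: poly_eq_poly_eq_iff[symmetric] fun_eq_iff poly_pcompose poly_sum poly_monom G_def Q_def)
      have g0: "spec0 g \<noteq> 0" unfolding sg using pcompose_eq_0[of G "[:c, \<sigma>:]"] G0 \<sigma>0 by auto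
      have og: "order 0 (spec0 g) \<le> \<mu>"
      proof -
        have "degree (spec0 g) \<le> \<mu>" unfolding sg degree_pcompose using dG \<sigma>0 by simp
        then show ?thesis using order_degree[OF g0, of 0] by linarith
      qed
      \<comment> \<open>For \<open>x, y < d'\<close>: the bound 1 gives
        \<open>c + \<sigma> y < c + 1\<close>, the bound \<open>d / (c + 1)\<close> then gives
        \<open>x (c + \<sigma> y) < d\<close>, and the bound \<open>c\<close> keeps
        \<open>c + \<sigma> y\<close> positive when \<open>\<sigma> = -1\<close>.\<close>
      define d' where "d' = Min {d, 1, d / (c + 1), if c > 0 then c else 1}"
      have d': "d' > 0" "d' \<le> d" "d' \<le> 1" "d' \<le> d / (c + 1)" "c > 0 \<Longrightarrow> d' \<le> c"
        using d c0 by (auto simp: d'_def)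
      have "\<exists>x y. 0 < x \<and> x < d' \<and> 0 < y \<and> y < d' \<and> rv g x y < 0"
      proof (cases "t = 0")
        case True
        have "ev \<iota> \<xi> 0 g = uev \<xi> (coeff g 0)" by (cases g) simp
        with neg True have "pos (- uev \<xi> (coeff g 0))" by simp
        from univariate_neg_witness[OF a(1,3) this d'(1)] obtain x where
          x: "0 < x" "x < d'" "poly (coeff g 0) x < 0" by blast
        have "rv g x 0 = poly (coeff g 0) x" by (cases g) simp
        then show ?thesis using witness_from_x_axis x d'(1) by metis
      next
        case False
        then have "pos t" using \<sigma> unfolding t_def by auto
        moreover have "has_neg_witnesses g"
        proof (cases "order 0 (spec0 g) < m")
          case True then show ?thesis using IH g0 by blast
        next
          case False
          then have og': "order 0 (spec0 g) = m" and \<mu>m: "\<mu> = m" using og \<mu>(1) by auto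
          \<comment> \<open>The order did not drop. Substitute the chart into the Bezout identity
            and multiply by \<open>\<sigma> x\<close>: by the chain rule the right side becomes a
            multiple of \<open>x^\<mu>\<close>, and cancelling leaves a Bezout identity for
            \<open>g\<close> with \<open>D = x^(\<mu> - 1) D'\<close>.\<close>
          define s where "s = sub polyX (polyX * Q)"
          have sf: "s f = polyX ^ \<mu> * g" using g(1) by (simp add: s_def)
          have sD: "s [:D:] = [:D:]" by (simp add: s_def)
          have pQ: "pderiv (polyX * Q) = polyX * polyC \<sigma>" by (simp add: Q_def pderiv_pCons)
          have "s (pderiv f) * (polyX * polyC \<sigma>) = pderiv (polyX ^ \<mu> * g)"
            unfolding sf[symmetric] s_def pderiv_sub pQ ..
          also have "\<dots> = polyX ^ \<mu> * pderiv g"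
          proof -
            have "polyX ^ \<mu> = [:[:0,1:] ^ \<mu>:]" by (induction \<mu>) (auto simp: one_pCons)
            then show ?thesis by (simp add: pderiv_smult)
          qed
          finally have e1: "s (pderiv f) * (polyX * polyC \<sigma>) = polyX ^ \<mu> * pderiv g" .
          \<comment> \<open>Here \<open>2 \<le> m\<close> enters: the exponent
            \<open>\<mu> - 1\<close> is positive, so the order of \<open>D\<close> drops
            strictly.\<close>
          obtain k where k: "\<mu> = Suc k" "k \<ge> 1" using \<mu>m assms(2) by (cases \<mu>) auto
          define w where "w = polyX * polyC \<sigma> * s u * g + s v * pderiv g"
          have pC: "polyC \<sigma> * polyC \<sigma> = 1" using \<sigma>(1) by (simp add: one_pCons)
          have "[:D:] = s u * s f + s v * s (pderiv f)"
            using arg_cong[OF f(3), of s] unfolding sD by (simp only: s_def polyC.ev_add polyC.ev_mult)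
          then have "polyX * polyC \<sigma> * [:D:] = polyX * polyC \<sigma> * (s u * s f + s v * s (pderiv f))"
            by (simp only:)
          also have "\<dots> = polyX * polyC \<sigma> * s u * s f + s v * (s (pderiv f) * (polyX * polyC \<sigma>))"
            by (simp only: distrib_left ac_simps)
          also have "\<dots> = polyX ^ \<mu> * w"
            unfolding e1 sf w_def by (simp only: distrib_left ac_simps)
          also have "\<dots> = polyX * (polyX ^ k * w)" by (simp only: k(1) power_Suc mult.assoc)
          finally have "polyX * (polyC \<sigma> * [:D:]) = polyX * (polyX ^ k * w)" by (simp only: mult.assoc)
          moreover have "polyX \<noteq> 0" by simp
          ultimately have "polyC \<sigma> * [:D:] = polyX ^ k * w" using mult_left_cancel by blast
          then have "polyC \<sigma> * (polyC \<sigma> * [:D:]) = polyX ^ k * (polyC \<sigma> * w)"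
            by (simp only: ac_simps)
          then have Dw: "[:D:] = polyX ^ k * (polyC \<sigma> * w)"
            by (simp only: mult.assoc[symmetric] pC mult_1_left)
          define w' where "w' = polyC \<sigma> * w"
          have pk: "polyX ^ k = [:[:0,1:] ^ k:]" by (induction k) (auto simp: one_pCons)
          have sm: "[:D:] = smult ([:0,1:] ^ k) w'" using Dw unfolding w'_def[symmetric] pk by simp
          then have "degree w' = 0" by (metis degree_pCons_0 degree_smult_eq f(4) pCons_eq_0_iff smult_eq_0_iff)
          then obtain D' where D': "w' = [:D':]" by (rule degree_eq_zeroE)
          have DD: "D = [:0,1:] ^ k * D'" using sm unfolding D' by simp
          have D'0: "D' \<noteq> 0" using DD f(4) by auto
          have "order 0 D = k + order 0 D'"
            unfolding DD by (subst order_mult) (use DD f(4) order_power_n_n[of "0::real" k] in auto)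
          then have lt: "order 0 D' < order 0 D" using k(2) by simp
          have "(polyC \<sigma> * (polyX * polyC \<sigma> * s u)) * g + (polyC \<sigma> * s v) * pderiv g = [:D':]"
            unfolding D'[symmetric] w'_def w_def by (simp only: distrib_left mult.assoc)
          from less.hyps[OF lt g0 og' this D'0] show ?thesis .
        qed
        ultimately show ?thesis using has_neg_witnessesD[OF _ a(1) t a(3) _ neg d'(1)] by blast
      qed
      then obtain x y where xy: "0 < x" "x < d'" "0 < y" "y < d'" "rv g x y < 0" by blast
      have \<sigma>c: "\<sigma> = 1 \<or> \<sigma> = -1" using \<sigma>(1) by (simp add: square_eq_1_iff)
      have p: "0 < c + \<sigma> * y"
      proof (cases "c = 0")
        case True then show ?thesis using \<sigma>(3) xy by simp
      next
        case False
        then have "y < c" using d'(5) c0 xy by simp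
        then show ?thesis using \<sigma>c xy c0 by auto
      qed
      have "c + \<sigma> * y < c + 1" using \<sigma>c xy d'(3) by auto
      then have "x * (c + \<sigma> * y) < x * (c + 1)" using xy(1) by simp
      also have "x * (c + 1) < d / (c + 1) * (c + 1)"
        by (rule mult_strict_right_mono) (use xy d' c0 in auto)
      also have "\<dots> = d" using c0 by simp
      finally have "x * (c + \<sigma> * y) < d" .
      moreover have "rv f x (x * (c + \<sigma> * y)) < 0" unfolding rvg using xy by (simp add: mult_pos_neg)
      ultimately show ?thesis using xy d' p by (intro exI[of _ x] exI[of _ "x * (c + \<sigma> * y)"]) auto
    next
      case False
      with near_or_inverse[OF z(1)] have n: "near (inverse z) 0" by blast
      define t where "t = inverse z"
      have t: "near t 0" "pos t" unfolding t_def by (rule n, rule pos_inverse[OF z(2)])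
      have \<xi>t: "\<xi> = \<eta> * t" unfolding t_def z_def using nz by simp
      obtain g where g: "sub (polyX * polyY) (polyX * 1) f = polyX ^ \<mu> * g"
        "spec0 g = (\<Sum>i\<le>\<mu>. smult (b i) (spec0 polyY ^ (\<mu> - i) * spec0 1 ^ i))" using bu by blast
      have evg: "ev \<iota> \<xi> \<eta> f = \<eta> ^ \<mu> * ev \<iota> \<eta> t g"
      proof -
        have "ev \<iota> \<eta> t (sub (polyX * polyY) (polyX * 1) f) = \<eta> ^ \<mu> * ev \<iota> \<eta> t g"
          unfolding g(1) by (simp add: ev_mult ev_power \<iota>_0 \<iota>_1)
        then show ?thesis by (simp only: ev_sub ev_mult ev_1 ev_polyX ev_polyY \<xi>t[symmetric] mult_1_right)
      qed
      have rvg: "rv f (x * y) x = x ^ \<mu> * rv g x y" for x y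
      proof -
        have "rv (sub (polyX * polyY) (polyX * 1) f) x y = x ^ \<mu> * rv g x y"
          unfolding g(1) by (simp add: evr.ev_mult evr.ev_power)
        then show ?thesis by (simp only: evr.ev_sub evr.ev_mult evr.ev_1 evr.ev_polyX evr.ev_polyY mult_1_right)
      qed
      have neg: "pos (- ev \<iota> \<eta> t g)"
        using pos_mult_cancel[OF pos_power[OF a(4)], of \<mu> "- ev \<iota> \<eta> t g"] a(5) evg by simp
      have cg: "coeff (spec0 g) j = (if j \<le> \<mu> then b (\<mu> - j) else 0)" for j
      proof -
        have "spec0 g = (\<Sum>i\<le>\<mu>. monom (b i) (\<mu> - i))"
          unfolding g(2) by (simp add: monom_altdef)
        then have "coeff (spec0 g) j = (\<Sum>i\<le>\<mu>. if \<mu> - i = j then b i else 0)"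
          by (simp add: coeff_sum)
        also have "\<dots> = (\<Sum>i\<le>\<mu>. if i = \<mu> - j then (if j \<le> \<mu> then b i else 0) else 0)"
          by (intro sum.cong) auto
        finally show ?thesis by simp
      qed
      obtain i where i: "i \<le> \<mu>" "b i \<noteq> 0" using \<mu>(2) by blast
      have "coeff (spec0 g) (\<mu> - i) \<noteq> 0" unfolding cg using i by simp
      then have g0: "spec0 g \<noteq> 0" by (metis coeff_0)
      \<comment> \<open>In this chart \<open>spec0 g\<close> has the coefficients \<open>b i\<close>
        in reverse order: for \<open>\<mu> = m\<close> its constant term \<open>b m\<close> is
        nonzero, and otherwise its degree is already below \<open>m\<close>. So the first component
        of the measure drops.\<close>
      have "order 0 (spec0 g) < m"
      proof (cases "\<mu> = m")
        case True
        then have "poly (spec0 g) 0 \<noteq> 0" using cg[of 0] \<mu>(3) by (simp add: poly_0_coeff_0)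
        then show ?thesis using assms(2) by (simp add: order_root order_0I)
      next
        case False
        have "degree (spec0 g) \<le> \<mu>" by (rule degree_le) (simp only: cg, simp)
        then show ?thesis using order_degree[OF g0, of 0] \<mu>(1) False by linarith
      qed
      then have "has_neg_witnesses g" using IH g0 by blast
      from has_neg_witnessesD[OF this a(2) t(1) a(4) t(2) neg, of "min d 1"] d
      obtain x y where xy: "0 < x" "x < min d 1" "0 < y" "y < min d 1" "rv g x y < 0" by auto
      have "x * y < 1 * d" by (rule mult_strict_mono) (use xy in auto)
      moreover have "rv f (x * y) x < 0" unfolding rvg using xy by (simp add: mult_pos_neg)
      ultimately show ?thesis using xy by (intro exI[of _ "x * y"] exI[of _ x]) auto
    qed
  qed
qed

text \<open>From order 2 on, \<open>f\<close> is replaced by its squarefree part \<open>r\<close>: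
  it has no larger order, agrees with \<open>f\<close> in sign off the zeros of \<open>q\<close>,
  and admits a Bezout identity with its derivative.\<close>

lemma witnesses_all: "spec0 f \<noteq> 0 \<Longrightarrow> has_neg_witnesses f"
proof (induction "order 0 (spec0 f)" arbitrary: f rule: less_induct)
  case less
  define m where "m = order 0 (spec0 f)"
  have IH: "has_neg_witnesses g" if "spec0 g \<noteq> 0" "order 0 (spec0 g) < m" for g
    using less.hyps[of g] that by (simp add: m_def)
  consider "m = 0" | "m = 1" | "2 \<le> m" by linarith
  then show ?case
  proof cases
    case 1 then show ?thesis using witnesses_order_0 less.prems by (simp add: m_def)
  next
    case 2 then show ?thesis using witnesses_order_1 less.prems by (simp add: m_def)
  next
    case 3
    define r where "r = squarefree_part f"
    define q where "q = square_part f"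
    have fqr: "f = r * q ^ 2" unfolding r_def q_def by (rule squarefree_decompose)
    then have s: "spec0 f = spec0 r * spec0 q ^ 2" by (simp only: spec0_mult spec0_power)
    then have nz: "spec0 r \<noteq> 0" "spec0 q \<noteq> 0" using less.prems by auto
    then have q0: "q \<noteq> 0" by auto
    have om: "order 0 (spec0 r) \<le> m"
      unfolding m_def s by (subst order_mult) (use nz in auto)
    have "has_neg_witnesses r"
    proof (cases "order 0 (spec0 r) < m")
      case True then show ?thesis using IH nz by blast
    next
      case False
      then have o: "order 0 (spec0 r) = m" using om by simp
      have "degree (spec0 r) \<le> degree r" unfolding spec0_def by (rule degree_map_poly_le)
      then have "degree r > 0" using order_degree[OF nz(1), of 0] o 3 by linarith
      moreover have "squarefree r" unfolding r_def by (rule squarefree_squarefree_part)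
      ultimately obtain u v D where "u * r + v * pderiv r = [:D:]" "D \<noteq> 0"
        using squarefree_bezout_pderiv by blast
      then show ?thesis using witnesses_bezout[OF IH 3 nz(1) o] by blast
    qed
    show ?thesis
      unfolding has_neg_witnesses_def
    proof (intro allI impI)
      fix \<xi> \<eta> d assume a: "near \<xi> 0" "near \<eta> 0" "pos \<xi>" "pos \<eta>" "pos (- ev \<iota> \<xi> \<eta> f)" and d: "(0::real) < d"
      have e: "- ev \<iota> \<xi> \<eta> f = (ev \<iota> \<xi> \<eta> q * ev \<iota> \<xi> \<eta> q) * - ev \<iota> \<xi> \<eta> r"
        unfolding fqr by (simp add: ev_mult power2_eq_square)
      have "ev \<iota> \<xi> \<eta> q \<noteq> 0"
      proof
        assume "ev \<iota> \<xi> \<eta> q = 0"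
        with e a(5) not_pos_zero show False by simp
      qed
      then have "pos (- ev \<iota> \<xi> \<eta> r)" using pos_mult_cancel[OF pos_square] a(5) e by metis
      from has_neg_witnessesD[OF \<open>has_neg_witnesses r\<close> a(1-4) this d]
      obtain x y where xy: "0 < x" "x < d" "0 < y" "y < d" "rv r x y < 0" by blast
      from rv_neg_box[OF xy(5)] obtain e where e: "e > 0"
        "\<And>x' y'. \<bar>x' - x\<bar> < e \<Longrightarrow> \<bar>y' - y\<bar> < e \<Longrightarrow> rv r x' y' < 0" by blast
      \<comment> \<open>A witness for \<open>r\<close> is moved slightly off the zero set of
        \<open>q\<close>, so that \<open>r q^2\<close> is negative as well.\<close>
      obtain x' y' where x': "x < x'" "x' < min d (x + e)" "y < y'" "y' < min d (y + e)" "rv q x' y' \<noteq> 0"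
        using rv_nonzero_in_box[OF q0, of x "min d (x + e)" y "min d (y + e)"] e(1) xy by auto
      have "rv r x' y' < 0" by (rule e(2)) (use x' in auto)
      then have "rv f x' y' < 0" unfolding fqr using x'(5)
        by (simp add: evr.ev_mult evr.ev_power mult_neg_pos)
      then show "\<exists>x y. 0 < x \<and> x < d \<and> 0 < y \<and> y < d \<and> rv f x y < 0"
        using x' xy by (intro exI[of _ x'] exI[of _ y']) auto
    qed
  qed
qed

section \<open>From the open quadrant to all finite points\<close>

lemma near_unique: assumes "near x a" "near x b" shows "a = b"
  using pos_near[OF near_diff[OF assms(1) assms(2)]] pos_near[OF near_diff[OF assms(2) assms(1)]] not_pos_zero
  by (cases a b rule: linorder_cases) auto

lemma near_inverse: assumes "near x a" "a \<noteq> 0" shows "near (inverse x) (inverse a)"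
proof -
  have "near 0 0" using near_const[of 0] by (simp add: \<iota>_0)
  then have x0: "x \<noteq> 0" using near_unique assms by blast
  then consider b where "near (inverse x) b" | "near x 0"
    using near_or_inverse[of "inverse x"] by auto
  then show ?thesis
  proof cases
    case 1
    have "near 1 (a * b)" using near_mult[OF assms(1) 1] x0 by simp
    then have "a * b = 1" using near_unique near_const[of 1] by (metis \<iota>_1)
    then have "b = inverse a" by (metis inverse_unique)
    with 1 show ?thesis by simp
  next
    case 2 then show ?thesis using near_unique assms by blast
  qed
qed

text \<open>If \<open>spec0 g = 0\<close>, every coefficient of \<open>g\<close>, hence
  \<open>g\<close>, is divisible by \<open>x\<close>. Splitting off all factors \<open>x\<close>
  makes \<open>witnesses_all\<close> applicable.\<close>

lemma polyX_power_decomp: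
  assumes "f \<noteq> 0"
  obtains k g where "f = polyX ^ k * g" "spec0 g \<noteq> 0"
proof -
  have "\<not> is_unit polyX" by (simp add: is_unit_const_poly_iff is_unit_poly_iff)
  then obtain g where g: "f = polyX ^ multiplicity polyX f * g" "\<not> polyX dvd g"
    using multiplicity_decompose'[OF assms] by blast
  have "spec0 g \<noteq> 0"
  proof
    assume 0: "spec0 g = 0"
    have "[:0,1:] dvd coeff g n" for n
    proof -
      have "poly (coeff g n) 0 = 0" using 0 coeff_spec0[of g n] by simp
      then show ?thesis using poly_eq_0_iff_dvd[of "coeff g n" 0] by simp
    qed
    then have "polyX dvd g" by (simp add: const_poly_dvd_iff)
    with g(2) show False by blast
  qed
  with g(1) that show ?thesis by blast
qed

text \<open>An infinitesimal coordinate may be 0, which leaves an axis or the origin; there one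
  variable or the value at the origin decides.\<close>

lemma neg_witness_quadrant:
  assumes "near \<xi> 0" "near \<eta> 0" "pos \<xi> \<or> \<xi> = 0" "pos \<eta> \<or> \<eta> = 0"
    and neg: "pos (- ev \<iota> \<xi> \<eta> f)" and d: "0 < d"
  shows "\<exists>x y. 0 < x \<and> x < d \<and> 0 < y \<and> y < d \<and> rv f x y < 0"
proof -
  have "f \<noteq> 0" using neg not_pos_zero by auto
  then obtain k g where g: "f = polyX ^ k * g" "spec0 g \<noteq> 0" by (rule polyX_power_decomp)
  consider "\<xi> = 0" "\<eta> = 0" | "\<xi> = 0" "pos \<eta>" | "pos \<xi>" "\<eta> = 0" | "pos \<xi>" "pos \<eta>"
    using assms by blast
  then show ?thesis
  proof cases
    case 1
    have "ev \<iota> 0 0 f = \<iota> (rv f 0 0)"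
    proof (cases f)
      case (pCons p f')
      then show ?thesis by (cases p) simp
    qed
    then have "near (- ev \<iota> 0 0 f) (- rv f 0 0)" using near_uminus[OF near_const] by simp
    moreover have "rv f 0 0 \<noteq> 0" using 1 neg \<open>ev \<iota> 0 0 f = \<iota> (rv f 0 0)\<close> not_pos_zero by (auto simp: \<iota>_0)
    ultimately have "rv f 0 0 < 0" using near_pos_nonneg neg 1 by fastforce
    from rv_neg_box[OF this] obtain e where e: "e > 0"
      "\<And>x' y'. \<bar>x' - 0\<bar> < e \<Longrightarrow> \<bar>y' - 0\<bar> < e \<Longrightarrow> rv f x' y' < 0" by blast
    have "rv f (min e d / 2) (min e d / 2) < 0" by (rule e(2)) (use e d in auto)
    then show ?thesis using e d by (intro exI[of _ "min e d / 2"]) auto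
  next
    case 2
    have "ev \<iota> 0 \<eta> f = uev \<eta> (spec0 f)"
    proof (induction f)
      case (pCons p f) then show ?case by (cases p) simp
    qed simp
    then have "pos (- uev \<eta> (spec0 f))" using neg 2 by simp
    from univariate_neg_witness[OF assms(2) 2(2) this d] obtain y where
      y: "0 < y" "y < d" "rv f 0 y < 0" unfolding rv_at_0 by blast
    then show ?thesis using witness_from_y_axis d by blast
  next
    case 3
    have "ev \<iota> \<xi> 0 f = uev \<xi> (coeff f 0)" by (cases f) simp
    then have "pos (- uev \<xi> (coeff f 0))" using neg 3 by simp
    from univariate_neg_witness[OF assms(1) 3(1) this d] obtain x where
      x: "0 < x" "x < d" "poly (coeff f 0) x < 0" by blast
    have "rv f x 0 = poly (coeff f 0) x" by (cases f) simp
    then show ?thesis using witness_from_x_axis x d by metis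
  next
    case 4
    have "ev \<iota> \<xi> \<eta> f = \<xi> ^ k * ev \<iota> \<xi> \<eta> g" unfolding g(1) by (simp only: ev_mult ev_power ev_polyX)
    then have "pos (- ev \<iota> \<xi> \<eta> g)" using neg pos_mult_cancel[OF pos_power[OF 4(1)], of k "- ev \<iota> \<xi> \<eta> g"] by simp
    from has_neg_witnessesD[OF witnesses_all[OF g(2)] assms(1,2) 4 this d]
    obtain x y where xy: "0 < x" "x < d" "0 < y" "y < d" "rv g x y < 0" by blast
    have "rv f x y = x ^ k * rv g x y" unfolding g(1) by (simp only: evr.ev_mult evr.ev_power evr.ev_polyX)
    then have "rv f x y < 0" using xy by (simp add: mult_pos_neg)
    with xy show ?thesis by blast
  qed
qed

text \<open>Translate to the standard part and reflect the coordinates into the closed quadrant. The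
  first one is not reflected if \<open>\<xi>\<close> exceeds \<open>a\<close>; the last conjunct
  records this and later keeps witnesses on the inner side of the boundary circle.\<close>

lemma neg_witness:
  assumes "near \<xi> a" "near \<eta> b" "pos (- ev \<iota> \<xi> \<eta> f)" "0 < d"
  shows "\<exists>x y. \<bar>x - a\<bar> < d \<and> \<bar>y - b\<bar> < d \<and> rv f x y < 0 \<and> (pos (\<xi> - \<iota> a) \<longrightarrow> a < x)"
proof -
  have sgn: "\<exists>s\<in>{1,-1}. (pos (\<iota> s * z) \<or> \<iota> s * z = 0) \<and> (pos z \<longrightarrow> s = 1)" for z
  proof (cases "pos z \<or> z = 0")
    case True then show ?thesis by (intro bexI[of _ 1]) (auto simp: \<iota>_1)
  next
    case False
    then have "pos (- z)" using pos_uminus_iff by blast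
    then show ?thesis using False by (intro bexI[of _ "-1"]) (auto simp: \<iota>_1 \<iota>_uminus)
  qed
  obtain s where s: "s \<in> {1,-1}" "pos (\<iota> s * (\<xi> - \<iota> a)) \<or> \<iota> s * (\<xi> - \<iota> a) = 0" "pos (\<xi> - \<iota> a) \<longrightarrow> s = 1"
    using sgn[of "\<xi> - \<iota> a"] by blast
  obtain t where t: "t \<in> {1,-1}" "pos (\<iota> t * (\<eta> - \<iota> b)) \<or> \<iota> t * (\<eta> - \<iota> b) = 0"
    using sgn[of "\<eta> - \<iota> b"] by blast
  have sq: "\<iota> s * (\<iota> s * z) = z" "\<iota> t * (\<iota> t * z) = z" for z
    using s(1) t(1) by (auto simp: \<iota>_1 \<iota>_uminus)
  define P where "P = [:[:a, s:]:]"
  define Q where "Q = [:[:b:], [:t:]:]"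
  define x' where "x' = \<iota> s * (\<xi> - \<iota> a)"
  define y' where "y' = \<iota> t * (\<eta> - \<iota> b)"
  have "ev \<iota> x' y' P = \<iota> a + \<iota> s * x'" "ev \<iota> x' y' Q = \<iota> b + \<iota> t * y'"
    by (simp_all add: P_def Q_def \<iota>_0 mult.commute)
  then have "ev \<iota> x' y' P = \<xi>" "ev \<iota> x' y' Q = \<eta>"
    unfolding x'_def y'_def sq by simp_all
  then have "ev \<iota> x' y' (sub P Q f) = ev \<iota> \<xi> \<eta> f" by (simp only: ev_sub)
  then have neg: "pos (- ev \<iota> x' y' (sub P Q f))" using assms(3) by simp
  have "near x' (s * (a - a))" unfolding x'_def by (intro near_mult near_diff near_const assms)
  then have x0: "near x' 0" by simp
  have "near y' (t * (b - b))" unfolding y'_def by (intro near_mult near_diff near_const assms)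
  then have y0: "near y' 0" by simp
  obtain x y where xy: "0 < x" "x < d" "0 < y" "y < d" "rv (sub P Q f) x y < 0"
    using neg_witness_quadrant[OF x0 y0 _ _ neg assms(4)] s(2) t(2) unfolding x'_def y'_def by blast
  have "rv P x y = a + s * x" "rv Q x y = b + t * y" by (simp_all add: P_def Q_def mult.commute)
  then have "rv f (a + s * x) (b + t * y) < 0" using xy(5) by (simp only: evr.ev_sub)
  then show ?thesis using xy(1-4) s(1,3) t(1) by (intro exI[of _ "a + s * x"] exI[of _ "b + t * y"]) auto
qed

end

subsection \<open>Ordered fields\<close>

definition field_preordering :: "'a::field set \<Rightarrow> bool" where
  "field_preordering T \<longleftrightarrow> (\<forall>x\<in>T. \<forall>y\<in>T. x + y \<in> T \<and> x * y \<in> T) \<and> (\<forall>x. x * x \<in> T) \<and> - 1 \<notin> T"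

text \<open>Zorn. If \<open>x\<close> is missing from a maximal \<open>P\<close>, then
  \<open>P + x P\<close> is closed under the operations and larger, so it contains -1; solving
  \<open>-1 = a + x b\<close> for \<open>- x\<close> puts \<open>- x\<close> into
  \<open>P\<close>.\<close>

lemma preordering_extends:
  assumes "field_preordering T"
  obtains P where "T \<subseteq> P" "field_preordering P" "\<And>x. x \<in> P \<or> - x \<in> P"
proof -
  define \<A> where "\<A> = {P. T \<subseteq> P \<and> field_preordering P}"
  have "T \<in> \<A>" using assms by (simp add: \<A>_def)
  have "\<Union>\<C> \<in> \<A>" if c: "\<C> \<noteq> {}" "subset.chain \<A> \<C>" for \<C>
  proof -
    have sub: "\<C> \<subseteq> \<A>" and lin: "\<And>X Y. X \<in> \<C> \<Longrightarrow> Y \<in> \<C> \<Longrightarrow> X \<subseteq> Y \<or> Y \<subseteq> X"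
      using c(2) by (auto simp: subset.chain_def)
    obtain X where X: "X \<in> \<C>" using c(1) by blast
    have "T \<subseteq> \<Union>\<C>" using X sub by (auto simp: \<A>_def)
    moreover have "x + y \<in> \<Union>\<C> \<and> x * y \<in> \<Union>\<C>" if xy: "x \<in> \<Union>\<C>" "y \<in> \<Union>\<C>" for x y
    proof -
      obtain Y1 Y2 where "Y1 \<in> \<C>" "x \<in> Y1" "Y2 \<in> \<C>" "y \<in> Y2" using xy by blast
      then obtain Y where Y: "Y \<in> \<C>" "x \<in> Y" "y \<in> Y"
        using lin[of Y1 Y2] by (cases "Y1 \<subseteq> Y2") (auto dest: subsetD)
      then have "field_preordering Y" using sub by (auto simp: \<A>_def)
      then show ?thesis using Y unfolding field_preordering_def by blast
    qed
    moreover have "x * x \<in> \<Union>\<C>" for x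
      using X sub unfolding \<A>_def field_preordering_def by blast
    moreover have "- 1 \<notin> \<Union>\<C>" using sub unfolding \<A>_def field_preordering_def by blast
    ultimately show ?thesis by (simp add: \<A>_def field_preordering_def)
  qed
  then obtain P where P: "P \<in> \<A>" and max: "\<And>X. X \<in> \<A> \<Longrightarrow> P \<subseteq> X \<Longrightarrow> X = P"
    using subset_Zorn_nonempty[of \<A>] \<open>T \<in> \<A>\<close> by blast
  have TP: "T \<subseteq> P" and pP: "field_preordering P" using P by (auto simp: \<A>_def)
  have add: "x + y \<in> P" and mult: "x * y \<in> P" if "x \<in> P" "y \<in> P" for x y
    using pP that unfolding field_preordering_def by auto
  have sq: "x * x \<in> P" for x using pP unfolding field_preordering_def by auto
  have m1: "- 1 \<notin> P" using pP unfolding field_preordering_def by auto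
  have zo: "0 \<in> P" "1 \<in> P" using sq[of 0] sq[of 1] by auto
  have "- x \<in> P" if x: "x \<notin> P" for x
  proof -
    define X where "X = {a + x * b | a b. a \<in> P \<and> b \<in> P}"
    have "P \<subseteq> X"
    proof
      fix a assume "a \<in> P"
      then show "a \<in> X" unfolding X_def using zo by (intro CollectI exI[of _ a] exI[of _ 0]) simp
    qed
    moreover have "x \<in> X" unfolding X_def using zo by (intro CollectI exI[of _ 0] exI[of _ 1]) simp
    ultimately have "X \<notin> \<A>" using max x by blast
    moreover have "y + z \<in> X \<and> y * z \<in> X" if yz: "y \<in> X" "z \<in> X" for y z
    proof -
      obtain a b a' b' where e: "y = a + x * b" "z = a' + x * b'" "a \<in> P" "b \<in> P" "a' \<in> P" "b' \<in> P"
        using yz unfolding X_def by blast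
      have "y + z = (a + a') + x * (b + b')" using e by (simp add: algebra_simps)
      moreover have "y * z = (a * a' + (x * x) * (b * b')) + x * (a * b' + b * a')"
        using e by (simp add: algebra_simps)
      moreover have "a + a' \<in> P" "b + b' \<in> P" "a * a' + (x * x) * (b * b') \<in> P" "a * b' + b * a' \<in> P"
        by (intro add mult sq e)+
      ultimately show ?thesis unfolding X_def by auto
    qed
    moreover have "T \<subseteq> X" using TP \<open>P \<subseteq> X\<close> by blast
    moreover have "y * y \<in> X" for y using sq \<open>P \<subseteq> X\<close> by blast
    ultimately have "- 1 \<in> X" by (auto simp: \<A>_def field_preordering_def)
    then obtain a b where ab: "- 1 = a + x * b" "a \<in> P" "b \<in> P" unfolding X_def by blast
    have "b \<noteq> 0" using ab m1 by auto
    have "x * b = - 1 - a" using ab(1) by (simp add: algebra_simps)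
    then have "- x * b = 1 + a" by simp
    then have "- x = (1 + a) / b" using nonzero_eq_divide_eq[OF \<open>b \<noteq> 0\<close>] by blast
    \<comment> \<open>The inverse of \<open>b\<close> is \<open>b\<close> times a square.\<close>
    also have "\<dots> = (1 + a) * (b * (inverse b * inverse b))" using \<open>b \<noteq> 0\<close> by (simp add: field_simps)
    also have "\<dots> \<in> P" by (intro mult add sq zo ab)
    finally show ?thesis .
  qed
  then show ?thesis using that TP pP by blast
qed

locale ordered_real_alg = real_alg \<iota> for \<iota> :: "real \<Rightarrow> 'e::field" +
  fixes P :: "'e set"
  assumes preP: "field_preordering P" and totP: "x \<in> P \<or> - x \<in> P"
begin

lemma P_add: "x \<in> P \<Longrightarrow> y \<in> P \<Longrightarrow> x + y \<in> P"
  and P_mult: "x \<in> P \<Longrightarrow> y \<in> P \<Longrightarrow> x * y \<in> P"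
  and P_square: "x * x \<in> P" and m1_P: "- 1 \<notin> P"
  using preP unfolding field_preordering_def by auto

lemma P_antisym: assumes "x \<in> P" "- x \<in> P" shows "x = 0"
proof (rule ccontr)
  assume x: "x \<noteq> 0"
  have "(x * - x) * (inverse x * inverse x) \<in> P" by (intro P_mult P_square assms)
  moreover have "(x * - x) * (inverse x * inverse x) = - 1" using x by (simp add: field_simps)
  ultimately show False using m1_P by simp
qed

lemma P_inverse: assumes "x \<in> P" shows "inverse x \<in> P"
proof -
  have "x * (inverse x * inverse x) \<in> P" by (intro P_mult P_square assms)
  moreover have "x * (inverse x * inverse x) = inverse x" by (cases "x = 0") auto
  ultimately show ?thesis by simp
qed

lemma P_\<iota>: assumes "0 \<le> r" shows "\<iota> r \<in> P"
proof -
  have "\<iota> r = \<iota> (sqrt r) * \<iota> (sqrt r)" using assms by (simp add: \<iota>_mult[symmetric])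
  then show ?thesis using P_square by metis
qed

lemma not_P_\<iota>: assumes "r < 0" shows "\<iota> r \<notin> P"
proof
  assume "\<iota> r \<in> P"
  moreover have "\<iota> (- 1 / r) \<in> P" by (rule P_\<iota>) (use assms in \<open>simp add: divide_nonneg_neg divide_nonpos_neg\<close>)
  ultimately have "\<iota> (r * (- 1 / r)) \<in> P" unfolding \<iota>_mult by (rule P_mult)
  then show False using assms m1_P by (simp add: \<iota>_uminus \<iota>_1)
qed

section \<open>The place of an ordering: infinitesimals and standard parts\<close>

definition small :: "'e \<Rightarrow> bool" where
  "small x \<longleftrightarrow> (\<forall>e>0. \<iota> e - x \<in> P \<and> \<iota> e + x \<in> P)"

definition bdd :: "'e \<Rightarrow> bool" where
  "bdd x \<longleftrightarrow> (\<exists>B>0. \<iota> B - x \<in> P \<and> \<iota> B + x \<in> P)"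

text \<open>Twice \<open>r s - x y\<close> is \<open>(r - x) (s + y) + (r + x) (s - y)\<close>; the
  other bound follows with the sign of \<open>y\<close> changed.\<close>

lemma abs_mult_bound:
  assumes "\<iota> r - x \<in> P" "\<iota> r + x \<in> P" "\<iota> s - y \<in> P" "\<iota> s + y \<in> P"
  shows "\<iota> (r * s) - x * y \<in> P" "\<iota> (r * s) + x * y \<in> P"
proof -
  have h: "\<iota> (1/2) \<in> P" by (rule P_\<iota>) simp
  have two: "\<iota> (1/2) * (z + z) = z" for z
  proof -
    have "\<iota> (1/2) + \<iota> (1/2) = \<iota> (1/2 + 1/2)" by (simp only: \<iota>_add)
    then have "\<iota> (1/2) + \<iota> (1/2) = 1" by (simp add: \<iota>_1)
    then show ?thesis by (metis distrib_left distrib_right mult_1_left)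
  qed
  have "\<iota> (r * s) - x * y = \<iota> (1/2) * ((\<iota> (r * s) - x * y) + (\<iota> (r * s) - x * y))" by (simp only: two)
  also have "\<dots> = \<iota> (1/2) * ((\<iota> r - x) * (\<iota> s + y) + (\<iota> r + x) * (\<iota> s - y))"
    by (simp add: \<iota>_mult algebra_simps)
  also have "\<dots> \<in> P" by (intro P_mult P_add h assms)
  finally show "\<iota> (r * s) - x * y \<in> P" .
  have "\<iota> (r * s) + x * y = \<iota> (1/2) * ((\<iota> (r * s) + x * y) + (\<iota> (r * s) + x * y))" by (simp only: two)
  also have "\<dots> = \<iota> (1/2) * ((\<iota> r - x) * (\<iota> s - y) + (\<iota> r + x) * (\<iota> s + y))"
    by (simp add: \<iota>_mult algebra_simps)
  also have "\<dots> \<in> P" by (intro P_mult P_add h assms)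
  finally show "\<iota> (r * s) + x * y \<in> P" .
qed

lemma small_add: assumes "small x" "small y" shows "small (x + y)"
  unfolding small_def
proof (intro allI impI)
  fix e :: real assume e: "0 < e"
  then have h: "\<iota> (e/2) - x \<in> P" "\<iota> (e/2) + x \<in> P" "\<iota> (e/2) - y \<in> P" "\<iota> (e/2) + y \<in> P"
    using assms unfolding small_def by simp_all
  have "(\<iota> (e/2) - x) + (\<iota> (e/2) - y) \<in> P" "(\<iota> (e/2) + x) + (\<iota> (e/2) + y) \<in> P" by (rule P_add; fact h)+
  moreover have "\<iota> e = \<iota> (e/2) + \<iota> (e/2)" by (simp add: \<iota>_add[symmetric])
  ultimately show "\<iota> e - (x + y) \<in> P \<and> \<iota> e + (x + y) \<in> P" by (simp add: algebra_simps)
qed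

lemma small_bdd_mult: assumes "small x" "bdd y" shows "small (x * y)"
  unfolding small_def
proof (intro allI impI)
  fix e :: real assume e: "0 < e"
  obtain B where B: "B > 0" "\<iota> B - y \<in> P" "\<iota> B + y \<in> P" using assms(2) unfolding bdd_def by blast
  have "\<iota> (e / B) - x \<in> P" "\<iota> (e / B) + x \<in> P" using assms(1) e B(1) unfolding small_def by simp_all
  from abs_mult_bound[OF this B(2,3)] B(1) show "\<iota> e - x * y \<in> P \<and> \<iota> e + x * y \<in> P" by simp
qed

lemma small_zero: "small 0" by (simp add: small_def P_\<iota>)

lemma small_uminus: "small x \<Longrightarrow> small (- x)" by (auto simp: small_def)

lemma small_imp_bdd: "small x \<Longrightarrow> bdd x" unfolding small_def bdd_def by (intro exI[of _ 1]) auto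

lemma bdd_\<iota>: "bdd (\<iota> r)"
  unfolding bdd_def
  by (intro exI[of _ "\<bar>r\<bar> + 1"]) (auto simp: \<iota>_add[symmetric] \<iota>_minus[symmetric] intro!: P_\<iota>)

lemma bdd_add: assumes "bdd x" "bdd y" shows "bdd (x + y)"
proof -
  obtain B C where B: "B > 0" "\<iota> B - x \<in> P" "\<iota> B + x \<in> P" and C: "C > 0" "\<iota> C - y \<in> P" "\<iota> C + y \<in> P"
    using assms unfolding bdd_def by blast
  have "(\<iota> B - x) + (\<iota> C - y) \<in> P" "(\<iota> B + x) + (\<iota> C + y) \<in> P" by (rule P_add; fact)+
  then have "\<iota> (B + C) - (x + y) \<in> P" "\<iota> (B + C) + (x + y) \<in> P" by (simp_all add: \<iota>_add algebra_simps)
  then show ?thesis using B C unfolding bdd_def by (intro exI[of _ "B + C"]) simp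
qed

definition near :: "'e \<Rightarrow> real \<Rightarrow> bool" where "near x a \<longleftrightarrow> small (x - \<iota> a)"

text \<open>The standard part is the supremum of the reals below \<open>x\<close>, by completeness
  of the reals.\<close>

lemma bdd_near: assumes "bdd x" shows "\<exists>a. near x a"
proof -
  obtain B where B: "B > 0" "\<iota> B - x \<in> P" "\<iota> B + x \<in> P" using assms unfolding bdd_def by blast
  define S where "S = {q. x - \<iota> q \<in> P}"
  have ne: "- B \<in> S" using B(3) by (simp add: S_def \<iota>_uminus add.commute)
  have "q \<le> B" if "q \<in> S" for q
  proof (rule ccontr)
    assume "\<not> q \<le> B"
    have "(\<iota> B - x) + (x - \<iota> q) \<in> P" using that unfolding S_def by (intro P_add B(2)) simp
    then have "\<iota> (B - q) \<in> P" by (simp add: \<iota>_minus)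
    then show False using not_P_\<iota>[of "B - q"] \<open>\<not> q \<le> B\<close> by simp
  qed
  then have bd: "bdd_above S" by (auto simp: bdd_above_def)
  have "small (x - \<iota> (Sup S))"
    unfolding small_def
  proof (intro allI impI conjI)
    fix e :: real assume e: "0 < e"
    have "Sup S - e < Sup S" using e by simp
    then obtain q where q: "q \<in> S" "Sup S - e < q" using less_cSup_iff[of S] ne bd by blast
    have "(x - \<iota> q) + \<iota> (q - (Sup S - e)) \<in> P" by (rule P_add) (use q in \<open>auto simp: S_def intro: P_\<iota>\<close>)
    moreover have "(x - \<iota> q) + \<iota> (q - (Sup S - e)) = \<iota> e + (x - \<iota> (Sup S))" by (simp add: \<iota>_minus)
    ultimately show "\<iota> e + (x - \<iota> (Sup S)) \<in> P" by (simp only:)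
    have "Sup S + e \<notin> S"
    proof
      assume "Sup S + e \<in> S"
      then have "Sup S + e \<le> Sup S" using bd by (rule cSup_upper)
      then show False using e by simp
    qed
    then have "- (x - \<iota> (Sup S + e)) \<in> P" using totP unfolding S_def by blast
    moreover have "- (x - \<iota> (Sup S + e)) = \<iota> e - (x - \<iota> (Sup S))" by (simp add: \<iota>_add)
    ultimately show "\<iota> e - (x - \<iota> (Sup S)) \<in> P" by (simp only:)
  qed
  then show ?thesis unfolding near_def by blast
qed

lemma small_inverse_unbounded:
  assumes "\<not> bdd x" "x \<in> P" shows "small (inverse x)"
  unfolding small_def
proof (intro allI impI conjI)
  fix e :: real assume e: "0 < e"
  show "\<iota> e + inverse x \<in> P" by (intro P_add P_\<iota> P_inverse) (use e assms in auto)
  have "\<iota> (1 / e) + x \<in> P" by (intro P_add P_\<iota>) (use e assms in auto)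
  then have "\<iota> (1 / e) - x \<notin> P" using assms(1) e unfolding bdd_def by force
  then have "x - \<iota> (1 / e) \<in> P" using totP[of "\<iota> (1 / e) - x"] by simp
  then have "\<iota> e * ((x - \<iota> (1 / e)) * inverse x) \<in> P"
    by (intro P_mult P_\<iota> P_inverse) (use e assms in auto)
  moreover have "\<iota> e * ((x - \<iota> (1 / e)) * inverse x) = \<iota> e - inverse x"
  proof -
    have x0: "x \<noteq> 0" using assms(1) small_imp_bdd[OF small_zero] by auto
    have "\<iota> e * \<iota> (1 / e) = 1" using e by (simp add: \<iota>_mult[symmetric] \<iota>_1)
    then have "\<iota> e * (\<iota> (1 / e) * inverse x) = inverse x" by (simp add: mult.assoc[symmetric])
    then show ?thesis using x0 by (simp add: left_diff_distrib right_diff_distrib)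
  qed
  ultimately show "\<iota> e - inverse x \<in> P" by simp
qed

lemma near_zero_iff: "near x 0 \<longleftrightarrow> small x" by (simp add: near_def \<iota>_0)

lemma bdd_of_near: assumes "near x a" shows "bdd x"
  using bdd_add[OF small_imp_bdd bdd_\<iota>, of "x - \<iota> a" a] assms by (simp add: near_def)

text \<open>The finite elements form a valuation ring with the infinitesimals as maximal ideal and
  the reals as residue field.\<close>

sublocale real_place \<iota> "\<lambda>x. x \<in> P \<and> x \<noteq> 0" near
proof
  show "near (\<iota> r) r" for r by (simp add: near_def small_zero)
  show "near (x + y) (a + b)" if "near x a" "near y b" for x y a b
    using small_add[of "x - \<iota> a" "y - \<iota> b"] that by (simp add: near_def \<iota>_add algebra_simps)
  show "near (x * y) (a * b)" if "near x a" "near y b" for x y a b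
  proof -
    have "small ((x - \<iota> a) * y)" "small ((y - \<iota> b) * \<iota> a)"
      using that small_bdd_mult bdd_of_near bdd_\<iota> unfolding near_def by blast+
    from small_add[OF this] show ?thesis by (simp add: near_def \<iota>_mult algebra_simps)
  qed
  show "(\<exists>a. near x a) \<or> near (inverse x) 0" if "x \<noteq> 0" for x
  proof (cases "bdd x")
    case True then show ?thesis using bdd_near by blast
  next
    case False
    have m: "bdd (- x) = bdd x" by (auto simp: bdd_def)
    show ?thesis
    proof (cases "x \<in> P")
      case True then show ?thesis using small_inverse_unbounded False by (simp add: near_zero_iff)
    next
      case xP: False
      then have "- x \<in> P" using totP by blast
      then have "small (inverse (- x))" using small_inverse_unbounded False m by blast
      from small_uminus[OF this] show ?thesis by (simp add: near_zero_iff)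
    qed
  qed
  show "x + y \<in> P \<and> x + y \<noteq> 0" if "x \<in> P \<and> x \<noteq> 0" "y \<in> P \<and> y \<noteq> 0" for x y
    using that P_add P_antisym[of y] by (metis add_eq_0_iff2 minus_unique neg_equal_iff_equal)
  show "x * y \<in> P \<and> x * y \<noteq> 0" if "x \<in> P \<and> x \<noteq> 0" "y \<in> P \<and> y \<noteq> 0" for x y
    using that P_mult by simp
  show "x \<in> P \<and> x \<noteq> 0 \<or> - x \<in> P \<and> - x \<noteq> 0" if "x \<noteq> 0" for x using that totP by auto
  show "\<not> (0 \<in> P \<and> (0::'e) \<noteq> 0)" by simp
  show "x \<in> P \<and> x \<noteq> 0" if "near x a" "0 < a" for x a
  proof -
    have "\<iota> (a/2) + (x - \<iota> a) \<in> P" using that unfolding near_def small_def by simp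
    moreover have "\<iota> a = \<iota> (a/2) + \<iota> (a/2)" by (simp add: \<iota>_add[symmetric])
    ultimately have h: "x - \<iota> (a/2) \<in> P" by simp
    have "(x - \<iota> (a/2)) + \<iota> (a/2) \<in> P" by (rule P_add[OF h P_\<iota>]) (use that in simp)
    moreover have "x \<noteq> 0" using h not_P_\<iota>[of "- (a/2)"] that by (auto simp: \<iota>_uminus)
    ultimately show ?thesis by simp
  qed
qed

end

subsection \<open>A Positivstellensatz on the disc\<close>

definition disc_poly :: "real poly poly" where
  "disc_poly = 1 - polyC 4 * polyX ^ 2 - polyC 4 * polyY ^ 2"

text \<open>The preordering generated by \<open>disc_poly\<close>. Closure under products is
  derived, the square of \<open>disc_poly\<close> being a square; induction towards sums of squares
  in \<open>A\<close> then meets only two kinds of generators.\<close>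

inductive_set disc_cone :: "real poly poly set" where
  square: "p * p \<in> disc_cone"
| disc: "disc_poly * (p * p) \<in> disc_cone"
| add: "p \<in> disc_cone \<Longrightarrow> q \<in> disc_cone \<Longrightarrow> p + q \<in> disc_cone"

lemma disc_cone_mult_square: "q \<in> disc_cone \<Longrightarrow> p * p * q \<in> disc_cone"
proof (induction rule: disc_cone.induct)
  case (square q)
  have "p * p * (q * q) = (p * q) * (p * q)" by (simp only: ac_simps)
  then show ?case using disc_cone.square by metis
next
  case (disc q)
  have "p * p * (disc_poly * (q * q)) = disc_poly * ((p * q) * (p * q))" by (simp only: ac_simps)
  then show ?case using disc_cone.disc by metis
next
  case (add q r)
  then show ?case unfolding distrib_left by (intro disc_cone.add)
qed

lemma disc_cone_mult_disc: "q \<in> disc_cone \<Longrightarrow> disc_poly * q \<in> disc_cone"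
proof (induction rule: disc_cone.induct)
  case (square q)
  show ?case by (rule disc_cone.disc)
next
  case (disc q)
  have "disc_poly * (disc_poly * (q * q)) = (disc_poly * q) * (disc_poly * q)" by (simp only: ac_simps)
  then show ?case using disc_cone.square by metis
next
  case (add q r)
  then show ?case unfolding distrib_left by (intro disc_cone.add)
qed

lemma disc_cone_mult: "p \<in> disc_cone \<Longrightarrow> q \<in> disc_cone \<Longrightarrow> p * q \<in> disc_cone"
proof (induction rule: disc_cone.induct)
  case (square p) then show ?case by (intro disc_cone_mult_square)
next
  case (disc p)
  then show ?case unfolding mult.assoc[of disc_poly] by (intro disc_cone_mult_disc disc_cone_mult_square)
next
  case (add p r) then show ?case unfolding distrib_right by (intro disc_cone.add) simp_all
qed

lemma rv_disc_poly: "rv disc_poly x y = 1 - 4 * x\<^sup>2 - 4 * y\<^sup>2"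
  by (simp only: disc_poly_def evr.ev_minus evr.ev_mult evr.ev_power evr.ev_1 evr.ev_polyX evr.ev_polyY evr.ev_const)

lemma disc_cone_nonneg: "p \<in> disc_cone \<Longrightarrow> 0 \<le> rv disc_poly x y \<Longrightarrow> 0 \<le> rv p x y"
  by (induction rule: disc_cone.induct) (simp_all add: evr.ev_mult evr.ev_add)

text \<open>The chord chart: with \<open>\<rho> = a + 1/2\<close>, \<open>y = b / \<rho>\<close> is the slope of the line from the boundary
  point \<open>(-1/2, 0)\<close> to \<open>(a, b)\<close>, and \<open>x = 1 - \<rho>(1 + y\<^sup>2)\<close> vanishes exactly on the boundary
  circle.\<close>
definition chord_poly :: "real poly poly \<Rightarrow> nat \<Rightarrow> real poly poly" where
  "chord_poly h N = (\<Sum>i\<le>N. \<Sum>j\<le>N. polyC (coeff (coeff h i) j) *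
     (polyC (-1/2) * (1 + polyY ^ 2) + (1 - polyX)) ^ j * (polyY * (1 - polyX)) ^ i *
     (1 + polyY ^ 2) ^ (2 * N - (i + j)))"

context real_alg
begin

lemma ev_disc_poly: "ev \<iota> x y disc_poly = 1 - \<iota> 4 * x\<^sup>2 - \<iota> 4 * y\<^sup>2"
  by (simp only: disc_poly_def ev_minus ev_mult ev_power ev_1 ev_polyX ev_polyY ev_const)

text \<open>The chart is \<open>a = -1/2 + (1 - x) / s\<close>, \<open>b = y (1 - x) / s\<close>,
  stated without division. Since \<open>i + j \<le> 2 * N\<close>, the factor
  \<open>s ^ (2 * N)\<close> clears all denominators; for real \<open>y\<close> it is positive and
  does not affect signs.\<close>

lemma ev_chord_poly:
  assumes N: "degree h \<le> N" "\<And>i. degree (coeff h i) \<le> N"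
    and s: "s = 1 + y\<^sup>2" "s * a = \<iota> (-1/2) * s + (1 - x)" "s * b = y * (1 - x)"
  shows "ev \<iota> x y (chord_poly h N) = s ^ (2 * N) * ev \<iota> a b h"
proof -
  have "ev \<iota> x y (chord_poly h N) = (\<Sum>i\<le>N. \<Sum>j\<le>N. \<iota> (coeff (coeff h i) j) *
      (s * a) ^ j * (s * b) ^ i * s ^ (2 * N - (i + j)))"
    unfolding chord_poly_def s(2,3) unfolding s(1)
    by (simp only: ev_sum ev_mult ev_add ev_minus ev_power ev_const ev_polyX ev_polyY ev_1)
  also have "\<dots> = (\<Sum>i\<le>N. \<Sum>j\<le>N. s ^ (2 * N) * (\<iota> (coeff (coeff h i) j) * a ^ j * b ^ i))"
  proof (intro sum.cong refl)
    fix i j assume "i \<in> {..N}" "j \<in> {..N}"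
    then have e: "2 * N = i + j + (2 * N - (i + j))" by simp
    have "s ^ (2 * N) = s ^ i * s ^ j * s ^ (2 * N - (i + j))"
      by (subst e) (simp only: power_add)
    then show "\<iota> (coeff (coeff h i) j) * (s * a) ^ j * (s * b) ^ i * s ^ (2 * N - (i + j)) =
      s ^ (2 * N) * (\<iota> (coeff (coeff h i) j) * a ^ j * b ^ i)"
      by (simp only: power_mult_distrib ac_simps)
  qed
  also have "\<dots> = s ^ (2 * N) * ev \<iota> a b h"
    unfolding ev_sum_form[OF N] by (simp only: sum_distrib_left)
  finally show ?thesis .
qed

end

lemma rv_chord_poly:
  assumes "degree h \<le> N" "\<And>i. degree (coeff h i) \<le> N"
  shows "rv (chord_poly h N) x y =
    (1 + y\<^sup>2) ^ (2 * N) * rv h (-1/2 + (1 - x) / (1 + y\<^sup>2)) (y * (1 - x) / (1 + y\<^sup>2))"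
proof -
  have nz: "1 + y\<^sup>2 \<noteq> 0" by (smt (verit) zero_le_power2)
  show ?thesis
    by (rule evr.ev_chord_poly[OF assms refl]) (use nz in \<open>simp_all add: field_simps\<close>)
qed

context real_place
begin

lemma disc_interior_neg:
  assumes "near A a" "near B b" "4 * a\<^sup>2 + 4 * b\<^sup>2 < 1" "pos (- ev \<iota> A B h)"
  shows "\<exists>x y. 0 \<le> rv disc_poly x y \<and> rv h x y < 0"
proof -
  have "rv (- disc_poly) a b < 0" using assms(3) by (simp add: evr.ev_uminus rv_disc_poly)
  from rv_neg_box[OF this] obtain e where e: "e > 0"
    "\<And>x' y'. \<bar>x' - a\<bar> < e \<Longrightarrow> \<bar>y' - b\<bar> < e \<Longrightarrow> rv (- disc_poly) x' y' < 0" by blast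
  from neg_witness[OF assms(1,2,4) e(1)] obtain x y where
    "\<bar>x - a\<bar> < e" "\<bar>y - b\<bar> < e" "rv h x y < 0" by blast
  with e(2) show ?thesis by (intro exI[of _ x] exI[of _ y]) (force simp: evr.ev_uminus)
qed

text \<open>In chord coordinates \<open>disc_poly\<close> becomes \<open>4 \<rho> x\<close> with
  \<open>\<rho>\<close> positive, so lying inside the disc means that \<open>x\<close> is positive.
  \<open>neg_witness\<close> preserves this sign, and the real point found maps back into the disc.
  At \<open>a = -1/2\<close>, where all chords start, \<open>\<rho>\<close> would be
  infinitesimal.\<close>

lemma disc_boundary_neg:
  assumes A: "near A a" and B: "near B b" and ab: "4 * a\<^sup>2 + 4 * b\<^sup>2 = 1" "a \<noteq> - 1 / 2"
    and G: "pos (ev \<iota> A B disc_poly)" and neg: "pos (- ev \<iota> A B h)"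
  shows "\<exists>x y. 0 \<le> rv disc_poly x y \<and> rv h x y < 0"
proof -
  obtain N where N: "degree h \<le> N" "\<And>i. degree (coeff h i) \<le> N" using exists_degree_bound[of h] by blast
  have "(2 * a)\<^sup>2 = 4 * a\<^sup>2" by (simp add: power_mult_distrib)
  then have "(2 * a)\<^sup>2 \<le> 1" using ab(1) zero_le_power2[of b] by linarith
  then have "\<bar>2 * a\<bar> \<le> 1" by (simp only: abs_square_le_1)
  then have a0: "0 < a + 1/2" using ab(2) by linarith
  define \<rho> where "\<rho> = A + \<iota> (1/2)"
  define s where "s = 1 + (B / \<rho>)\<^sup>2"
  define y where "y = B / \<rho>"
  define x where "x = 1 - \<rho> * s"
  have n\<rho>: "near \<rho> (a + 1/2)" unfolding \<rho>_def by (intro near_add A near_const)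
  have p\<rho>: "pos \<rho>" using pos_near[OF n\<rho> a0] .
  have \<rho>0: "\<rho> \<noteq> 0" using p\<rho> not_pos_zero by auto
  have ny: "near y (b / (a + 1/2))"
    unfolding y_def divide_inverse[of B] divide_inverse[of b]
    by (rule near_mult[OF B near_inverse[OF n\<rho>]]) (use a0 in linarith)
  have n1: "near 1 1" using near_const[of 1] by (simp add: \<iota>_1)
  have "near x (1 - (a + 1/2) * (1 + (b / (a + 1/2))\<^sup>2))"
    unfolding x_def s_def y_def[symmetric] power2_eq_square by (intro near_diff near_mult near_add n1 n\<rho> ny)
  \<comment> \<open>The circle equation reads \<open>(a + 1/2)^2 + b^2 = a + 1/2\<close>, so the
    standard part of \<open>x\<close> is 0.\<close>
  moreover have "(a + 1/2) * (1 + (b / (a + 1/2))\<^sup>2) = 1"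
  proof -
    have "b\<^sup>2 = 1/4 - a\<^sup>2" using ab(1) by simp
    then have "(a + 1/2)\<^sup>2 + b\<^sup>2 = a + 1/2" by (simp add: power2_eq_square algebra_simps)
    then have "((a + 1/2)\<^sup>2 + b\<^sup>2) / (a + 1/2) = 1" using a0 by simp
    moreover have "r * (1 + (b / r)\<^sup>2) = (r\<^sup>2 + b\<^sup>2) / r" if "0 < r" for r :: real
      using that by (simp add: power2_eq_square add_divide_distrib distrib_left)
    ultimately show ?thesis using a0 by (simp only:)
  qed
  ultimately have nx: "near x 0" by simp
  have half: "2 * \<iota> (1/2) = 1"
  proof -
    have "\<iota> (1/2) + \<iota> (1/2) = 1" by (simp add: \<iota>_add[symmetric] \<iota>_1)
    then show ?thesis by simp
  qed
  have four: "\<iota> 4 = 4" using \<iota>_add[of 2 2] \<iota>_add[of 1 1] by (simp add: \<iota>_1)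
  have sr: "\<rho> * s * \<rho> = \<rho> * \<rho> + B * B" unfolding s_def using \<rho>0
    by (simp add: power2_eq_square field_simps)
  have gx: "ev \<iota> A B disc_poly = (4 * \<rho>) * x"
  proof -
    have "(4 * \<rho>) * x = 4 * \<rho> - 4 * (\<rho> * s * \<rho>)" unfolding x_def by (simp add: algebra_simps)
    also have "\<dots> = 4 * \<rho> - 4 * (\<rho> * \<rho> + B * B)" unfolding sr ..
    also have "\<dots> = 2 * (2 * \<iota> (1/2)) - (2 * \<iota> (1/2)) * (2 * \<iota> (1/2)) + 4 * A - 4 * A * (2 * \<iota> (1/2))
        - 4 * A\<^sup>2 - 4 * B\<^sup>2"
      unfolding \<rho>_def by (simp add: power2_eq_square algebra_simps)
    also have "\<dots> = 1 - 4 * A\<^sup>2 - 4 * B\<^sup>2" unfolding half by simp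
    finally show ?thesis unfolding ev_disc_poly four by simp
  qed
  have p4: "pos 4" using pos_near[OF near_const[of 4]] by (simp add: four)
  have px: "pos x" using pos_mult_cancel[OF pos_mult[OF p4 p\<rho>], of x] G unfolding gx by blast
  have "s * A = \<iota> (-1/2) * s + (1 - x)"
  proof -
    have "\<iota> (-1/2) = - \<iota> (1/2)" using \<iota>_uminus[of "1/2"] by simp
    then show ?thesis by (simp add: x_def \<rho>_def algebra_simps)
  qed
  moreover have "s * B = y * (1 - x)" unfolding x_def y_def using \<rho>0 by simp
  ultimately have evc: "ev \<iota> x y (chord_poly h N) = s ^ (2 * N) * ev \<iota> A B h"
    by (intro ev_chord_poly N) (simp_all add: s_def y_def)
  have "pos s"
  proof (rule pos_near)
    show "near s (1 + (b / (a + 1/2))\<^sup>2)"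
      unfolding s_def y_def[symmetric] power2_eq_square by (intro near_mult near_add n1 ny)
    show "0 < 1 + (b / (a + 1/2))\<^sup>2" by (smt (verit) zero_le_power2)
  qed
  then have "pos (s ^ (2 * N) * (- ev \<iota> A B h))" by (intro pos_mult pos_power neg)
  then have "pos (- ev \<iota> x y (chord_poly h N))" unfolding evc by simp
  \<comment> \<open>Radius 1 suffices: \<open>0 < x' < 1\<close> already puts the image into the
    disc, whatever the slope.\<close>
  from neg_witness[OF nx ny this, of 1] px obtain x' y' where
    xy: "\<bar>x'\<bar> < 1" "rv (chord_poly h N) x' y' < 0" "0 < x'" by (auto simp: \<iota>_0)
  define S where "S = 1 + y'\<^sup>2"
  have S: "0 < S" unfolding S_def by (smt (verit) zero_le_power2)
  define a' where "a' = -1/2 + (1 - x') / S"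
  define b' where "b' = y' * (1 - x') / S"
  have "rv (chord_poly h N) x' y' = S ^ (2 * N) * rv h a' b'"
    unfolding rv_chord_poly[OF N] S_def a'_def b'_def ..
  then have "rv h a' b' < 0" using xy(2) S by (simp add: mult_less_0_iff)
  moreover have "rv disc_poly a' b' = 4 * ((1 - x') / S) * x'"
  proof -
    have "b'\<^sup>2 = (S - 1) * (1 - x')\<^sup>2 / S\<^sup>2" unfolding b'_def S_def by (simp add: power_mult_distrib power_divide)
    then have "rv disc_poly a' b' = 1 - 4 * (-1/2 + (1 - x') / S)\<^sup>2 - 4 * ((S - 1) * (1 - x')\<^sup>2 / S\<^sup>2)"
      unfolding rv_disc_poly a'_def by simp
    also have "\<dots> = 4 * ((1 - x') / S) * x'" using S by (simp add: field_simps power2_eq_square)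
    finally show ?thesis .
  qed
  then have "0 \<le> rv disc_poly a' b'" using S xy by simp
  ultimately show ?thesis by blast
qed

lemma disc_neg:
  assumes G: "pos (ev \<iota> A B disc_poly)" and neg: "pos (- ev \<iota> A B h)"
  shows "\<exists>x y. 0 \<le> rv disc_poly x y \<and> rv h x y < 0"
proof -
  \<comment> \<open>If \<open>U\<close> were infinite, dividing by \<open>U^2\<close> would give a
    positive \<open>1/U^2 - 4\<close>, whose standard part is -4.\<close>
  have bounded: "\<exists>a. near U a" if UV: "pos (1 - \<iota> 4 * U\<^sup>2 - \<iota> 4 * V\<^sup>2)" for U V
  proof (rule ccontr)
    assume no: "\<not> ?thesis"
    have z: "near 0 0" using near_const[of 0] by (simp add: \<iota>_0)
    have U0: "U \<noteq> 0" using no z by blast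
    with no near_or_inverse have n: "near (inverse U) 0" by blast
    have "pos (1 - \<iota> 4 * U\<^sup>2)"
    proof (cases "V = 0")
      case True then show ?thesis using UV by simp
    next
      case False
      then have "pos (\<iota> 4 * (V * V))" by (intro pos_mult pos_near[OF near_const] pos_square) auto
      from pos_add[OF UV this] show ?thesis by (simp add: power2_eq_square)
    qed
    then have "pos ((inverse U * inverse U) * (1 - \<iota> 4 * U\<^sup>2))" using U0 by (intro pos_mult pos_square) auto
    moreover have "(inverse U * inverse U) * (1 - \<iota> 4 * U\<^sup>2) = inverse U * inverse U - \<iota> 4"
      using U0 by (simp add: field_simps power2_eq_square)
    ultimately have p: "pos (inverse U * inverse U - \<iota> 4)" by simp
    have "near (inverse U * inverse U - \<iota> 4) (0 * 0 - 4)" by (intro near_diff near_mult n near_const)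
    from near_pos_nonneg[OF this p] show False by simp
  qed
  obtain a where a: "near A a" using bounded G unfolding ev_disc_poly by blast
  have "pos (1 - \<iota> 4 * B\<^sup>2 - \<iota> 4 * A\<^sup>2)" using G unfolding ev_disc_poly by (simp add: algebra_simps)
  then obtain b where b: "near B b" using bounded by blast
  have "0 \<le> rv disc_poly a b" using near_pos_nonneg[OF near_ev[OF a b] G] .
  then consider "4 * a\<^sup>2 + 4 * b\<^sup>2 < 1" | "4 * a\<^sup>2 + 4 * b\<^sup>2 = 1" "a \<noteq> - 1 / 2"
    | "4 * a\<^sup>2 + 4 * b\<^sup>2 = 1" "a = - 1 / 2" unfolding rv_disc_poly by linarith
  then show ?thesis
  proof cases
    case 1 then show ?thesis using disc_interior_neg a b neg by blast
  next
    case 2 then show ?thesis using disc_boundary_neg[OF a b] G neg by blast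
  next
    case 3
    \<comment> \<open>The reflection from \<open>x\<close> to \<open>- x\<close> preserves
      \<open>disc_poly\<close> and moves the point away from the start of the chords.\<close>
    define h' where "h' = sub (- polyX) polyY h"
    have "near (- A) (- a)" using near_uminus a by blast
    moreover have "4 * (- a)\<^sup>2 + 4 * b\<^sup>2 = 1" "- a \<noteq> - 1 / 2" using 3 by auto
    moreover have "pos (ev \<iota> (- A) B disc_poly)" using G unfolding ev_disc_poly by simp
    moreover have "ev \<iota> (- A) B h' = ev \<iota> A B h"
      unfolding h'_def ev_sub ev_uminus ev_polyX ev_polyY by simp
    then have "pos (- ev \<iota> (- A) B h')" using neg by simp
    ultimately obtain x y where xy: "0 \<le> rv disc_poly x y" "rv h' x y < 0"
      using disc_boundary_neg[OF _ b] by blast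
    have "rv h' x y = rv h (- x) y" unfolding h'_def evr.ev_sub evr.ev_uminus evr.ev_polyX evr.ev_polyY ..
    moreover have "rv disc_poly (- x) y = rv disc_poly x y" unfolding rv_disc_poly by simp
    ultimately show ?thesis using xy by metis
  qed
qed

end

section \<open>The field of rational functions\<close>

interpretation polyF: real_alg "\<lambda>r. to_fract (polyC r)"
proof (rule real_alg.intro)
  interpret a: comm_ring_hom polyC by (rule polyC.\<iota>_hom)
  show "comm_ring_hom (\<lambda>r. to_fract (polyC r))"
    by unfold_locales (simp_all only: a.hom_add a.hom_mult a.hom_zero a.hom_one to_fract_add to_fract_mult to_fract_0 to_fract_1)
qed

text \<open>At the generic point the value of \<open>f\<close> is \<open>f\<close> itself, so an
  ordering of the field assigns it a sign.\<close>

lemma ev_generic: "ev (\<lambda>r. to_fract (polyC r)) (to_fract polyX) (to_fract polyY) f = to_fract f"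
proof (induction f)
  case 0 then show ?case by simp
next
  case (pCons p f)
  have u: "polyF.uev (to_fract polyX) p = to_fract [:p:]" for p
  proof (induction p)
    case 0 then show ?case by simp
  next
    case (pCons a p)
    have "[:pCons a p:] = polyC a + polyX * [:p:]" by simp
    then have "to_fract [:pCons a p:] = to_fract (polyC a) + to_fract polyX * to_fract [:p:]"
      by (metis to_fract_add to_fract_mult)
    with pCons show ?case by simp
  qed
  have "pCons p f = [:p:] + polyY * f" by simp
  then have "to_fract (pCons p f) = to_fract [:p:] + to_fract polyY * to_fract f"
    by (metis to_fract_add to_fract_mult)
  with pCons u show ?case by simp
qed

theorem disc_positivstellensatz:
  assumes nonneg: "\<And>x y. 0 \<le> rv disc_poly x y \<Longrightarrow> 0 \<le> rv h x y"
  shows "\<exists>D. D \<noteq> 0 \<and> D * D * h \<in> disc_cone"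
proof (rule ccontr)
  assume no: "\<not> ?thesis"
  have sq0: "0 \<in> disc_cone" "1 \<in> disc_cone" using disc_cone.square[of 0] disc_cone.square[of 1] by auto
  \<comment> \<open>The preordering generated by the cone and \<open>-h\<close>; it is proper by \<open>no\<close>.\<close>
  define T where "T = {(to_fract a - to_fract h * to_fract b) * (inverse (to_fract c) * inverse (to_fract c)) | a b c.
     a \<in> disc_cone \<and> b \<in> disc_cone \<and> c \<noteq> 0}"
  have TI: "z \<in> T" if "z * (to_fract c * to_fract c) = to_fract a - to_fract h * to_fract b"
    "a \<in> disc_cone" "b \<in> disc_cone" "c \<noteq> 0" for z a b c
  proof -
    have "to_fract c \<noteq> 0" using that(4) by simp
    then have "z = (z * (to_fract c * to_fract c)) * (inverse (to_fract c) * inverse (to_fract c))"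
      by (simp add: field_simps)
    then show ?thesis using that unfolding T_def by auto
  qed
  have TE: "\<exists>a b c. z * (to_fract c * to_fract c) = to_fract a - to_fract h * to_fract b \<and>
    a \<in> disc_cone \<and> b \<in> disc_cone \<and> c \<noteq> 0" if "z \<in> T" for z
  proof -
    obtain a b c where abc: "a \<in> disc_cone" "b \<in> disc_cone" "c \<noteq> 0"
      "z = (to_fract a - to_fract h * to_fract b) * (inverse (to_fract c) * inverse (to_fract c))"
      using \<open>z \<in> T\<close> unfolding T_def by blast
    have "to_fract c \<noteq> 0" using abc(3) by simp
    then have "z * (to_fract c * to_fract c) = to_fract a - to_fract h * to_fract b"
      unfolding abc(4) by (simp add: field_simps)
    with abc show ?thesis by blast
  qed
  have "field_preordering T"
    unfolding field_preordering_def
  proof (intro conjI ballI allI)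
    fix z w assume "z \<in> T" "w \<in> T"
    then obtain a b c a' b' c' where
      z: "z * (to_fract c * to_fract c) = to_fract a - to_fract h * to_fract b" "a \<in> disc_cone" "b \<in> disc_cone" "c \<noteq> 0" and
      w: "w * (to_fract c' * to_fract c') = to_fract a' - to_fract h * to_fract b'" "a' \<in> disc_cone" "b' \<in> disc_cone" "c' \<noteq> 0"
      using TE by meson
    show "z + w \<in> T"
    proof (rule TI)
      have "(z + w) * (to_fract (c * c') * to_fract (c * c')) =
        (z * (to_fract c * to_fract c)) * (to_fract c' * to_fract c') + (w * (to_fract c' * to_fract c')) * (to_fract c * to_fract c)"
        by (simp add: algebra_simps)
      also have "\<dots> = to_fract (c' * c' * a + c * c * a') - to_fract h * to_fract (c' * c' * b + c * c * b')"
        unfolding z w by (simp add: algebra_simps)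
      finally show "(z + w) * (to_fract (c * c') * to_fract (c * c')) =
        to_fract (c' * c' * a + c * c * a') - to_fract h * to_fract (c' * c' * b + c * c * b')" .
      show "c' * c' * a + c * c * a' \<in> disc_cone" "c' * c' * b + c * c * b' \<in> disc_cone"
        by (intro disc_cone.add disc_cone_mult_square z w)+
      show "c * c' \<noteq> 0" using z w by simp
    qed
    show "z * w \<in> T"
    proof (rule TI)
      have "(z * w) * (to_fract (c * c') * to_fract (c * c')) =
        (z * (to_fract c * to_fract c)) * (w * (to_fract c' * to_fract c'))"
        by (simp add: algebra_simps)
      also have "\<dots> = to_fract (a * a' + h * h * (b * b')) - to_fract h * to_fract (a * b' + b * a')"
        unfolding z w by (simp add: algebra_simps)
      finally show "(z * w) * (to_fract (c * c') * to_fract (c * c')) =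
        to_fract (a * a' + h * h * (b * b')) - to_fract h * to_fract (a * b' + b * a')" .
      show "a * a' + h * h * (b * b') \<in> disc_cone" "a * b' + b * a' \<in> disc_cone"
        by (intro disc_cone.add disc_cone_mult_square disc_cone_mult z w)+
      show "c * c' \<noteq> 0" using z w by simp
    qed
  next
    fix z :: "real poly poly fract"
    obtain p q where pq: "z = Fraction_Field.Fract p q" "q \<noteq> 0" by (cases z) auto
    have zq: "z * to_fract q = to_fract p" using pq by (simp add: Fract_conv_to_fract)
    have "(z * z) * (to_fract q * to_fract q) = (z * to_fract q) * (z * to_fract q)" by (simp only: ac_simps)
    also have "\<dots> = to_fract (p * p) - to_fract h * to_fract 0" by (simp add: zq)
    finally show "z * z \<in> T" by (rule TI) (use sq0 pq disc_cone.square in auto)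
  next
    show "- 1 \<notin> T"
    proof
      assume "- 1 \<in> T"
      then obtain a b c where
        abc: "- 1 * (to_fract c * to_fract c) = to_fract a - to_fract h * to_fract b"
        "a \<in> disc_cone" "b \<in> disc_cone" "c \<noteq> 0" using TE by meson
      have "to_fract (h * b) = to_fract (a + c * c)" using abc(1) by (simp add: algebra_simps)
      then have e: "h * b = a + c * c" by (simp only: to_fract_eq_iff)
      \<comment> \<open>For \<open>b = 0\<close> the identity \<open>a + c^2 = 0\<close> would make
        \<open>c\<close> vanish on the whole disc.\<close>
      have "b \<noteq> 0"
      proof
        assume "b = 0"
        then have ac: "a + c * c = 0" using e by simp
        have "rv c x y = 0" if "0 \<le> rv disc_poly x y" for x y
        proof -
          have "rv a x y + rv c x y * rv c x y = 0" using arg_cong[OF ac, of "\<lambda>f. rv f x y"]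
            by (simp only: evr.ev_add evr.ev_mult evr.ev_0)
          then show ?thesis using disc_cone_nonneg[OF abc(2) that] by (simp add: add_nonneg_eq_0_iff)
        qed
        moreover obtain x y where xy: "0 < x" "x < 1/4" "0 < y" "y < (1/4::real)" "rv c x y \<noteq> 0"
          using rv_nonzero_in_box[OF abc(4), of 0 "1/4" 0 "1/4"] by auto
        moreover have "0 \<le> rv disc_poly x y"
        proof -
          have "x\<^sup>2 \<le> (1/4)\<^sup>2" "y\<^sup>2 \<le> (1/4)\<^sup>2" using xy by (auto intro!: power_mono)
          then show ?thesis unfolding rv_disc_poly by (simp add: power2_eq_square)
        qed
        ultimately show False by blast
      qed
      \<comment> \<open>This is the source of the square multiplier: \<open>D = b\<close>.\<close>
      moreover have "b * b * h = b * (a + c * c)" unfolding e[symmetric] by (simp only: ac_simps)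
      then have "b * b * h \<in> disc_cone"
        using disc_cone_mult[OF abc(3) disc_cone.add[OF abc(2) disc_cone.square[of c]]] by (simp only:)
      ultimately show False using no by blast
    qed
  qed
  then obtain P where P: "T \<subseteq> P" "field_preordering P" "\<And>x. x \<in> P \<or> - x \<in> P"
    using preordering_extends[of T] by blast
  interpret o: ordered_real_alg "\<lambda>r. to_fract (polyC r)" P by unfold_locales (use P in auto)
  have "- to_fract h \<in> T" by (rule TI[of _ 1 0 1]) (use sq0 in auto)
  moreover have "to_fract disc_poly \<in> T"
    by (rule TI[of _ 1 disc_poly 0]) (use sq0 disc_cone.disc[of 1] in auto)
  ultimately have m: "- to_fract h \<in> P" "to_fract disc_poly \<in> P" using P(1) by auto
  have h0: "h \<noteq> 0"
  proof
    assume "h = 0"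
    then have "1 * 1 * h \<in> disc_cone" using sq0 by simp
    with no show False by (metis one_neq_zero)
  qed
  have d0: "disc_poly \<noteq> 0"
  proof
    assume "disc_poly = 0"
    then have "rv disc_poly 0 0 = 0" by simp
    then show False unfolding rv_disc_poly by simp
  qed
  have "\<exists>x y. 0 \<le> rv disc_poly x y \<and> rv h x y < 0"
  proof (rule o.disc_neg)
    show "ev (\<lambda>r. to_fract (polyC r)) (to_fract polyX) (to_fract polyY) disc_poly \<in> P \<and>
        ev (\<lambda>r. to_fract (polyC r)) (to_fract polyX) (to_fract polyY) disc_poly \<noteq> 0"
      unfolding ev_generic using m(2) d0 by simp
    show "- ev (\<lambda>r. to_fract (polyC r)) (to_fract polyX) (to_fract polyY) h \<in> P \<and>
        - ev (\<lambda>r. to_fract (polyC r)) (to_fract polyX) (to_fract polyY) h \<noteq> 0"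
      unfolding ev_generic using m(1) h0 by simp
  qed
  then show False using nonneg by (meson not_le)
qed

subsection \<open>Two by two matrices\<close>

text \<open>A type of its own is a ring without dimension hypotheses, so identities in the
  two-dimensional representations reduce to identities between entries; \<open>tomat\<close>
  translates to general matrices.\<close>

datatype m2 = M2 (m11: complex) (m12: complex) (m21: complex) (m22: complex)

lemma m2_eq_iff: "A = B \<longleftrightarrow> m11 A = m11 B \<and> m12 A = m12 B \<and> m21 A = m21 B \<and> m22 A = m22 B"
  by (cases A; cases B) simp

instantiation m2 :: ring_1
begin

definition "0 = M2 0 0 0 0"
definition "1 = M2 1 0 0 1"
definition "A + B = M2 (m11 A + m11 B) (m12 A + m12 B) (m21 A + m21 B) (m22 A + m22 B)"
definition "A - B = M2 (m11 A - m11 B) (m12 A - m12 B) (m21 A - m21 B) (m22 A - m22 B)"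
definition "- A = M2 (- m11 A) (- m12 A) (- m21 A) (- m22 A)"
definition "A * B = M2 (m11 A * m11 B + m12 A * m21 B) (m11 A * m12 B + m12 A * m22 B)
  (m21 A * m11 B + m22 A * m21 B) (m21 A * m12 B + m22 A * m22 B)"

instance
  by standard (simp_all add: zero_m2_def one_m2_def plus_m2_def minus_m2_def uminus_m2_def times_m2_def algebra_simps)

end

lemma m2_sel [simp]:
  "m11 0 = 0" "m12 0 = 0" "m21 0 = 0" "m22 0 = 0"
  "m11 1 = 1" "m12 1 = 0" "m21 1 = 0" "m22 1 = 1"
  "m11 (A + B) = m11 A + m11 B" "m12 (A + B) = m12 A + m12 B"
  "m21 (A + B) = m21 A + m21 B" "m22 (A + B) = m22 A + m22 B"
  "m11 (A - B) = m11 A - m11 B" "m12 (A - B) = m12 A - m12 B"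
  "m21 (A - B) = m21 A - m21 B" "m22 (A - B) = m22 A - m22 B"
  "m11 (A * B) = m11 A * m11 B + m12 A * m21 B" "m12 (A * B) = m11 A * m12 B + m12 A * m22 B"
  "m21 (A * B) = m21 A * m11 B + m22 A * m21 B" "m22 (A * B) = m21 A * m12 B + m22 A * m22 B"
  by (simp_all add: zero_m2_def one_m2_def plus_m2_def minus_m2_def times_m2_def)

definition scal :: "complex \<Rightarrow> m2" where "scal z = M2 z 0 0 z"

definition adj :: "m2 \<Rightarrow> m2" where "adj A = M2 (cnj (m11 A)) (cnj (m21 A)) (cnj (m12 A)) (cnj (m22 A))"

lemma scal_sel [simp]: "m11 (scal z) = z" "m12 (scal z) = 0" "m21 (scal z) = 0" "m22 (scal z) = z"
  by (simp_all add: scal_def)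

lemma adj_sel [simp]: "m11 (adj A) = cnj (m11 A)" "m12 (adj A) = cnj (m21 A)"
  "m21 (adj A) = cnj (m12 A)" "m22 (adj A) = cnj (m22 A)"
  by (simp_all add: adj_def)

lemma scal_simps: "scal 0 = 0" "scal 1 = 1" "scal (a + b) = scal a + scal b" "scal (a - b) = scal a - scal b"
  "scal (a * b) = scal a * scal b"
  by (simp_all add: m2_eq_iff)

lemma scal_commute: "A * scal z = scal z * A"
  by (simp add: m2_eq_iff mult.commute)

lemma adj_simps: "adj 0 = 0" "adj 1 = 1" "adj (A + B) = adj A + adj B" "adj (A * B) = adj B * adj A"
  "adj (adj A) = A" "adj (scal z) = scal (cnj z)"
  by (simp_all add: m2_eq_iff mult.commute add.commute)

lemma scal_sum: "scal (\<Sum>i\<in>I. f i) = (\<Sum>i\<in>I. scal (f i))"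
  by (induction I rule: infinite_finite_induct) (simp_all add: scal_simps)

definition psd2 :: "m2 \<Rightarrow> bool" where
  "psd2 Y \<longleftrightarrow> (\<forall>v w. \<exists>r\<ge>0. cnj v * (m11 Y * v + m12 Y * w) + cnj w * (m21 Y * v + m22 Y * w) = complex_of_real r)"

lemma psd2_adj_mult: "psd2 (adj B * B)"
  unfolding psd2_def
proof (intro allI)
  fix v w
  define a where "a = m11 B * v + m12 B * w"
  define b where "b = m21 B * v + m22 B * w"
  have "cnj v * (m11 (adj B * B) * v + m12 (adj B * B) * w) + cnj w * (m21 (adj B * B) * v + m22 (adj B * B) * w)
     = a * cnj a + b * cnj b"
    by (simp add: a_def b_def algebra_simps)
  also have "\<dots> = complex_of_real ((cmod a)\<^sup>2 + (cmod b)\<^sup>2)" by (simp only: of_real_add complex_norm_square)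
  finally show "\<exists>r\<ge>0. cnj v * (m11 (adj B * B) * v + m12 (adj B * B) * w) +
    cnj w * (m21 (adj B * B) * v + m22 (adj B * B) * w) = complex_of_real r"
    by (intro exI[of _ "(cmod a)\<^sup>2 + (cmod b)\<^sup>2"]) simp
qed

lemma psd2_zero: "psd2 0" by (auto simp: psd2_def intro!: exI[of _ 0])

lemma psd2_add: assumes "psd2 A" "psd2 B" shows "psd2 (A + B)"
  unfolding psd2_def
proof (intro allI)
  fix v w
  obtain r where "0 \<le> r" "cnj v * (m11 A * v + m12 A * w) + cnj w * (m21 A * v + m22 A * w) = complex_of_real r"
    using assms(1) unfolding psd2_def by blast
  moreover obtain s where "0 \<le> s" "cnj v * (m11 B * v + m12 B * w) + cnj w * (m21 B * v + m22 B * w) = complex_of_real s"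
    using assms(2) unfolding psd2_def by blast
  moreover have "cnj v * (m11 (A + B) * v + m12 (A + B) * w) + cnj w * (m21 (A + B) * v + m22 (A + B) * w) =
    (cnj v * (m11 A * v + m12 A * w) + cnj w * (m21 A * v + m22 A * w)) +
    (cnj v * (m11 B * v + m12 B * w) + cnj w * (m21 B * v + m22 B * w))"
    by (simp add: algebra_simps)
  ultimately show "\<exists>r\<ge>0. cnj v * (m11 (A + B) * v + m12 (A + B) * w) + cnj w * (m21 (A + B) * v + m22 (A + B) * w) = complex_of_real r"
    by (intro exI[of _ "r + s"]) simp
qed

lemma psd2_scal: assumes "psd2 A" "0 \<le> r" shows "psd2 (scal (complex_of_real r) * A)"
  unfolding psd2_def
proof (intro allI)
  fix v w
  obtain s where s: "0 \<le> s" "cnj v * (m11 A * v + m12 A * w) + cnj w * (m21 A * v + m22 A * w) = complex_of_real s"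
    using assms(1) unfolding psd2_def by blast
  have "cnj v * (m11 (scal (complex_of_real r) * A) * v + m12 (scal (complex_of_real r) * A) * w) +
     cnj w * (m21 (scal (complex_of_real r) * A) * v + m22 (scal (complex_of_real r) * A) * w)
    = complex_of_real r * (cnj v * (m11 A * v + m12 A * w) + cnj w * (m21 A * v + m22 A * w))"
    by (simp add: algebra_simps)
  also have "\<dots> = complex_of_real (r * s)" unfolding s(2) by simp
  finally show "\<exists>t\<ge>0. cnj v * (m11 (scal (complex_of_real r) * A) * v + m12 (scal (complex_of_real r) * A) * w) +
     cnj w * (m21 (scal (complex_of_real r) * A) * v + m22 (scal (complex_of_real r) * A) * w) = complex_of_real t"
    using assms(2) s(1) by (intro exI[of _ "r * s"]) simp
qed

definition tr2 :: "m2 \<Rightarrow> complex" where "tr2 Y = m11 Y + m22 Y"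
definition det2 :: "m2 \<Rightarrow> complex" where "det2 Y = m11 Y * m22 Y - m12 Y * m21 Y"

lemma cayley_hamilton2: "Y * Y + scal (det2 Y) = scal (tr2 Y) * Y"
  by (simp add: m2_eq_iff tr2_def det2_def algebra_simps)

text \<open>The columns of the adjugate as test vectors turn the form into \<open>a det\<close> and
  \<open>d det\<close>, which settles the sign unless \<open>a = d = 0\<close>; then the vector
  \<open>(1, - cnj b)\<close> gives \<open>- 2 |b|^2\<close> and forces
  \<open>b = 0\<close>.\<close>

lemma psd2_tr_det:
  assumes "psd2 Y" "adj Y = Y"
  shows "0 \<le> Re (tr2 Y)" "0 \<le> Re (det2 Y)" "tr2 Y = 0 \<Longrightarrow> Y = 0"
proof -
  define a where "a = Re (m11 Y)"
  define d where "d = Re (m22 Y)"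
  define b where "b = m12 Y"
  have h: "m11 Y = of_real a" "m22 Y = of_real d" "m21 Y = cnj b"
  proof -
    have "cnj (m11 Y) = m11 Y" "cnj (m22 Y) = m22 Y" "cnj (m12 Y) = m21 Y"
      using arg_cong[OF assms(2), of m11] arg_cong[OF assms(2), of m22] arg_cong[OF assms(2), of m21]
      by (simp_all only: adj_sel)
    then show "m11 Y = of_real a" "m22 Y = of_real d" "m21 Y = cnj b"
      unfolding a_def d_def b_def by (simp_all add: complex_eq_iff)
  qed
  have q: "0 \<le> Re (cnj v * (of_real a * v + b * w) + cnj w * (cnj b * v + of_real d * w))" for v w
    using assms(1) unfolding psd2_def h b_def[symmetric] by (metis Re_complex_of_real)
  have a0: "0 \<le> a" using q[of 1 0] by simp
  have d0: "0 \<le> d" using q[of 0 1] by simp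
  have bb: "b * cnj b = of_real ((cmod b)\<^sup>2)" by (simp only: complex_norm_square)
  have det: "det2 Y = of_real (a * d - (cmod b)\<^sup>2)" unfolding det2_def h b_def[symmetric] bb by simp
  have A: "0 \<le> a * (a * d - (cmod b)\<^sup>2)"
  proof -
    have "cnj (- b) * (of_real a * (- b) + b * of_real a) + cnj (of_real a) * (cnj b * (- b) + of_real d * of_real a)
      = of_real a * (of_real (a * d) - b * cnj b)" by (simp add: algebra_simps)
    also have "\<dots> = of_real (a * (a * d - (cmod b)\<^sup>2))" unfolding bb by simp
    finally show ?thesis using q[of "- b" "of_real a"] by (metis Re_complex_of_real)
  qed
  have D: "0 \<le> d * (a * d - (cmod b)\<^sup>2)"
  proof -
    have "cnj (of_real d) * (of_real a * of_real d + b * (- cnj b)) + cnj (- cnj b) * (cnj b * of_real d + of_real d * (- cnj b))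
      = of_real d * (of_real (a * d) - b * cnj b)" by (simp add: algebra_simps)
    also have "\<dots> = of_real (d * (a * d - (cmod b)\<^sup>2))" unfolding bb by simp
    finally show ?thesis using q[of "of_real d" "- cnj b"] by (metis Re_complex_of_real)
  qed
  have Z: "b = 0" if "a = 0" "d = 0"
  proof -
    have "cnj 1 * (of_real a * 1 + b * (- cnj b)) + cnj (- cnj b) * (cnj b * 1 + of_real d * (- cnj b))
      = - 2 * (b * cnj b)" using that by simp
    also have "\<dots> = of_real (- 2 * (cmod b)\<^sup>2)" unfolding bb by simp
    finally have "0 \<le> - 2 * (cmod b)\<^sup>2" using q[of 1 "- cnj b"] by (metis Re_complex_of_real)
    then show ?thesis by simp
  qed
  show "0 \<le> Re (tr2 Y)" using a0 d0 by (simp add: tr2_def h)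
  show "0 \<le> Re (det2 Y)"
  proof -
    consider "0 < a" | "0 < d" | "a = 0" "d = 0" using a0 d0 by linarith
    then show ?thesis
    proof cases
      case 1 then show ?thesis using A unfolding det Re_complex_of_real by (simp add: zero_le_mult_iff)
    next
      case 2 then show ?thesis using D unfolding det Re_complex_of_real by (simp add: zero_le_mult_iff)
    next
      case 3 then show ?thesis using Z unfolding det Re_complex_of_real by simp
    qed
  qed
  assume "tr2 Y = 0"
  then have "of_real (a + d) = (0::complex)" by (simp add: tr2_def h)
  then have "a + d = 0" by (simp only: of_real_eq_0_iff)
  then have "a = 0" "d = 0" using a0 d0 by linarith+
  then show "Y = 0" using Z h by (simp add: m2_eq_iff b_def)
qed

subsection \<open>The free algebra\<close>

definition wmon :: "bool list \<Rightarrow> fa" where "wmon w = (\<lambda>v. if v = w then 1 else 0)"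

text \<open>Splittings of \<open>w\<close> correspond to pairs of words with concatenation
  \<open>w\<close>. Restricted to finite supports, the product can be regrouped by pairs, as in
  \<open>Phi_mult\<close>.\<close>

lemma fa_mult_pairs:
  assumes "finite A" "finite B" "\<And>w. w \<notin> A \<Longrightarrow> p w = 0" "\<And>w. w \<notin> B \<Longrightarrow> q w = 0"
  shows "fa_mult p q w = (\<Sum>x\<in>{x \<in> A \<times> B. fst x @ snd x = w}. p (fst x) * q (snd x))"
proof -
  have inj: "inj_on (\<lambda>i. (take i w, drop i w)) {..length w}"
    by (rule inj_onI) (metis atMost_iff length_take min.absorb2 prod.inject)
  have img: "(\<lambda>i. (take i w, drop i w)) ` {..length w} = {x. fst x @ snd x = w}"
  proof (intro equalityI subsetI)
    fix x assume "x \<in> {x. fst x @ snd x = w}"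
    then show "x \<in> (\<lambda>i. (take i w, drop i w)) ` {..length w}"
      by (intro image_eqI[of _ _ "length (fst x)"]) (auto simp: prod_eq_iff)
  qed auto
  have fin: "finite {x. fst x @ snd x = w}" unfolding img[symmetric] by simp
  have "fa_mult p q w = (\<Sum>x\<in>{x. fst x @ snd x = w}. p (fst x) * q (snd x))"
    unfolding fa_mult_def img[symmetric] by (subst sum.reindex[OF inj]) simp
  also have "\<dots> = (\<Sum>x\<in>{x \<in> A \<times> B. fst x @ snd x = w}. p (fst x) * q (snd x))"
    by (rule sum.mono_neutral_right[OF fin]) (use assms(3,4) in force)+
  finally show ?thesis .
qed

lemma fa_mult_support:
  assumes "finite A" "finite B" "\<And>w. w \<notin> A \<Longrightarrow> p w = 0" "\<And>w. w \<notin> B \<Longrightarrow> q w = 0"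
    "w \<notin> (\<lambda>x. fst x @ snd x) ` (A \<times> B)"
  shows "fa_mult p q w = 0"
proof -
  have e: "{x \<in> A \<times> B. fst x @ snd x = w} = {}" using assms(5) by force
  have "fa_mult p q w = (\<Sum>x\<in>{x \<in> A \<times> B. fst x @ snd x = w}. p (fst x) * q (snd x))"
    by (rule fa_mult_pairs) (use assms in auto)
  then show ?thesis unfolding e by simp
qed

lemma carrier_supp: "p \<in> fa_carrier \<Longrightarrow> finite {w. p w \<noteq> 0}"
  by (simp add: fa_carrier_def)

lemma carrierI: "finite A \<Longrightarrow> (\<And>w. w \<notin> A \<Longrightarrow> p w = 0) \<Longrightarrow> p \<in> fa_carrier"
  unfolding fa_carrier_def by (auto intro: finite_subset[of _ A])

lemma carrier_mult [simp]: assumes "p \<in> fa_carrier" "q \<in> fa_carrier" shows "fa_mult p q \<in> fa_carrier"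
proof (rule carrierI)
  let ?A = "{w. p w \<noteq> 0}" and ?B = "{w. q w \<noteq> 0}"
  show "finite ((\<lambda>x. fst x @ snd x) ` (?A \<times> ?B))"
    using assms[THEN carrier_supp] by (intro finite_imageI finite_cartesian_product)
  show "fa_mult p q w = 0" if "w \<notin> (\<lambda>x. fst x @ snd x) ` (?A \<times> ?B)" for w
    by (rule fa_mult_support[of ?A ?B p q w]) (use that assms[THEN carrier_supp] in auto)
qed

lemma carrier_add [simp]: "p \<in> fa_carrier \<Longrightarrow> q \<in> fa_carrier \<Longrightarrow> fa_add p q \<in> fa_carrier"
  by (rule carrierI[of "{w. p w \<noteq> 0} \<union> {w. q w \<noteq> 0}"]) (auto simp: fa_add_def fa_carrier_def)

lemma carrier_diff [simp]: "p \<in> fa_carrier \<Longrightarrow> q \<in> fa_carrier \<Longrightarrow> fa_diff p q \<in> fa_carrier"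
  by (rule carrierI[of "{w. p w \<noteq> 0} \<union> {w. q w \<noteq> 0}"]) (auto simp: fa_diff_def fa_carrier_def)

lemma carrier_smult [simp]: "p \<in> fa_carrier \<Longrightarrow> fa_smult a p \<in> fa_carrier"
  by (rule carrierI[of "{w. p w \<noteq> 0}"]) (auto simp: fa_smult_def fa_carrier_def)

lemma carrier_mon [simp]: "wmon w \<in> fa_carrier"
  by (rule carrierI[of "{w}"]) (auto simp: wmon_def)

lemma fa_gen_mon: "fa_gen b = wmon [b]" and fa_one_mon: "fa_one = wmon []"
  by (auto simp: fa_gen_def fa_one_def wmon_def)

lemma carrier_basic [simp]: "fa_zero \<in> fa_carrier" "fa_one \<in> fa_carrier" "fa_gen b \<in> fa_carrier"
  unfolding fa_gen_mon fa_one_mon by (simp add: fa_zero_def fa_carrier_def, rule carrier_mon, rule carrier_mon)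

lemma star_word_inj: "rev (map Not (rev (map Not w))) = w"
  by (simp add: rev_map o_def)

lemma carrier_star [simp]: assumes "p \<in> fa_carrier" shows "fa_star p \<in> fa_carrier"
proof (rule carrierI[of "(\<lambda>w. rev (map Not w)) ` {w. p w \<noteq> 0}"])
  show "finite ((\<lambda>w. rev (map Not w)) ` {w. p w \<noteq> 0})" using assms by (simp add: fa_carrier_def)
  fix w assume "w \<notin> (\<lambda>w. rev (map Not w)) ` {w. p w \<noteq> 0}"
  then have "p (rev (map Not w)) = 0" using star_word_inj by (metis (mono_tags, lifting) image_eqI mem_Collect_eq)
  then show "fa_star p w = 0" by (simp add: fa_star_def)
qed

lemma fa_mult_assoc: "fa_mult (fa_mult p q) r = fa_mult p (fa_mult q r)"
proof
  fix w :: "bool list"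
  let ?n = "length w"
  have "fa_mult (fa_mult p q) r w = (\<Sum>k\<le>?n. \<Sum>i\<le>k. p (take i w) * q (drop i (take k w)) * r (drop k w))"
    unfolding fa_mult_def sum_distrib_right by (intro sum.cong refl) (auto simp: min_absorb1)
  also have "\<dots> = (\<Sum>(k,i)\<in>Sigma {..?n} (\<lambda>k. {..k}). p (take i w) * q (drop i (take k w)) * r (drop k w))"
    by (rule sum.Sigma) auto
  also have "\<dots> = (\<Sum>(i,j)\<in>Sigma {..?n} (\<lambda>i. {..?n - i}). p (take i w) * q (take j (drop i w)) * r (drop j (drop i w)))"
    by (rule sum.reindex_bij_witness[of _ "\<lambda>(i,j). (i + j, i)" "\<lambda>(k,i). (i, k - i)"])
      (auto simp: drop_take)
  also have "\<dots> = (\<Sum>i\<le>?n. \<Sum>j\<le>?n - i. p (take i w) * q (take j (drop i w)) * r (drop j (drop i w)))"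
    by (rule sum.Sigma[symmetric]) auto
  also have "\<dots> = fa_mult p (fa_mult q r) w"
    by (simp add: fa_mult_def sum_distrib_left mult.assoc)
  finally show "fa_mult (fa_mult p q) r w = fa_mult p (fa_mult q r) w" .
qed

lemma fa_mult_mon: "fa_mult (wmon u) (wmon v) = wmon (u @ v)"
proof
  fix w
  have "fa_mult (wmon u) (wmon v) w = (\<Sum>x\<in>{x \<in> {u} \<times> {v}. fst x @ snd x = w}. wmon u (fst x) * wmon v (snd x))"
    by (rule fa_mult_pairs) (auto simp: wmon_def)
  also have "{x \<in> {u} \<times> {v}. fst x @ snd x = w} = (if u @ v = w then {(u, v)} else {})" by auto
  also have "(\<Sum>x\<in>(if u @ v = w then {(u, v)} else {}). wmon u (fst x) * wmon v (snd x)) = wmon (u @ v) w"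
    by (auto simp: wmon_def)
  finally show "fa_mult (wmon u) (wmon v) w = wmon (u @ v) w" .
qed

lemma fa_distribs:
  "fa_mult p (fa_add q r) = fa_add (fa_mult p q) (fa_mult p r)"
  "fa_mult (fa_add q r) p = fa_add (fa_mult q p) (fa_mult r p)"
  "fa_mult p (fa_diff q r) = fa_diff (fa_mult p q) (fa_mult p r)"
  "fa_mult (fa_diff q r) p = fa_diff (fa_mult q p) (fa_mult r p)"
  "fa_mult p (fa_smult a q) = fa_smult a (fa_mult p q)"
  "fa_mult (fa_smult a q) p = fa_smult a (fa_mult q p)"
  "fa_mult p fa_zero = fa_zero" "fa_mult fa_zero p = fa_zero"
  by (simp_all add: fun_eq_iff fa_mult_def fa_add_def fa_diff_def fa_smult_def fa_zero_def
      sum.distrib sum_subtractf sum_distrib_left algebra_simps)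

lemma carrier_induct [consumes 1, case_names zero mon add]:
  assumes "p \<in> fa_carrier" and zero: "P fa_zero"
    and mon: "\<And>a w. P (fa_smult a (wmon w))"
    and add: "\<And>p q. p \<in> fa_carrier \<Longrightarrow> q \<in> fa_carrier \<Longrightarrow> P p \<Longrightarrow> P q \<Longrightarrow> P (fa_add p q)"
  shows "P p"
proof -
  have "\<forall>p. {w. p w \<noteq> 0} \<subseteq> S \<longrightarrow> P p" if "finite S" for S
    using that
  proof (induction S rule: finite_induct)
    case empty
    have "p = fa_zero" if "{w. p w \<noteq> 0} \<subseteq> {}" for p :: fa using that by (auto simp: fa_zero_def)
    then show ?case using zero by metis
  next
    case (insert v S)
    show ?case
    proof (intro allI impI)
      fix p :: fa assume p: "{w. p w \<noteq> 0} \<subseteq> insert v S"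
      define q where "q = p(v := 0)"
      have q: "{w. q w \<noteq> 0} \<subseteq> S" using p insert.hyps by (auto simp: q_def)
      have "p = fa_add (fa_smult (p v) (wmon v)) q"
        by (auto simp: fun_eq_iff q_def fa_add_def fa_smult_def wmon_def)
      moreover have "q \<in> fa_carrier" unfolding fa_carrier_def using q insert.hyps finite_subset by auto
      ultimately show "P p" using add[OF _ _ mon] insert.IH q carrier_smult carrier_mon by metis
    qed
  qed
  then show ?thesis using carrier_supp[OF assms(1)] by blast
qed

lemma rel_carrier [simp]: "rel \<in> fa_carrier" by (simp add: rel_def)

lemma ideal_carrier: "p \<in> rel_ideal \<Longrightarrow> p \<in> fa_carrier"
  by (induction rule: rel_ideal.induct) auto

lemma ideal_lmult: "p \<in> rel_ideal \<Longrightarrow> c \<in> fa_carrier \<Longrightarrow> fa_mult c p \<in> rel_ideal"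
proof (induction rule: rel_ideal.induct)
  case zero then show ?case by (simp add: fa_distribs rel_ideal.zero)
next
  case (add p q) then show ?case by (simp add: fa_distribs rel_ideal.add)
next
  case (gen a b)
  then show ?case using rel_ideal.gen[of "fa_mult c a" b] by (simp add: fa_mult_assoc)
qed

lemma fa_smult_simps: "fa_smult a fa_zero = fa_zero" "fa_smult a (fa_smult b p) = fa_smult (a * b) p"
  "fa_smult a (fa_add p q) = fa_add (fa_smult a p) (fa_smult a q)" "fa_smult 1 p = p"
  by (simp_all add: fun_eq_iff fa_smult_def fa_add_def fa_zero_def algebra_simps)

lemma ideal_smult: "p \<in> rel_ideal \<Longrightarrow> fa_smult c p \<in> rel_ideal"
proof (induction rule: rel_ideal.induct)
  case zero then show ?case by (simp add: fa_smult_simps rel_ideal.zero)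
next
  case (add p q) then show ?case by (simp add: fa_smult_simps rel_ideal.add)
next
  case (gen a b)
  then show ?case using rel_ideal.gen[of "fa_smult c a" b] by (simp add: fa_distribs)
qed

lemma A_eq_refl: "A_eq p p"
  unfolding A_eq_def using rel_ideal.zero by (simp add: fa_diff_def fa_zero_def)

lemma A_eq_trans: "A_eq p q \<Longrightarrow> A_eq q r \<Longrightarrow> A_eq p r"
proof -
  assume "A_eq p q" "A_eq q r"
  then have "fa_add (fa_diff p q) (fa_diff q r) \<in> rel_ideal" unfolding A_eq_def by (rule rel_ideal.add)
  moreover have "fa_add (fa_diff p q) (fa_diff q r) = fa_diff p r" by (simp add: fun_eq_iff fa_add_def fa_diff_def)
  ultimately show ?thesis by (simp add: A_eq_def)
qed

lemma A_eq_add: "A_eq p q \<Longrightarrow> A_eq p' q' \<Longrightarrow> A_eq (fa_add p p') (fa_add q q')"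
proof -
  assume "A_eq p q" "A_eq p' q'"
  then have "fa_add (fa_diff p q) (fa_diff p' q') \<in> rel_ideal" unfolding A_eq_def by (rule rel_ideal.add)
  moreover have "fa_add (fa_diff p q) (fa_diff p' q') = fa_diff (fa_add p p') (fa_add q q')"
    by (simp add: fun_eq_iff fa_add_def fa_diff_def)
  ultimately show ?thesis by (simp add: A_eq_def)
qed

lemma A_eq_smult: "A_eq p q \<Longrightarrow> A_eq (fa_smult a p) (fa_smult a q)"
proof -
  assume "A_eq p q"
  then have "fa_smult a (fa_diff p q) \<in> rel_ideal" unfolding A_eq_def by (rule ideal_smult)
  moreover have "fa_smult a (fa_diff p q) = fa_diff (fa_smult a p) (fa_smult a q)"
    by (simp add: fun_eq_iff fa_smult_def fa_diff_def algebra_simps)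
  ultimately show ?thesis by (simp add: A_eq_def)
qed

lemma A_eq_lmult: "A_eq p q \<Longrightarrow> c \<in> fa_carrier \<Longrightarrow> A_eq (fa_mult c p) (fa_mult c q)"
  unfolding A_eq_def fa_distribs(3)[symmetric] by (rule ideal_lmult)

subsection \<open>Normal forms\<close>

definition nword :: "nat \<Rightarrow> nat \<Rightarrow> bool list" where "nword i j = replicate i True @ replicate j False"

lemma nword_inj: "nword i j = nword i' j' \<Longrightarrow> i = i' \<and> j = j'"
proof -
  assume e: "nword i j = nword i' j'"
  have c: "length (filter id (nword i j)) = i" "length (filter Not (nword i j)) = j" for i j
    by (simp_all add: nword_def)
  then show ?thesis using e by metis
qed

text \<open>Rewriting with the relation shows that these words span; their independence comes from
  the two-dimensional representations in \<open>nf_zero_of_Phi\<close>.\<close>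

inductive_set normal_forms :: "fa set" where
  nf_zero: "fa_zero \<in> normal_forms"
| nf_mon: "fa_smult a (wmon (nword i j)) \<in> normal_forms"
| nf_add: "p \<in> normal_forms \<Longrightarrow> q \<in> normal_forms \<Longrightarrow> fa_add p q \<in> normal_forms"

lemma nf_smult: "p \<in> normal_forms \<Longrightarrow> fa_smult a p \<in> normal_forms"
  by (induction rule: normal_forms.induct) (simp_all add: fa_smult_simps normal_forms.intros)

lemma nf_carrier: "p \<in> normal_forms \<Longrightarrow> p \<in> fa_carrier"
  by (induction rule: normal_forms.induct) auto

lemma nf_support: "p \<in> normal_forms \<Longrightarrow> p w \<noteq> 0 \<Longrightarrow> \<exists>i j. w = nword i j"
proof (induction rule: normal_forms.induct)
  case nf_zero then show ?case by (simp add: fa_zero_def)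
next
  case (nf_mon a i j) then show ?case by (auto simp: fa_smult_def wmon_def split: if_splits)
next
  case (nf_add p q)
  then have "p w \<noteq> 0 \<or> q w \<noteq> 0" by (auto simp: fa_add_def)
  then show ?case using nf_add.IH by blast
qed

definition has_nf :: "fa \<Rightarrow> bool" where "has_nf p \<longleftrightarrow> (\<exists>q\<in>normal_forms. A_eq p q)"

lemma has_nf_add: "has_nf p \<Longrightarrow> has_nf q \<Longrightarrow> has_nf (fa_add p q)"
  unfolding has_nf_def using A_eq_add nf_add by blast

lemma has_nf_smult: "has_nf p \<Longrightarrow> has_nf (fa_smult a p)"
  unfolding has_nf_def using A_eq_smult nf_smult by blast

lemma has_nf_nword: "has_nf (wmon (nword i j))"
  unfolding has_nf_def using nf_mon[of 1 i j] A_eq_refl by (metis fa_smult_simps(4))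

lemma has_nf_lmult:
  assumes "\<And>i j. has_nf (fa_mult c (wmon (nword i j)))" "c \<in> fa_carrier" "has_nf p"
  shows "has_nf (fa_mult c p)"
proof -
  have *: "has_nf (fa_mult c q)" if "q \<in> normal_forms" for q
    using that
  proof (induction rule: normal_forms.induct)
    case nf_zero then show ?case
      unfolding fa_distribs has_nf_def using A_eq_refl normal_forms.nf_zero by blast
  next
    case (nf_mon a i j) then show ?case unfolding fa_distribs by (intro has_nf_smult assms)
  next
    case (nf_add p q) then show ?case unfolding fa_distribs by (intro has_nf_add)
  qed
  obtain q where q: "q \<in> normal_forms" "A_eq p q" using assms(3) unfolding has_nf_def by blast
  obtain q' where q': "q' \<in> normal_forms" "A_eq (fa_mult c q) q'" using *[OF q(1)] unfolding has_nf_def by blast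
  show ?thesis unfolding has_nf_def using A_eq_trans[OF A_eq_lmult[OF q(2) assms(2)] q'(2)] q'(1) by blast
qed

lemma has_nf_x: "has_nf p \<Longrightarrow> has_nf (fa_mult (wmon [True]) p)"
proof (rule has_nf_lmult)
  fix i j
  have "fa_mult (wmon [True]) (wmon (nword i j)) = wmon (nword (Suc i) j)" by (simp add: fa_mult_mon nword_def)
  then show "has_nf (fa_mult (wmon [True]) (wmon (nword i j)))" using has_nf_nword by simp
qed auto

lemma rel_mon: "rel = fa_diff (fa_add (wmon [False, True]) (wmon [True, False])) (wmon [])"
  by (simp add: rel_def fa_gen_mon fa_one_mon fa_mult_mon)

lemma A_eq_swap: "A_eq (wmon (False # True # w)) (fa_diff (wmon w) (wmon (True # False # w)))"
proof -
  have "fa_mult (fa_mult fa_one rel) (wmon w) \<in> rel_ideal" by (rule rel_ideal.gen) simp_all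
  moreover have "fa_mult (fa_mult fa_one rel) (wmon w) =
     fa_diff (wmon (False # True # w)) (fa_diff (wmon w) (wmon (True # False # w)))"
    unfolding rel_mon fa_one_mon fa_distribs fa_mult_mon by (simp add: fun_eq_iff fa_add_def fa_diff_def)
  ultimately show ?thesis by (simp add: A_eq_def)
qed

text \<open>Induction on the number of letters \<open>x\<close> to be crossed: the relation moves
  \<open>x*\<close> past one of them and adds a shorter word.\<close>

lemma has_nf_xstar: "has_nf p \<Longrightarrow> has_nf (fa_mult (wmon [False]) p)"
proof (rule has_nf_lmult)
  fix i j show "has_nf (fa_mult (wmon [False]) (wmon (nword i j)))"
  proof (induction i)
    case 0
    have "fa_mult (wmon [False]) (wmon (nword 0 j)) = wmon (nword 0 (Suc j))" by (simp add: fa_mult_mon nword_def)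
    then show ?case using has_nf_nword by simp
  next
    case (Suc i)
    have e: "fa_mult (wmon [False]) (wmon (nword (Suc i) j)) = wmon (False # True # nword i j)"
      by (simp add: fa_mult_mon nword_def)
    have "fa_diff (wmon (nword i j)) (wmon (True # False # nword i j)) =
      fa_add (wmon (nword i j)) (fa_smult (-1) (fa_mult (wmon [True]) (fa_mult (wmon [False]) (wmon (nword i j)))))"
      by (simp add: fa_mult_mon fun_eq_iff fa_diff_def fa_add_def fa_smult_def)
    moreover have "has_nf \<dots>" by (intro has_nf_add has_nf_smult has_nf_x has_nf_nword Suc)
    ultimately obtain q where q: "q \<in> normal_forms" "A_eq (fa_diff (wmon (nword i j)) (wmon (True # False # nword i j))) q"
      unfolding has_nf_def by auto
    show ?case unfolding e has_nf_def using A_eq_trans[OF A_eq_swap q(2)] q(1) by blast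
  qed
qed auto

lemma carrier_has_nf: assumes "p \<in> fa_carrier" shows "has_nf p"
  using assms
proof (induction rule: carrier_induct)
  case zero show ?case unfolding has_nf_def using A_eq_refl nf_zero by blast
next
  case (mon a w)
  have "has_nf (wmon w)"
  proof (induction w)
    case Nil show ?case using has_nf_nword[of 0 0] by (simp add: nword_def)
  next
    case (Cons b w)
    have "wmon (b # w) = fa_mult (wmon [b]) (wmon w)" by (simp add: fa_mult_mon)
    then show ?case using Cons has_nf_x has_nf_xstar by (cases b) auto
  qed
  then show ?case by (rule has_nf_smult)
next
  case (add p q) then show ?case by (intro has_nf_add)
qed

subsection \<open>The two-dimensional representations\<close>

text \<open>The solution of \<open>u v = l\<close>, \<open>u\<^sup>2 + |v|\<^sup>2 = 1\<close> with \<open>u > |v|\<close>, so that \<open>X2 l\<close> satisfies the defining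
  relation of \<open>A\<close> and has square \<open>l\<close>.\<close>
definition uu :: "complex \<Rightarrow> real" where "uu l = sqrt ((1 + sqrt (1 - 4 * (cmod l)\<^sup>2)) / 2)"

definition vv :: "complex \<Rightarrow> complex" where "vv l = l / of_real (uu l)"

definition X2 :: "complex \<Rightarrow> m2" where "X2 l = M2 0 (of_real (uu l)) (vv l) 0"

definition gm :: "complex \<Rightarrow> bool \<Rightarrow> m2" where "gm l b = (if b then X2 l else adj (X2 l))"

definition wm :: "complex \<Rightarrow> bool list \<Rightarrow> m2" where "wm l w = prod_list (map (gm l) w)"

definition Phi :: "fa \<Rightarrow> complex \<Rightarrow> m2" where
  "Phi p l = (\<Sum>w | p w \<noteq> 0. scal (p w) * wm l w)"

text \<open>Strict: on the boundary circle \<open>uu l\<close> equals \<open>cmod (vv l)\<close>, so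
  \<open>X2 l * adj (X2 l)\<close> is a scalar and \<open>X2_independent\<close> fails.\<close>

abbreviation in_disc :: "complex \<Rightarrow> bool" where "in_disc l \<equiv> cmod l < 1 / 2"

lemma X2_sel [simp]: "m11 (X2 l) = 0" "m12 (X2 l) = of_real (uu l)" "m21 (X2 l) = vv l" "m22 (X2 l) = 0"
  by (simp_all add: X2_def)

context
  fixes l :: complex assumes l: "in_disc l"
begin

lemma disc_sqrt: "0 < 1 - 4 * (cmod l)\<^sup>2"
proof -
  have "(cmod l)\<^sup>2 < (1/2)\<^sup>2" by (rule power_strict_mono) (use l in auto)
  then show ?thesis by (simp add: power2_eq_square)
qed

lemma uu_sq: "(uu l)\<^sup>2 = (1 + sqrt (1 - 4 * (cmod l)\<^sup>2)) / 2"
  unfolding uu_def by (rule real_sqrt_pow2) (use disc_sqrt in simp)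

lemma uu_pos: "0 < uu l"
proof -
  have "0 < sqrt (1 - 4 * (cmod l)\<^sup>2)" by (rule real_sqrt_gt_zero[OF disc_sqrt])
  then have "0 < 1 + sqrt (1 - 4 * (cmod l)\<^sup>2)" by (intro add_pos_pos) simp_all
  then show ?thesis
    unfolding uu_def by (intro real_sqrt_gt_zero divide_pos_pos) simp_all
qed

lemma uu_vv: "of_real (uu l) * vv l = l"
  unfolding vv_def using uu_pos by simp

lemma vv_sq: "(cmod (vv l))\<^sup>2 = (1 - sqrt (1 - 4 * (cmod l)\<^sup>2)) / 2"
proof -
  define s where "s = sqrt (1 - 4 * (cmod l)\<^sup>2)"
  have s: "0 < s" "s\<^sup>2 = 1 - 4 * (cmod l)\<^sup>2" unfolding s_def using disc_sqrt by auto
  have "cmod (vv l) * uu l = cmod l"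
    using arg_cong[OF uu_vv, of cmod] uu_pos by (simp add: norm_mult mult.commute)
  then have "(cmod (vv l))\<^sup>2 * (uu l)\<^sup>2 = (cmod l)\<^sup>2" by (metis power_mult_distrib)
  also have "\<dots> = (1 - s) / 2 * ((1 + s) / 2)" using s(2) by (simp add: power2_eq_square field_simps)
  also have "(1 + s) / 2 = (uu l)\<^sup>2" unfolding uu_sq s_def ..
  finally have "(cmod (vv l))\<^sup>2 * (uu l)\<^sup>2 = (1 - s) / 2 * (uu l)\<^sup>2" .
  then show ?thesis using uu_pos unfolding s_def[symmetric] by simp
qed

lemma vv_cnj: "vv l * cnj (vv l) = of_real ((1 - sqrt (1 - 4 * (cmod l)\<^sup>2)) / 2)"
  unfolding vv_sq[symmetric] by (simp only: complex_norm_square)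

lemma uu_cnj: "of_real (uu l) * of_real (uu l) = complex_of_real ((1 + sqrt (1 - 4 * (cmod l)\<^sup>2)) / 2)"
  unfolding uu_sq[symmetric] by (simp add: power2_eq_square)

lemma X2_relation: "adj (X2 l) * X2 l + X2 l * adj (X2 l) = 1"
proof -
  have "vv l * cnj (vv l) + of_real (uu l) * of_real (uu l) = 1"
    unfolding vv_cnj uu_cnj of_real_add[symmetric] by (simp add: add_divide_distrib[symmetric])
  then show ?thesis by (simp add: m2_eq_iff mult.commute add.commute)
qed

lemma X2_sq: "X2 l * X2 l = scal l"
  using uu_vv by (simp add: m2_eq_iff mult.commute)

lemma X2_adj_sq: "adj (X2 l) * adj (X2 l) = scal (cnj l)"
proof -
  have "adj (X2 l) * adj (X2 l) = adj (X2 l * X2 l)" by (simp only: adj_simps)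
  then show ?thesis unfolding X2_sq by (simp only: adj_simps)
qed

text \<open>Diagonal and off-diagonal entries give two 2 by 2 systems, for \<open>a, d\<close> and
  for \<open>b, c\<close>; both determinants are \<open>A - B = sqrt (1 - 4 |l|^2)\<close> up to
  sign.\<close>

lemma X2_independent:
  assumes "scal a + scal b * X2 l + scal c * adj (X2 l) + scal d * (X2 l * adj (X2 l)) = 0"
  shows "a = 0 \<and> b = 0 \<and> c = 0 \<and> d = 0"
proof -
  define s where "s = sqrt (1 - 4 * (cmod l)\<^sup>2)"
  have s: "0 < s" unfolding s_def using disc_sqrt by simp
  define A where "A = complex_of_real ((1 + s) / 2)"
  define B where "B = complex_of_real ((1 - s) / 2)"
  have AB: "A - B = of_real s" unfolding A_def B_def of_real_diff[symmetric] by (simp add: field_simps)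
  have e1: "a + d * A = 0" using arg_cong[OF assms, of m11] uu_cnj by (simp add: A_def s_def)
  have e2: "a + d * B = 0" using arg_cong[OF assms, of m22] vv_cnj by (simp add: B_def s_def)
  have "d * (A - B) = (a + d * A) - (a + d * B)" by (simp add: algebra_simps)
  then have "d * of_real s = 0" unfolding e1 e2 AB by simp
  then have d: "d = 0" using s by simp
  then have a: "a = 0" using e1 by simp
  have e3: "b * of_real (uu l) + c * cnj (vv l) = 0" using arg_cong[OF assms, of m12] by simp
  have e4: "b * vv l + c * of_real (uu l) = 0" using arg_cong[OF assms, of m21] by simp
  have "b * (A - B) = of_real (uu l) * (b * of_real (uu l) + c * cnj (vv l)) - cnj (vv l) * (b * vv l + c * of_real (uu l))"
    unfolding A_def B_def s_def uu_cnj[symmetric] vv_cnj[symmetric] by (simp add: algebra_simps)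
  then have "b * of_real s = 0" unfolding e3 e4 AB by simp
  then have b: "b = 0" using s by simp
  then have "c * of_real (uu l) = 0" using e4 by simp
  then have "c = 0" using uu_pos by simp
  with a b d show ?thesis by blast
qed

end

lemma wm_append: "wm l (u @ v) = wm l u * wm l v"
  by (simp add: wm_def)

lemma wm_star: "adj (wm l w) = wm l (rev (map Not w))"
proof (induction w)
  case Nil show ?case by (simp add: wm_def adj_simps)
next
  case (Cons b w)
  have g: "adj (gm l b) = gm l (\<not> b)" by (simp add: gm_def adj_simps)
  have "wm l (b # w) = gm l b * wm l w" by (simp add: wm_def)
  then have "adj (wm l (b # w)) = wm l (rev (map Not w)) * gm l (\<not> b)" using Cons g by (simp only: adj_simps)
  also have "\<dots> = wm l (rev (map Not (b # w)))" by (simp add: wm_def)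
  finally show ?case .
qed

lemma Phi_superset:
  assumes "finite A" "\<And>w. w \<notin> A \<Longrightarrow> p w = 0"
  shows "Phi p l = (\<Sum>w\<in>A. scal (p w) * wm l w)"
  unfolding Phi_def by (rule sum.mono_neutral_left) (use assms in \<open>auto simp: scal_simps\<close>)

lemma Phi_add: assumes "p \<in> fa_carrier" "q \<in> fa_carrier" shows "Phi (fa_add p q) l = Phi p l + Phi q l"
proof -
  let ?A = "{w. p w \<noteq> 0} \<union> {w. q w \<noteq> 0}"
  have fin: "finite ?A" using assms carrier_supp by blast
  have "Phi (fa_add p q) l = (\<Sum>w\<in>?A. scal (fa_add p q w) * wm l w)"
    by (rule Phi_superset[OF fin]) (auto simp: fa_add_def)
  moreover have "Phi p l = (\<Sum>w\<in>?A. scal (p w) * wm l w)" "Phi q l = (\<Sum>w\<in>?A. scal (q w) * wm l w)"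
    by (rule Phi_superset[OF fin]; simp)+
  ultimately show ?thesis by (simp add: fa_add_def scal_simps distrib_right sum.distrib)
qed

lemma Phi_smult: assumes "p \<in> fa_carrier" shows "Phi (fa_smult a p) l = scal a * Phi p l"
proof -
  have "Phi (fa_smult a p) l = (\<Sum>w | p w \<noteq> 0. scal (fa_smult a p w) * wm l w)"
    by (rule Phi_superset[OF carrier_supp[OF assms]]) (auto simp: fa_smult_def)
  then show ?thesis by (simp add: Phi_def fa_smult_def scal_simps sum_distrib_left mult.assoc)
qed

lemma Phi_diff: assumes "p \<in> fa_carrier" "q \<in> fa_carrier" shows "Phi (fa_diff p q) l = Phi p l - Phi q l"
proof -
  have "fa_diff p q = fa_add p (fa_smult (-1) q)" by (simp add: fun_eq_iff fa_diff_def fa_add_def fa_smult_def)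
  moreover have "scal (-1) * Phi q l = - Phi q l" by (simp add: m2_eq_iff uminus_m2_def)
  ultimately show ?thesis using assms by (simp add: Phi_add Phi_smult)
qed

lemma Phi_mon: "Phi (wmon w) l = wm l w"
  by (subst Phi_superset[of "{w}"]) (auto simp: wmon_def scal_simps)

lemma Phi_basic: "Phi fa_zero l = 0" "Phi fa_one l = 1" "Phi fa_x l = X2 l" "Phi fa_xstar l = adj (X2 l)"
  unfolding fa_one_mon fa_gen_mon Phi_mon by (simp_all add: Phi_def fa_zero_def wm_def gm_def)

lemma Phi_mult: assumes "p \<in> fa_carrier" "q \<in> fa_carrier" shows "Phi (fa_mult p q) l = Phi p l * Phi q l"
proof -
  let ?A = "{w. p w \<noteq> 0}" and ?B = "{w. q w \<noteq> 0}"
  let ?C = "(\<lambda>x. fst x @ snd x) ` (?A \<times> ?B)"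
  have fin: "finite ?A" "finite ?B" using assms carrier_supp by auto
  have "Phi (fa_mult p q) l = (\<Sum>w\<in>?C. scal (fa_mult p q w) * wm l w)"
  proof (rule Phi_superset)
    show "finite ?C" using fin by (intro finite_imageI finite_cartesian_product)
    show "fa_mult p q w = 0" if "w \<notin> ?C" for w
      by (rule fa_mult_support[of ?A ?B p q w]) (use that fin in auto)
  qed
  also have "\<dots> = (\<Sum>w\<in>?C. \<Sum>x\<in>{x \<in> ?A \<times> ?B. fst x @ snd x = w}. (scal (p (fst x)) * wm l (fst x)) * (scal (q (snd x)) * wm l (snd x)))"
  proof (intro sum.cong refl)
    fix w
    have "fa_mult p q w = (\<Sum>x\<in>{x \<in> ?A \<times> ?B. fst x @ snd x = w}. p (fst x) * q (snd x))"
      by (rule fa_mult_pairs) (use fin in auto)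
    then have "scal (fa_mult p q w) * wm l w = (\<Sum>x\<in>{x \<in> ?A \<times> ?B. fst x @ snd x = w}. scal (p (fst x)) * scal (q (snd x)) * wm l w)"
      by (simp add: scal_sum scal_simps sum_distrib_right)
    also have "\<dots> = (\<Sum>x\<in>{x \<in> ?A \<times> ?B. fst x @ snd x = w}. (scal (p (fst x)) * wm l (fst x)) * (scal (q (snd x)) * wm l (snd x)))"
    proof (intro sum.cong refl)
      fix x assume "x \<in> {x \<in> ?A \<times> ?B. fst x @ snd x = w}"
      then have "wm l w = wm l (fst x) * wm l (snd x)" using wm_append by auto
      then show "scal (p (fst x)) * scal (q (snd x)) * wm l w =
        (scal (p (fst x)) * wm l (fst x)) * (scal (q (snd x)) * wm l (snd x))"
        by (metis mult.assoc scal_commute)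
    qed
    finally show "scal (fa_mult p q w) * wm l w =
      (\<Sum>x\<in>{x \<in> ?A \<times> ?B. fst x @ snd x = w}. (scal (p (fst x)) * wm l (fst x)) * (scal (q (snd x)) * wm l (snd x)))" .
  qed
  also have "\<dots> = (\<Sum>x\<in>?A \<times> ?B. (scal (p (fst x)) * wm l (fst x)) * (scal (q (snd x)) * wm l (snd x)))"
    by (rule sum.group) (use fin in auto)
  also have "\<dots> = Phi p l * Phi q l"
    unfolding Phi_def sum_product by (simp add: sum.cartesian_product case_prod_unfold)
  finally show ?thesis .
qed

lemma fa_star_alt: "fa_star (fa_add p q) = fa_add (fa_star p) (fa_star q)"
  "fa_star (fa_smult a p) = fa_smult (cnj a) (fa_star p)" "fa_star fa_zero = fa_zero"
  "fa_star (wmon w) = wmon (rev (map Not w))"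
proof -
  show "fa_star (wmon w) = wmon (rev (map Not w))"
    unfolding fa_star_def wmon_def fun_eq_iff using star_word_inj by (metis complex_cnj_one complex_cnj_zero)
qed (simp_all add: fun_eq_iff fa_star_def fa_add_def fa_smult_def fa_zero_def)

lemma Phi_star: assumes "p \<in> fa_carrier" shows "Phi (fa_star p) l = adj (Phi p l)"
  using assms
proof (induction rule: carrier_induct)
  case zero show ?case by (simp add: fa_star_alt Phi_basic adj_simps)
next
  case (mon a w) show ?case
    by (simp add: fa_star_alt Phi_smult Phi_mon adj_simps wm_star scal_commute)
next
  case (add p q) then show ?case by (simp add: fa_star_alt Phi_add adj_simps)
qed

lemma Phi_ideal: assumes "p \<in> rel_ideal" "in_disc l" shows "Phi p l = 0"
  using assms(1)
proof (induction rule: rel_ideal.induct)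
  case zero show ?case by (simp add: Phi_basic)
next
  case (add p q) then show ?case by (simp add: Phi_add ideal_carrier)
next
  case (gen a b)
  have "Phi rel l = 0" using X2_relation[OF assms(2)]
    by (simp add: rel_def Phi_diff Phi_add Phi_mult Phi_basic)
  with gen show ?case by (simp add: Phi_mult)
qed

lemma A_eq_imp_Phi: assumes "A_eq p q" "p \<in> fa_carrier" "q \<in> fa_carrier" "in_disc l" shows "Phi p l = Phi q l"
  using Phi_ideal[of "fa_diff p q" l] assms by (simp add: A_eq_def Phi_diff)

subsection \<open>Faithfulness\<close>

lemma infinite_unit_circle: "infinite (range cis)"
proof
  assume "finite (range cis)"
  then have "finite (cis ` {0..pi})" by (rule finite_subset[rotated]) auto
  moreover have "inj_on cis {0..pi}"
  proof (rule inj_onI)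
    fix x y assume "x \<in> {0..pi}" "y \<in> {0..pi}" "cis x = cis y"
    moreover from this have "cos x = cos y" by (simp add: complex_eq_iff)
    ultimately show "x = y" using cos_inj_pi[of x y] by auto
  qed
  ultimately have "finite {0..pi}" by (rule finite_imageD)
  then show False using infinite_Icc[OF pi_gt_zero] by simp
qed

text \<open>Put \<open>l = r u\<close> with \<open>|u| = 1\<close>. For fixed \<open>u\<close> the
  sum is a polynomial in \<open>r\<close> with infinitely many zeros, so its coefficient at
  \<open>r^n\<close> is 0; times \<open>u^n\<close> it is a polynomial \<open>Q\<close> in
  \<open>u^2\<close>, as \<open>cnj u\<close> is the inverse of \<open>u\<close>. Vanishing on the
  circle, \<open>Q\<close> is 0.\<close>

lemma poly_in_cnj_coeffs_zero:
  fixes c :: "nat \<Rightarrow> nat \<Rightarrow> complex"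
  assumes zero: "\<And>l. in_disc l \<Longrightarrow> (\<Sum>a<M. \<Sum>b<M. c a b * l ^ a * cnj l ^ b) = 0"
    and "i < M" "j < M"
  shows "c i j = 0"
proof -
  define n where "n = i + j"
  define Q where "Q = (\<Sum>a<M. \<Sum>b<M. if a + b = n then monom (c a b) a else 0)"
  have Q0: "poly Q (cis (2 * t)) = 0" for t
  proof -
    define u where "u = cis t"
    have uu: "u * cnj u = 1" unfolding u_def by (simp add: cis_cnj cis_mult)
    define P where "P = (\<Sum>a<M. \<Sum>b<M. monom (c a b * u ^ a * cnj u ^ b) (a + b))"
    have "poly P (of_real r) = 0" if "0 < r" "r < 1/2" for r
    proof -
      have "cmod (of_real r * u) < 1/2" using that by (simp add: norm_mult u_def)
      from zero[OF this] show ?thesis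
        by (simp add: P_def poly_sum poly_monom power_mult_distrib power_add mult_ac)
    qed
    then have "of_real ` {0<..<1/2::real} \<subseteq> {z. poly P z = 0}" by auto
    moreover have "infinite (of_real ` {0<..<1/2::real} :: complex set)"
    proof
      assume "finite (of_real ` {0<..<1/2::real} :: complex set)"
      then have "finite {0<..<1/2::real}" by (rule finite_imageD) (simp add: inj_on_def)
      then show False using infinite_Ioo[of 0 "1/2::real"] by simp
    qed
    ultimately have "P = 0" using poly_roots_finite[of P] finite_subset by blast
    then have "0 = coeff P n * u ^ n" by simp
    also have "\<dots> = (\<Sum>a<M. \<Sum>b<M. (if a + b = n then c a b * u ^ a * cnj u ^ b else 0) * u ^ n)"
      by (simp add: P_def coeff_sum sum_distrib_right)
    also have "\<dots> = (\<Sum>a<M. \<Sum>b<M. if a + b = n then c a b * (u * u) ^ a else 0)"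
    proof (intro sum.cong refl)
      fix a b
      have "u ^ a * cnj u ^ b * u ^ (a + b) = (u * u) ^ a * (u * cnj u) ^ b"
        by (simp add: power_add power_mult_distrib mult_ac)
      then have "c a b * u ^ a * cnj u ^ b * u ^ (a + b) = c a b * (u * u) ^ a"
        unfolding uu by (simp add: mult.assoc)
      then show "(if a + b = n then c a b * u ^ a * cnj u ^ b else 0) * u ^ n
        = (if a + b = n then c a b * (u * u) ^ a else 0)" by auto
    qed
    also have "u * u = cis (2 * t)" by (simp add: u_def cis_mult)
    also have "(\<Sum>a<M. \<Sum>b<M. if a + b = n then c a b * cis (2 * t) ^ a else 0) = poly Q (cis (2 * t))"
      unfolding Q_def poly_sum by (intro sum.cong refl) (simp add: poly_monom)
    finally show ?thesis by simp
  qed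
  have "range cis \<subseteq> {z. poly Q z = 0}" using Q0[of "_ / 2"] by auto
  then have "Q = 0" using poly_roots_finite[of Q] finite_subset infinite_unit_circle by blast
  then have "0 = coeff Q i" by simp
  also have "\<dots> = (\<Sum>a<M. \<Sum>b<M. if a = i then (if b = j then c i j else 0) else 0)"
    unfolding Q_def coeff_sum by (intro sum.cong refl) (auto simp: n_def)
  also have "\<dots> = (\<Sum>a<M. if a = i then c i j else 0)"
    by (intro sum.cong refl) (simp add: assms(3))
  also have "\<dots> = c i j" using assms(2) by simp
  finally show ?thesis by simp
qed

lemma sum_even_odd: "(\<Sum>i<2*M. f i) = (\<Sum>a<M. f (2*a) + f (2*a+1))" for f :: "nat \<Rightarrow> 'a::comm_monoid_add"
  by (induction M) (simp_all add: add.assoc)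

lemma wm_nword: "wm l (nword i j) = X2 l ^ i * adj (X2 l) ^ j"
proof -
  have "prod_list (replicate n a) = a ^ n" for n and a :: m2 by (induction n) auto
  then show ?thesis by (simp add: wm_def nword_def gm_def map_replicate)
qed

lemma scal_power: "scal z ^ n = scal (z ^ n)"
  by (induction n) (simp_all add: scal_simps)

text \<open>Since \<open>X2 l\<close> and its adjoint have scalar squares, splitting exponents by
  parity collects \<open>Phi q l\<close> into multiples of \<open>1\<close>, \<open>x\<close>,
  \<open>x*\<close>, \<open>x x*\<close> by polynomials in \<open>l\<close> and
  \<open>cnj l\<close>. These vanish by \<open>X2_independent\<close>, and so do their
  coefficients.\<close>

lemma nf_zero_of_Phi:
  assumes "q \<in> normal_forms" "\<And>l. in_disc l \<Longrightarrow> Phi q l = 0"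
  shows "q = fa_zero"
proof -
  define c where "c i j = q (nword i j)" for i j
  have fin: "finite {w. q w \<noteq> 0}" using assms(1) nf_carrier carrier_supp by blast
  \<comment> \<open>Coefficients vanish unless both exponents are below \<open>M\<close>; the range
    up to \<open>2 * M\<close> used later allows pairing by parity.\<close>
  obtain M where M: "\<And>w. q w \<noteq> 0 \<Longrightarrow> length w < M"
    using finite_nat_set_iff_bounded[of "length ` {w. q w \<noteq> 0}"] fin by auto
  have Z: "c i j = 0" if "i \<ge> M \<or> j \<ge> M" for i j
  proof (rule ccontr)
    assume "c i j \<noteq> 0"
    then have "length (nword i j) < M" by (intro M) (simp add: c_def)
    then show False using that by (auto simp: nword_def)
  qed
  define D where "D = {..<2*M} \<times> {..<2*M}"
  define Z' where "Z' e e' l = (\<Sum>a<M. \<Sum>b<M. c (2*a+e) (2*b+e') * l ^ a * cnj l ^ b)" for e e' l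
  have form: "Phi q l = scal (Z' 0 0 l) + scal (Z' 1 0 l) * X2 l + scal (Z' 0 1 l) * adj (X2 l)
      + scal (Z' 1 1 l) * (X2 l * adj (X2 l))" if l: "in_disc l" for l
  proof -
    let ?X = "X2 l" and ?Y = "adj (X2 l)"
    have "Phi q l = (\<Sum>w\<in>(\<lambda>(i,j). nword i j) ` D. scal (q w) * wm l w)"
    proof (rule Phi_superset)
      show "finite ((\<lambda>(i,j). nword i j) ` D)" by (simp add: D_def)
      fix w assume w: "w \<notin> (\<lambda>(i,j). nword i j) ` D"
      show "q w = 0"
      proof (rule ccontr)
        assume qw: "q w \<noteq> 0"
        then obtain i j where ij: "w = nword i j" using nf_support[OF assms(1)] by blast
        have "c i j \<noteq> 0" using qw unfolding c_def ij .
        then have "\<not> (M \<le> i \<or> M \<le> j)" using Z[of i j] by blast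
        then have "(i, j) \<in> D" by (simp add: D_def)
        then have "w \<in> (\<lambda>(i,j). nword i j) ` D" unfolding ij by (rule rev_image_eqI) simp
        then show False using w by blast
      qed
    qed
    also have "\<dots> = (\<Sum>(i,j)\<in>D. scal (c i j) * (?X ^ i * ?Y ^ j))"
      by (subst sum.reindex) (auto simp: inj_on_def c_def wm_nword case_prod_unfold dest: nword_inj)
    also have "\<dots> = (\<Sum>i<2*M. \<Sum>j<2*M. scal (c i j) * (?X ^ i * ?Y ^ j))"
      unfolding D_def by (rule sum.cartesian_product[symmetric])
    also have "\<dots> = (\<Sum>a<M. \<Sum>b<M. scal (c (2*a) (2*b)) * (?X ^ (2*a) * ?Y ^ (2*b)) + scal (c (2*a) (2*b+1)) * (?X ^ (2*a) * ?Y ^ (2*b+1))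
       + (scal (c (2*a+1) (2*b)) * (?X ^ (2*a+1) * ?Y ^ (2*b)) + scal (c (2*a+1) (2*b+1)) * (?X ^ (2*a+1) * ?Y ^ (2*b+1))))"
      unfolding sum_even_odd sum.distrib by (simp only: add.assoc add.left_commute)
    also have "\<dots> = (\<Sum>a<M. \<Sum>b<M. scal (c (2*a) (2*b) * l ^ a * cnj l ^ b) + scal (c (2*a) (2*b+1) * l ^ a * cnj l ^ b) * ?Y
       + (scal (c (2*a+1) (2*b) * l ^ a * cnj l ^ b) * ?X + scal (c (2*a+1) (2*b+1) * l ^ a * cnj l ^ b) * (?X * ?Y)))"
    proof (intro sum.cong refl)
      fix a b
      have xa: "?X ^ (2*a) = scal (l ^ a)" "?Y ^ (2*b) = scal (cnj l ^ b)"
        unfolding power_mult power2_eq_square X2_sq[OF l] X2_adj_sq[OF l] scal_power by simp_all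
      have xb: "?X ^ (2*a+1) = scal (l ^ a) * ?X" "?Y ^ (2*b+1) = scal (cnj l ^ b) * ?Y"
        unfolding power_add xa by simp_all
      show "scal (c (2*a) (2*b)) * (?X ^ (2*a) * ?Y ^ (2*b)) + scal (c (2*a) (2*b+1)) * (?X ^ (2*a) * ?Y ^ (2*b+1))
       + (scal (c (2*a+1) (2*b)) * (?X ^ (2*a+1) * ?Y ^ (2*b)) + scal (c (2*a+1) (2*b+1)) * (?X ^ (2*a+1) * ?Y ^ (2*b+1)))
       = scal (c (2*a) (2*b) * l ^ a * cnj l ^ b) + scal (c (2*a) (2*b+1) * l ^ a * cnj l ^ b) * ?Y
       + (scal (c (2*a+1) (2*b) * l ^ a * cnj l ^ b) * ?X + scal (c (2*a+1) (2*b+1) * l ^ a * cnj l ^ b) * (?X * ?Y))"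
        unfolding xa xb by (simp add: m2_eq_iff mult_ac)
    qed
    also have "\<dots> = scal (Z' 0 0 l) + scal (Z' 1 0 l) * X2 l + scal (Z' 0 1 l) * adj (X2 l)
      + scal (Z' 1 1 l) * (X2 l * adj (X2 l))"
      by (simp add: Z'_def scal_sum sum_distrib_right sum.distrib)
    finally show ?thesis .
  qed
  have cc: "c (2*a+e) (2*b+e') = 0" if "a < M" "b < M" "e = 0 \<or> e = 1" "e' = 0 \<or> e' = 1" for a b e e'
  proof (rule poly_in_cnj_coeffs_zero[where M = M and c = "\<lambda>a b. c (2*a+e) (2*b+e')"])
    fix l :: complex assume l: "in_disc l"
    have "scal (Z' 0 0 l) + scal (Z' 1 0 l) * X2 l + scal (Z' 0 1 l) * adj (X2 l)
      + scal (Z' 1 1 l) * (X2 l * adj (X2 l)) = 0" using form[OF l] assms(2)[OF l] by simp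
    from X2_independent[OF l this] have "Z' e e' l = 0" using that(3,4) by auto
    then show "(\<Sum>a<M. \<Sum>b<M. c (2 * a + e) (2 * b + e') * l ^ a * cnj l ^ b) = 0" by (simp add: Z'_def)
  qed (use that in auto)
  have "c i j = 0" for i j
  proof (cases "i < M \<and> j < M")
    case True
    then have "c (2 * (i div 2) + i mod 2) (2 * (j div 2) + j mod 2) = 0" by (intro cc) auto
    then show ?thesis by simp
  next
    case False then show ?thesis using Z by (simp add: not_less)
  qed
  then show ?thesis
    unfolding fa_zero_def fun_eq_iff using nf_support[OF assms(1)] c_def by metis
qed

text \<open>Reduce the difference to normal form. This lets equations in \<open>A\<close> be
  verified on 2 by 2 matrices and then be transported to arbitrary representations.\<close>

theorem A_eq_iff_Phi:
  assumes "p \<in> fa_carrier" "q \<in> fa_carrier"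
  shows "A_eq p q \<longleftrightarrow> (\<forall>l. in_disc l \<longrightarrow> Phi p l = Phi q l)"
proof
  assume "A_eq p q" then show "\<forall>l. in_disc l \<longrightarrow> Phi p l = Phi q l" using A_eq_imp_Phi assms by blast
next
  assume e: "\<forall>l. in_disc l \<longrightarrow> Phi p l = Phi q l"
  have c: "fa_diff p q \<in> fa_carrier" using assms by simp
  then obtain r where r: "r \<in> normal_forms" "A_eq (fa_diff p q) r" using carrier_has_nf unfolding has_nf_def by blast
  have "Phi r l = 0" if "in_disc l" for l
    using A_eq_imp_Phi[OF r(2) c nf_carrier[OF r(1)] that] e that assms by (simp add: Phi_diff)
  then have "r = fa_zero" using nf_zero_of_Phi r(1) by blast
  then have "fa_diff (fa_diff p q) fa_zero \<in> rel_ideal" using r(2) by (simp add: A_eq_def)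
  then show "A_eq p q" by (simp add: A_eq_def fa_diff_def fa_zero_def)
qed

subsection \<open>Real polynomial functions on the disc\<close>

abbreviation rl :: "real poly poly \<Rightarrow> complex \<Rightarrow> real" where "rl h l \<equiv> rv h (Re l) (Im l)"

definition rpoly :: "(complex \<Rightarrow> complex) \<Rightarrow> bool" where
  "rpoly \<phi> \<longleftrightarrow> (\<exists>h k. \<forall>l. \<phi> l = Complex (rl h l) (rl k l))"

lemma rpolyE: assumes "rpoly \<phi>" obtains h k where "\<And>l. \<phi> l = Complex (rl h l) (rl k l)"
  using assms unfolding rpoly_def by blast

lemma rpoly_const: "rpoly (\<lambda>l. c)"
  unfolding rpoly_def by (intro exI[of _ "polyC (Re c)"] exI[of _ "polyC (Im c)"]) (simp add: complex_eq_iff)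

lemma rpoly_id: "rpoly (\<lambda>l. l)"
  unfolding rpoly_def by (intro exI[of _ polyX] exI[of _ polyY]) (simp add: complex_eq_iff)

lemma rpoly_cnj: "rpoly (\<lambda>l. cnj l)"
  unfolding rpoly_def by (intro exI[of _ polyX] exI[of _ "- polyY"]) (simp add: complex_eq_iff evr.ev_uminus)

lemma rpoly_add: assumes "rpoly f" "rpoly g" shows "rpoly (\<lambda>l. f l + g l)"
proof -
  obtain h k where "\<And>l. f l = Complex (rl h l) (rl k l)" using assms(1) rpolyE by blast
  moreover obtain h' k' where "\<And>l. g l = Complex (rl h' l) (rl k' l)" using assms(2) rpolyE by blast
  ultimately show ?thesis unfolding rpoly_def
    by (intro exI[of _ "h + h'"] exI[of _ "k + k'"]) (simp add: complex_eq_iff evr.ev_add)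
qed

lemma rpoly_mult: assumes "rpoly f" "rpoly g" shows "rpoly (\<lambda>l. f l * g l)"
proof -
  obtain h k where "\<And>l. f l = Complex (rl h l) (rl k l)" using assms(1) rpolyE by blast
  moreover obtain h' k' where "\<And>l. g l = Complex (rl h' l) (rl k' l)" using assms(2) rpolyE by blast
  ultimately show ?thesis unfolding rpoly_def
    by (intro exI[of _ "h * h' - k * k'"] exI[of _ "h * k' + k * h'"])
      (simp add: complex_eq_iff evr.ev_add evr.ev_mult evr.ev_minus)
qed

lemma rpoly_uminus: "rpoly f \<Longrightarrow> rpoly (\<lambda>l. - f l)"
  using rpoly_mult[OF rpoly_const[of "-1"]] by simp

lemma rpoly_diff: "rpoly f \<Longrightarrow> rpoly g \<Longrightarrow> rpoly (\<lambda>l. f l - g l)"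
  using rpoly_add[OF _ rpoly_uminus, of f g] by simp

lemmas rpoly_intros = rpoly_const rpoly_id rpoly_cnj rpoly_add rpoly_mult rpoly_uminus rpoly_diff

text \<open>Coordinates with respect to \<open>1\<close>, \<open>x\<close>, \<open>x*\<close>,
  \<open>x x*\<close>. For \<open>Phi p l\<close> they can be chosen polynomial in
  \<open>Re l\<close> and \<open>Im l\<close>, in contrast to the matrix entries, which contain
  square roots.\<close>

definition comb :: "complex \<Rightarrow> complex \<Rightarrow> complex \<Rightarrow> complex \<Rightarrow> complex \<Rightarrow> m2" where
  "comb l a b c d = scal a + scal b * X2 l + scal c * adj (X2 l) + scal d * (X2 l * adj (X2 l))"

lemma comb_lmult_X2:
  assumes "in_disc l" shows "X2 l * comb l a b c d = comb l (l * b) a (l * d) c"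
proof -
  let ?X = "X2 l" and ?Y = "adj (X2 l)"
  have "?X * comb l a b c d = scal a * ?X + scal b * (?X * ?X) + scal c * (?X * ?Y) + scal d * ((?X * ?X) * ?Y)"
    unfolding comb_def by (simp add: distrib_left mult.assoc[symmetric] scal_commute)
  then show ?thesis unfolding X2_sq[OF assms] comb_def by (simp add: m2_eq_iff algebra_simps)
qed

lemma comb_lmult_adj:
  assumes "in_disc l"
  shows "adj (X2 l) * comb l a b c d = comb l (b + cnj l * c) (- (cnj l * d)) (a + d) (- b)"
proof -
  let ?X = "X2 l" and ?Y = "adj (X2 l)"
  have yx: "?Y * ?X = 1 - ?X * ?Y" using X2_relation[OF assms] by (simp add: algebra_simps)
  have "?Y * (?X * ?Y) = (1 - ?X * ?Y) * ?Y" unfolding yx[symmetric] by (simp add: mult.assoc)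
  also have "\<dots> = ?Y - ?X * (?Y * ?Y)" by (simp add: algebra_simps)
  also have "\<dots> = ?Y - scal (cnj l) * ?X" unfolding X2_adj_sq[OF assms] scal_commute ..
  finally have yxy: "?Y * (?X * ?Y) = ?Y - scal (cnj l) * ?X" .
  have "?Y * comb l a b c d = scal a * ?Y + scal b * (?Y * ?X) + scal c * (?Y * ?Y) + scal d * (?Y * (?X * ?Y))"
  proof -
    have "?Y * (scal z * M) = scal z * (?Y * M)" for z M by (metis mult.assoc scal_commute)
    then show ?thesis unfolding comb_def by (simp add: distrib_left scal_commute)
  qed
  also have "\<dots> = comb l (b + cnj l * c) (- (cnj l * d)) (a + d) (- b)"
    unfolding yx yxy X2_adj_sq[OF assms] comb_def by (simp add: m2_eq_iff algebra_simps)
  finally show ?thesis .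
qed

lemma Phi_comb:
  assumes "p \<in> fa_carrier"
  shows "\<exists>a b c d. rpoly a \<and> rpoly b \<and> rpoly c \<and> rpoly d \<and>
    (\<forall>l. in_disc l \<longrightarrow> Phi p l = comb l (a l) (b l) (c l) (d l))"
  using assms
proof (induction rule: carrier_induct)
  case zero
  show ?case by (intro exI[of _ "\<lambda>_. 0"]) (auto intro!: rpoly_intros simp: Phi_basic comb_def scal_simps)
next
  case (mon s w)
  have "\<exists>a b c d. rpoly a \<and> rpoly b \<and> rpoly c \<and> rpoly d \<and>
    (\<forall>l. in_disc l \<longrightarrow> wm l w = comb l (a l) (b l) (c l) (d l))"
  proof (induction w)
    case Nil
    show ?case by (intro exI[of _ "\<lambda>_. 1"] exI[of _ "\<lambda>_. 0"])
      (auto intro!: rpoly_intros simp: wm_def comb_def scal_simps)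
  next
    case (Cons x w)
    then obtain a b c d where r: "rpoly a" "rpoly b" "rpoly c" "rpoly d" and
      w: "\<And>l. in_disc l \<Longrightarrow> wm l w = comb l (a l) (b l) (c l) (d l)" by blast
    show ?case
    proof (cases x)
      case True
      then have gx: "wm l (x # w) = X2 l * wm l w" for l by (simp add: wm_def gm_def)
      show ?thesis
        by (rule exI[of _ "\<lambda>l. l * b l"], rule exI[of _ a], rule exI[of _ "\<lambda>l. l * d l"], rule exI[of _ c])
          (auto intro!: rpoly_intros r simp only: gx w comb_lmult_X2)
    next
      case False
      then have gx: "wm l (x # w) = adj (X2 l) * wm l w" for l by (simp add: wm_def gm_def)
      show ?thesis
        by (rule exI[of _ "\<lambda>l. b l + cnj l * c l"], rule exI[of _ "\<lambda>l. - (cnj l * d l)"],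
            rule exI[of _ "\<lambda>l. a l + d l"], rule exI[of _ "\<lambda>l. - b l"])
          (auto intro!: rpoly_intros r simp only: gx w comb_lmult_adj)
    qed
  qed
  then obtain a b c d where r: "rpoly a" "rpoly b" "rpoly c" "rpoly d" and
    w: "\<And>l. in_disc l \<Longrightarrow> wm l w = comb l (a l) (b l) (c l) (d l)" by blast
  show ?case
    by (rule exI[of _ "\<lambda>l. s * a l"], rule exI[of _ "\<lambda>l. s * b l"], rule exI[of _ "\<lambda>l. s * c l"], rule exI[of _ "\<lambda>l. s * d l"])
      (auto intro!: rpoly_intros r simp: Phi_smult Phi_mon w comb_def scal_simps distrib_left mult.assoc)
next
  case (add p q)
  from add.IH(1) obtain a b c d where r: "rpoly a" "rpoly b" "rpoly c" "rpoly d" and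
    w: "\<And>l. in_disc l \<Longrightarrow> Phi p l = comb l (a l) (b l) (c l) (d l)" by blast
  from add.IH(2) obtain a' b' c' d' where r': "rpoly a'" "rpoly b'" "rpoly c'" "rpoly d'" and
    w': "\<And>l. in_disc l \<Longrightarrow> Phi q l = comb l (a' l) (b' l) (c' l) (d' l)" by blast
  show ?case
    by (rule exI[of _ "\<lambda>l. a l + a' l"], rule exI[of _ "\<lambda>l. b l + b' l"], rule exI[of _ "\<lambda>l. c l + c' l"], rule exI[of _ "\<lambda>l. d l + d' l"])
      (use add.hyps in \<open>auto intro!: rpoly_intros r r' simp: Phi_add w w' comb_def scal_simps distrib_right\<close>)
qed

text \<open>\<open>u\<close> and \<open>v\<close> enter only through \<open>u v = l\<close>,
  \<open>u cnj v = cnj l\<close> and \<open>u^2 + |v|^2 = 1\<close>, so the square roots disappear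
  from trace and determinant.\<close>

lemma comb_tr_det:
  assumes l: "in_disc l"
  shows "tr2 (comb l a b c d) = 2 * a + d"
    "det2 (comb l a b c d) = a * a + a * d + d * d * (l * cnj l) - (b * b * l + b * c + c * c * cnj l)"
proof -
  define u where "u = complex_of_real (uu l)"
  define v where "v = vv l"
  have uv: "u * v = l" unfolding u_def v_def by (rule uu_vv[OF l])
  have uv': "u * cnj v = cnj l" using arg_cong[OF uv, of cnj] by (simp add: u_def)
  have one: "u * u + v * cnj v = 1"
    using arg_cong[OF X2_relation[OF l], of m22] by (simp add: u_def v_def mult.commute)
  have e: "m11 (comb l a b c d) = a + d * (u * u)" "m22 (comb l a b c d) = a + d * (v * cnj v)"
    "m12 (comb l a b c d) = b * u + c * cnj v" "m21 (comb l a b c d) = b * v + c * u"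
    by (simp_all add: comb_def u_def v_def)
  have "tr2 (comb l a b c d) = 2 * a + d * (u * u + v * cnj v)" by (simp add: tr2_def e algebra_simps)
  then show "tr2 (comb l a b c d) = 2 * a + d" by (simp add: one)
  have "det2 (comb l a b c d) = a * a + a * d * (u * u + v * cnj v) + d * d * ((u * v) * (u * cnj v))
    - (b * b * (u * v) + b * c * (u * u + v * cnj v) + c * c * (u * cnj v))"
    by (simp add: det2_def e algebra_simps)
  then show "det2 (comb l a b c d) = a * a + a * d + d * d * (l * cnj l) - (b * b * l + b * c + c * c * cnj l)"
    unfolding one uv uv' by simp
qed

lemma hermitian_tr_det:
  assumes "y \<in> fa_carrier" "\<And>l. in_disc l \<Longrightarrow> adj (Phi y l) = Phi y l"
  obtains t n where "\<And>l. in_disc l \<Longrightarrow> tr2 (Phi y l) = of_real (rl t l)"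
    "\<And>l. in_disc l \<Longrightarrow> det2 (Phi y l) = of_real (rl n l)"
proof -
  obtain a b c d where r: "rpoly a" "rpoly b" "rpoly c" "rpoly d" and
    w: "\<And>l. in_disc l \<Longrightarrow> Phi y l = comb l (a l) (b l) (c l) (d l)" using Phi_comb[OF assms(1)] by blast
  have "rpoly (\<lambda>l. 2 * a l + d l)" by (intro rpoly_intros r)
  then obtain t t' where t: "\<And>l. 2 * a l + d l = Complex (rl t l) (rl t' l)" using rpolyE by blast
  have "rpoly (\<lambda>l. a l * a l + a l * d l + d l * d l * (l * cnj l) - (b l * b l * l + b l * c l + c l * c l * cnj l))"
    by (intro rpoly_intros r)
  then obtain n n' where n: "\<And>l. a l * a l + a l * d l + d l * d l * (l * cnj l) - (b l * b l * l + b l * c l + c l * c l * cnj l)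
    = Complex (rl n l) (rl n' l)" using rpolyE by blast
  have real: "z = of_real (Re z)" if "cnj z = z" for z using that by (simp add: complex_eq_iff)
  show ?thesis
  proof (rule that[of t n])
    fix l assume l: "in_disc l"
    have ad: "cnj (m11 (Phi y l)) = m11 (Phi y l)" "cnj (m22 (Phi y l)) = m22 (Phi y l)" "cnj (m12 (Phi y l)) = m21 (Phi y l)"
      using arg_cong[OF assms(2)[OF l], of m11] arg_cong[OF assms(2)[OF l], of m22] arg_cong[OF assms(2)[OF l], of m21]
      by (simp_all only: adj_sel)
    have "cnj (tr2 (Phi y l)) = tr2 (Phi y l)" by (simp only: tr2_def complex_cnj_add ad)
    then have "tr2 (Phi y l) = of_real (Re (tr2 (Phi y l)))" by (rule real)
    also have "Re (tr2 (Phi y l)) = rl t l" unfolding w[OF l] comb_tr_det[OF l] t by simp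
    finally show "tr2 (Phi y l) = of_real (rl t l)" .
    have "cnj (m12 (Phi y l) * m21 (Phi y l)) = m12 (Phi y l) * m21 (Phi y l)"
      unfolding ad(3)[symmetric] by (simp add: mult.commute)
    then have "cnj (det2 (Phi y l)) = det2 (Phi y l)"
      by (simp only: det2_def complex_cnj_diff) (simp only: complex_cnj_mult ad(1,2))
    then have "det2 (Phi y l) = of_real (Re (det2 (Phi y l)))" by (rule real)
    also have "Re (det2 (Phi y l)) = rl n l" unfolding w[OF l] comb_tr_det[OF l] n by simp
    finally show "det2 (Phi y l) = of_real (rl n l)" .
  qed
qed

text \<open>A negative value would persist nearby: contract the point into the open disc, then move
  it off the zero set of \<open>N\<close>.\<close>

lemma nonneg_on_closed_disc:
  assumes N: "N \<noteq> 0" and pos: "\<And>l. in_disc l \<Longrightarrow> rl N l \<noteq> 0 \<Longrightarrow> 0 \<le> rl h l"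
    and xy: "0 \<le> rv disc_poly x y"
  shows "0 \<le> rv h x y"
proof (rule ccontr)
  assume "\<not> 0 \<le> rv h x y"
  then obtain e where e: "e > 0" "\<And>x' y'. \<bar>x' - x\<bar> < e \<Longrightarrow> \<bar>y' - y\<bar> < e \<Longrightarrow> rv h x' y' < 0"
    using rv_neg_box[where f = h and x = x and y = y] by auto
  \<comment> \<open>As \<open>|x|, |y| \<le> 1\<close>, contracting by \<open>1 - s\<close> moves
    each coordinate by at most \<open>e/2\<close>; the later shift by less than
    \<open>d \<le> e/2\<close> uses up the rest.\<close>
  define s where "s = min (e/2) (1/2)"
  have s: "0 < s" "s \<le> e / 2" "s \<le> 1/2" using e(1) by (auto simp: s_def)
  have xy2: "4 * x\<^sup>2 + 4 * y\<^sup>2 \<le> 1" using xy unfolding rv_disc_poly by simp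
  have "x\<^sup>2 \<le> 1" "y\<^sup>2 \<le> 1" using xy2 zero_le_power2[of x] zero_le_power2[of y] by linarith+
  then have b: "\<bar>x\<bar> \<le> 1" "\<bar>y\<bar> \<le> 1" by (simp_all only: abs_square_le_1)
  define x1 where "x1 = (1 - s) * x"
  define y1 where "y1 = (1 - s) * y"
  have "(1 - s)\<^sup>2 < 1\<^sup>2" by (rule power_strict_mono) (use s in auto)
  then have "(1 - s)\<^sup>2 * (4 * x\<^sup>2 + 4 * y\<^sup>2) < 1"
    using xy2 mult_left_mono[OF xy2 zero_le_power2[of "1 - s"]] by simp
  moreover have "(1 - s)\<^sup>2 * (4 * x\<^sup>2 + 4 * y\<^sup>2) = 4 * x1\<^sup>2 + 4 * y1\<^sup>2"
    unfolding x1_def y1_def power_mult_distrib distrib_left by (simp only: mult.left_commute)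
  ultimately have "rv (- disc_poly) x1 y1 < 0"
    unfolding evr.ev_uminus rv_disc_poly by linarith
  then obtain e1 where e1: "e1 > 0"
    "\<And>x' y'. \<bar>x' - x1\<bar> < e1 \<Longrightarrow> \<bar>y' - y1\<bar> < e1 \<Longrightarrow> rv (- disc_poly) x' y' < 0"
    using rv_neg_box by blast
  define d where "d = min e1 (e/2)"
  have d: "0 < d" "d \<le> e1" "d \<le> e/2" using e(1) e1(1) by (auto simp: d_def)
  obtain x' y' where x': "x1 < x'" "x' < x1 + d" "y1 < y'" "y' < y1 + d" "rv N x' y' \<noteq> 0"
    using rv_nonzero_in_box[OF N, of x1 "x1 + d" y1 "y1 + d"] d(1) by auto
  have "rv (- disc_poly) x' y' < 0" by (rule e1(2)) (use x' d in auto)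
  then have "4 * (x'\<^sup>2 + y'\<^sup>2) < 1" unfolding evr.ev_uminus rv_disc_poly by simp
  then have "(cmod (Complex x' y'))\<^sup>2 < (1/2)\<^sup>2" unfolding cmod_power2 by (simp add: power_divide)
  then have "in_disc (Complex x' y')" by (rule power2_less_imp_less) simp
  then have "0 \<le> rv h x' y'" using pos[of "Complex x' y'"] x'(5) by simp
  moreover have "rv h x' y' < 0"
  proof (rule e(2))
    have sx: "s * \<bar>x\<bar> \<le> s * 1" "s * \<bar>y\<bar> \<le> s * 1" by (rule mult_left_mono; use b s in simp)+
    have "\<bar>x1 - x\<bar> = s * \<bar>x\<bar>" "\<bar>y1 - y\<bar> = s * \<bar>y\<bar>"
      using s by (simp_all add: x1_def y1_def algebra_simps abs_mult)
    then have "\<bar>x1 - x\<bar> \<le> e/2" "\<bar>y1 - y\<bar> \<le> e/2" using s sx by linarith+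
    then show "\<bar>x' - x\<bar> < e" "\<bar>y' - y\<bar> < e" using x' d by linarith+
  qed
  ultimately show False by simp
qed

lemma nonzero_in_disc: assumes "N \<noteq> 0" obtains l where "in_disc l" "rl N l \<noteq> 0"
proof -
  have "\<not> (\<forall>l. in_disc l \<longrightarrow> rl N l = 0)"
  proof
    assume z: "\<forall>l. in_disc l \<longrightarrow> rl N l = 0"
    \<comment> \<open>If \<open>N\<close> vanished on the disc, the positivity premise would be
      vacuous even for the constant -1.\<close>
    have "0 \<le> rv (- 1) 0 0" by (rule nonneg_on_closed_disc[OF assms]) (use z in \<open>auto simp: rv_disc_poly\<close>)
    then show False by (simp add: evr.ev_uminus evr.ev_1)
  qed
  then show ?thesis using that by blast
qed

subsection \<open>Operators on finite-dimensional Hermitian spaces\<close>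

text \<open>Vectors are encoded as polynomials through their coefficient sequences, which provides the
  additive structure; those of the space of dimension \<open>k\<close> have no coefficients from \<open>k\<close> on.\<close>
type_synonym cvec = "complex poly"

definition sc :: "complex \<Rightarrow> cvec \<Rightarrow> cvec" where "sc = Polynomial.smult"

definition ip :: "nat \<Rightarrow> cvec \<Rightarrow> cvec \<Rightarrow> complex" where
  "ip k f g = (\<Sum>i<k. cnj (coeff f i) * coeff g i)"

definition vecs :: "nat \<Rightarrow> cvec set" where "vecs k = {f. \<forall>i\<ge>k. coeff f i = 0}"

definition op :: "nat \<Rightarrow> complex mat \<Rightarrow> cvec \<Rightarrow> cvec" where
  "op k M f = (\<Sum>i<k. monom (\<Sum>j<k. M $$ (i, j) * coeff f j) i)"

lemma coeff_sc [simp]: "coeff (sc a f) i = a * coeff f i" by (simp add: sc_def)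

lemma coeff_op [simp]: "coeff (op k M f) i = (if i < k then \<Sum>j<k. M $$ (i, j) * coeff f j else 0)"
  by (simp add: op_def coeff_sum)

lemma sc_simps: "sc a (f + g) = sc a f + sc a g" "sc a (f - g) = sc a f - sc a g" "sc a (sc b f) = sc (a * b) f"
  "sc (a + b) f = sc a f + sc b f" "sc (a - b) f = sc a f - sc b f" "sc 1 f = f" "sc 0 f = 0" "sc a 0 = 0"
  by (simp_all add: poly_eq_iff algebra_simps)

lemma sc_sum: "sc a (\<Sum>i\<in>I. F i) = (\<Sum>i\<in>I. sc a (F i))"
  by (induction I rule: infinite_finite_induct) (simp_all add: sc_simps)

lemma ip_simps: "ip k (f + g) h = ip k f h + ip k g h" "ip k h (f + g) = ip k h f + ip k h g"
  "ip k (f - g) h = ip k f h - ip k g h" "ip k h (f - g) = ip k h f - ip k h g"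
  "ip k (sc a f) h = cnj a * ip k f h" "ip k h (sc a f) = a * ip k h f" "ip k f 0 = 0" "ip k 0 f = 0"
  by (simp_all add: ip_def sum.distrib sum_subtractf sum_distrib_left algebra_simps)

lemma ip_cnj: "cnj (ip k f g) = ip k g f"
  by (simp add: ip_def mult.commute)

lemma ip_self: "ip k f f = of_real (\<Sum>i<k. (cmod (coeff f i))\<^sup>2)"
proof -
  have "cnj z * z = of_real ((cmod z)\<^sup>2)" for z
    by (simp only: complex_norm_square mult.commute)
  then show ?thesis unfolding ip_def of_real_sum by (intro sum.cong) simp_all
qed

lemma ip_self_nonneg: "\<exists>r\<ge>0. ip k f f = of_real r"
  unfolding ip_self by (rule exI[of _ "\<Sum>i<k. (cmod (coeff f i))\<^sup>2"]) (simp add: sum_nonneg)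

lemma ip_self_zero: assumes "f \<in> vecs k" "ip k f f = 0" shows "f = 0"
proof (rule poly_eqI)
  fix i
  have "(\<Sum>i<k. (cmod (coeff f i))\<^sup>2) = 0" using assms(2) unfolding ip_self by (simp only: of_real_eq_0_iff)
  then have "\<forall>i\<in>{..<k}. (cmod (coeff f i))\<^sup>2 = 0" by (subst (asm) sum_nonneg_eq_0_iff) auto
  then show "coeff f i = coeff 0 i" using assms(1) by (cases "i < k") (auto simp: vecs_def)
qed

lemma vecs_closed: "f \<in> vecs k \<Longrightarrow> g \<in> vecs k \<Longrightarrow> f + g \<in> vecs k" "f \<in> vecs k \<Longrightarrow> g \<in> vecs k \<Longrightarrow> f - g \<in> vecs k"
  "f \<in> vecs k \<Longrightarrow> sc a f \<in> vecs k" "op k M f \<in> vecs k" "0 \<in> vecs k"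
  by (simp_all add: vecs_def)

lemma op_linear: "op k M (f + g) = op k M f + op k M g" "op k M (sc a f) = sc a (op k M f)"
  by (simp_all add: poly_eq_iff sum.distrib sum_distrib_left algebra_simps)

lemma op_add:
  assumes "A \<in> carrier_mat k k" "B \<in> carrier_mat k k"
  shows "op k (A + B) f = op k A f + op k B f"
proof (rule poly_eqI)
  fix i
  have "(\<Sum>j<k. (A + B) $$ (i, j) * coeff f j) = (\<Sum>j<k. A $$ (i, j) * coeff f j + B $$ (i, j) * coeff f j)" if "i < k"
    by (rule sum.cong) (use assms that in \<open>auto simp: distrib_right\<close>)
  then show "coeff (op k (A + B) f) i = coeff (op k A f + op k B f) i"
    unfolding coeff_add coeff_op sum.distrib by (cases "i < k") simp_all
qed

lemma op_smult:
  assumes "A \<in> carrier_mat k k"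
  shows "op k (a \<cdot>\<^sub>m A) f = sc a (op k A f)"
proof (rule poly_eqI)
  fix i
  have "(\<Sum>j<k. (a \<cdot>\<^sub>m A) $$ (i, j) * coeff f j) = (\<Sum>j<k. a * (A $$ (i, j) * coeff f j))" if "i < k"
    by (rule sum.cong) (use assms that in auto)
  then show "coeff (op k (a \<cdot>\<^sub>m A) f) i = coeff (sc a (op k A f)) i"
    unfolding coeff_sc coeff_op sum_distrib_left by (cases "i < k") (simp_all add: sum_distrib_left)
qed

lemma op_one: assumes "f \<in> vecs k" shows "op k (1\<^sub>m k) f = f"
proof (rule poly_eqI)
  fix i
  show "coeff (op k (1\<^sub>m k) f) i = coeff f i"
  proof (cases "i < k")
    case True
    have "(\<Sum>j<k. 1\<^sub>m k $$ (i, j) * coeff f j) = (\<Sum>j<k. if j = i then coeff f j else 0)"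
      by (rule sum.cong) (use True in auto)
    then show ?thesis using True by simp
  next
    case False then show ?thesis using assms by (simp add: vecs_def)
  qed
qed

lemma op_mult:
  assumes "A \<in> carrier_mat k k" "B \<in> carrier_mat k k"
  shows "op k (A * B) f = op k A (op k B f)"
proof (rule poly_eqI)
  fix i
  show "coeff (op k (A * B) f) i = coeff (op k A (op k B f)) i"
  proof (cases "i < k")
    case True
    have "coeff (op k (A * B) f) i = (\<Sum>j<k. (\<Sum>m<k. A $$ (i, m) * B $$ (m, j)) * coeff f j)"
      using assms True by (auto simp: scalar_prod_def lessThan_atLeast0 intro!: sum.cong)
    also have "\<dots> = (\<Sum>j<k. \<Sum>m<k. A $$ (i, m) * (B $$ (m, j) * coeff f j))"
      by (simp add: sum_distrib_right mult.assoc)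
    also have "\<dots> = (\<Sum>m<k. \<Sum>j<k. A $$ (i, m) * (B $$ (m, j) * coeff f j))" by (rule sum.swap)
    also have "\<dots> = coeff (op k A (op k B f)) i" using True by (simp add: sum_distrib_left)
    finally show ?thesis .
  next
    case False then show ?thesis by simp
  qed
qed

lemma mat_adjoint_index:
  assumes "M \<in> carrier_mat k k" "i < k" "j < k"
  shows "mat_adjoint M $$ (i, j) = cnj (M $$ (j, i))"
  using assms by (auto simp: mat_adjoint_def mat_of_rows_def)

lemma ip_adjoint: assumes "M \<in> carrier_mat k k" shows "ip k f (op k M g) = ip k (op k (mat_adjoint M) f) g"
proof -
  have "ip k f (op k M g) = (\<Sum>i<k. \<Sum>j<k. cnj (coeff f i) * (M $$ (i, j) * coeff g j))"
    by (simp add: ip_def sum_distrib_left)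
  also have "\<dots> = (\<Sum>j<k. \<Sum>i<k. cnj (coeff f i) * (M $$ (i, j) * coeff g j))" by (rule sum.swap)
  also have "\<dots> = (\<Sum>j<k. cnj (\<Sum>i<k. mat_adjoint M $$ (j, i) * coeff f i) * coeff g j)"
    using assms by (auto simp: mat_adjoint_index sum_distrib_right sum_distrib_left mult_ac intro!: sum.cong)
  also have "\<dots> = ip k (op k (mat_adjoint M) f) g" by (simp add: ip_def)
  finally show ?thesis .
qed

lemma psd_mat_iff_ip:
  assumes M: "M \<in> carrier_mat k k" and pos: "\<And>f. f \<in> vecs k \<Longrightarrow> \<exists>r\<ge>0. ip k f (op k M f) = of_real r"
  shows "psd_mat k M"
  unfolding psd_mat_def
proof (intro conjI ballI M)
  fix v :: "complex vec" assume v: "v \<in> carrier_vec k"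
  define f where "f = (\<Sum>i<k. monom (v $ i) i)"
  have cf: "coeff f i = (if i < k then v $ i else 0)" for i by (simp add: f_def coeff_sum)
  have "conjugate v \<bullet> (M *\<^sub>v v) = (\<Sum>i<k. cnj (v $ i) * (\<Sum>j<k. M $$ (i, j) * v $ j))"
    using v M by (auto simp: scalar_prod_def lessThan_atLeast0 intro!: sum.cong)
  also have "\<dots> = ip k f (op k M f)" by (simp add: ip_def cf)
  finally have e: "conjugate v \<bullet> (M *\<^sub>v v) = ip k f (op k M f)" .
  have "f \<in> vecs k" by (simp add: vecs_def cf)
  then obtain r where "r \<ge> 0" "conjugate v \<bullet> (M *\<^sub>v v) = of_real r" using pos e by metis
  then show "conjugate v \<bullet> (M *\<^sub>v v) \<in> \<real>" "0 \<le> Re (conjugate v \<bullet> (M *\<^sub>v v))" by auto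
qed

section \<open>Annihilating polynomials in factored form, and eigenvectors\<close>

fun shifts :: "(cvec \<Rightarrow> cvec) \<Rightarrow> complex list \<Rightarrow> cvec \<Rightarrow> cvec" where
  "shifts S [] f = f"
| "shifts S (m # ms) f = S (shifts S ms f) - sc m (shifts S ms f)"

locale linear_op =
  fixes S :: "cvec \<Rightarrow> cvec"
  assumes S_add: "S (f + g) = S f + S g" and S_sc: "S (sc a f) = sc a (S f)"
begin

lemma S_zero: "S 0 = 0" using S_sc[of 0 0] by (simp add: sc_simps)

lemma S_diff: "S (f - g) = S f - S g"
  using S_add[of "f - g" g] by (simp add: algebra_simps)

lemma S_sum: "S (\<Sum>i\<in>I. F i) = (\<Sum>i\<in>I. S (F i))"
  by (induction I rule: infinite_finite_induct) (simp_all add: S_zero S_add)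

lemma shifts_diff: "shifts S ms (f - g) = shifts S ms f - shifts S ms g"
proof (induction ms)
  case (Cons a ms)
  show ?case unfolding shifts.simps Cons.IH S_diff sc_simps by (simp add: algebra_simps)
qed simp

lemma shifts_eigen: "S e = sc m e \<Longrightarrow> shifts S ms e = sc (\<Prod>a\<leftarrow>ms. m - a) e"
  by (induction ms) (simp_all add: S_sc sc_simps algebra_simps)

text \<open>The factors commute, so \<open>S - m\<close> can be moved to the outside.\<close>

lemma shifts_member:
  assumes "m \<in> set ms" shows "\<exists>g. shifts S ms f = S g - sc m g"
  using assms
proof (induction ms)
  case (Cons a ms)
  show ?case
  proof (cases "a = m")
    case True then show ?thesis by auto
  next
    case False
    then obtain g where g: "shifts S ms f = S g - sc m g" using Cons by auto
    have "shifts S (a # ms) f = S (S g - sc a g) - sc m (S g - sc a g)"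
      by (simp add: g S_diff S_sc sc_simps mult.commute)
    then show ?thesis by blast
  qed
qed simp

text \<open>\<open>p(S) f\<close>, with a summation bound \<open>N\<close> kept apart from the
  degree so that different polynomials share one range.\<close>

definition pact :: "nat \<Rightarrow> complex poly \<Rightarrow> cvec \<Rightarrow> cvec" where
  "pact N p f = (\<Sum>j\<le>N. sc (coeff p j) ((S ^^ j) f))"

lemma pact_linear_factor:
  assumes "degree p \<le> N"
  shows "pact (Suc N) ([:- a, 1:] * p) f = S (pact N p f) - sc a (pact N p f)"
proof -
  have "pact (Suc N) ([:- a, 1:] * p) f = pact (Suc N) (pCons 0 p) f - sc a (pact (Suc N) p f)"
    by (simp add: pact_def sc_sum sc_simps sum_subtractf sum.distrib algebra_simps)
  also have "pact (Suc N) (pCons 0 p) f = S (pact N p f)"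
    unfolding pact_def sum.atMost_Suc_shift by (simp add: S_sum S_sc sc_simps)
  also have "pact (Suc N) p f = pact N p f"
    using assms by (simp add: pact_def coeff_eq_0 sc_simps)
  finally show ?thesis .
qed

lemma pact_linear_factors: "pact (length as) (\<Prod>a\<leftarrow>as. [:- a, 1:]) f = shifts S as f"
proof (induction as)
  case Nil show ?case by (simp add: pact_def sc_simps)
next
  case (Cons a as)
  have "degree (\<Prod>a\<leftarrow>as. [:- a, 1:]) \<le> length as"
  proof (induction as)
    case (Cons a as)
    have "degree ([:- a, 1:] * (\<Prod>a\<leftarrow>as. [:- a, 1:])) \<le> degree [:- a, 1:] + degree (\<Prod>a\<leftarrow>as. [:- a, 1:])"
      by (rule degree_mult_le)
    with Cons show ?case by simp
  qed simp
  from pact_linear_factor[OF this] Cons show ?case by simp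
qed

text \<open>The \<open>k + 1\<close> vectors \<open>f, S f, ..., S^k f\<close> lie in dimension
  \<open>k\<close> and are dependent; a dependency is a polynomial annihilating \<open>f\<close>,
  and it factors over the complex numbers.\<close>

lemma exists_annihilating_shifts:
  assumes S_vecs: "\<And>f. f \<in> vecs k \<Longrightarrow> S f \<in> vecs k" and f: "f \<in> vecs k"
  shows "\<exists>as. shifts S as f = 0"
proof -
  have Sj: "(S ^^ j) f \<in> vecs k" for j using f S_vecs by (induction j) auto
  \<comment> \<open>Of size \<open>k + 1\<close>, with last row 0 since the vectors have no
    coefficient at \<open>k\<close>; its singularity expresses the dimension count.\<close>
  define A where "A = mat (Suc k) (Suc k) (\<lambda>(i, j). coeff ((S ^^ j) f) i)"
  have A: "A \<in> carrier_mat (Suc k) (Suc k)" by (simp add: A_def)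
  have "A\<^sup>T *\<^sub>v unit_vec (Suc k) k = 0\<^sub>v (Suc k)"
  proof (rule eq_vecI)
    fix j assume "j < dim_vec (0\<^sub>v (Suc k) :: complex vec)"
    then have j: "j < Suc k" by simp
    have "(A\<^sup>T *\<^sub>v unit_vec (Suc k) k) $ j = A $$ (k, j)"
      using j A by (simp add: scalar_prod_right_unit)
    also have "\<dots> = 0" using j Sj[of j] by (simp add: A_def vecs_def)
    finally show "(A\<^sup>T *\<^sub>v unit_vec (Suc k) k) $ j = 0\<^sub>v (Suc k) $ j" using j by simp
  qed (use A in simp)
  moreover have "unit_vec (Suc k) k \<noteq> (0\<^sub>v (Suc k) :: complex vec)"
    by (metis index_unit_vec(1) index_zero_vec(1) lessI zero_neq_one)
  ultimately have "det A\<^sup>T = 0"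
    by (subst det_0_iff_vec_prod_zero[of _ "Suc k"]) (use A in \<open>auto intro!: exI[of _ "unit_vec (Suc k) k"]\<close>)
  then have "det A = 0" using det_transpose[OF A] by simp
  then obtain w where w: "w \<in> carrier_vec (Suc k)" "w \<noteq> 0\<^sub>v (Suc k)" "A *\<^sub>v w = 0\<^sub>v (Suc k)"
    using det_0_iff_vec_prod_zero[OF A] by blast
  define p where "p = (\<Sum>j\<le>k. monom (w $ j) j)"
  have cp: "coeff p j = (if j \<le> k then w $ j else 0)" for j by (simp add: p_def coeff_sum)
  have p0: "p \<noteq> 0"
  proof
    assume "p = 0"
    then have "w $ j = 0" if "j \<le> k" for j using cp[of j] that by simp
    then have "w = 0\<^sub>v (Suc k)" using w(1) by (intro eq_vecI) auto
    with w(2) show False by blast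
  qed
  have dp: "degree p \<le> k" by (rule degree_le) (simp add: cp)
  have pz: "pact k p f = 0"
  proof (rule poly_eqI)
    fix i
    show "coeff (pact k p f) i = coeff 0 i"
    proof (cases "i < Suc k")
      case True
      have "coeff (pact k p f) i = (\<Sum>j<Suc k. coeff ((S ^^ j) f) i * w $ j)"
        unfolding pact_def coeff_sum lessThan_Suc_atMost by (intro sum.cong) (auto simp: cp)
      also have "\<dots> = (A *\<^sub>v w) $ i"
        using True w(1) A by (auto simp: A_def scalar_prod_def lessThan_atLeast0 intro!: sum.cong)
      finally show ?thesis unfolding w(3) using True by simp
    next
      case False
      then show ?thesis unfolding pact_def coeff_sum using Sj by (simp add: vecs_def)
    qed
  qed
  obtain as where as: "Polynomial.smult (lead_coeff p) (\<Prod>a\<leftarrow>as. [:- a, 1:]) = p" "length as = degree p"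
    using fundamental_theorem_algebra_factorized by blast
  have "pact k p f = pact (length as) p f"
    unfolding pact_def by (rule sum.mono_neutral_right) (use as(2) dp in \<open>auto simp: coeff_eq_0 sc_simps\<close>)
  also have "\<dots> = sc (lead_coeff p) (pact (length as) (\<Prod>a\<leftarrow>as. [:- a, 1:]) f)"
    unfolding pact_def sc_sum sc_simps by (subst as(1)[symmetric]) simp
  also have "\<dots> = sc (lead_coeff p) (shifts S as f)" unfolding pact_linear_factors ..
  finally have "sc (inverse (lead_coeff p)) (sc (lead_coeff p) (shifts S as f)) = 0" using pz by (simp add: sc_simps)
  then have "shifts S as f = 0" using p0 by (simp add: sc_simps)
  then show ?thesis by blast
qed

end

text \<open>A self-adjoint operator commuting with a normal one is positive as soon as it is positive on the
  eigenvectors of the latter, because those of different eigenvalues are orthogonal.\<close>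
lemma positive_on_eigenvectors:
  assumes lin: "linear_op S" "linear_op H"
    and cl: "\<And>f. f \<in> vecs k \<Longrightarrow> S f \<in> vecs k" "\<And>f. f \<in> vecs k \<Longrightarrow> H f \<in> vecs k"
    and adj: "\<And>f g. ip k f (S g) = ip k (S' f) g" "\<And>f g. ip k f (H g) = ip k (H f) g"
    and norm: "\<And>e m. e \<in> vecs k \<Longrightarrow> S e = sc m e \<Longrightarrow> S' e = sc (cnj m) e"
    and comm: "\<And>f. S (H f) = H (S f)"
    and eig: "\<And>e m. e \<in> vecs k \<Longrightarrow> S e = sc m e \<Longrightarrow> \<exists>r\<ge>0. ip k e (H e) = of_real r"
    and v: "v \<in> vecs k"
  shows "\<exists>r\<ge>0. ip k v (H v) = of_real r"
proof -
  interpret S: linear_op S by fact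
  interpret H: linear_op H by fact
  have clS: "shifts S ms f \<in> vecs k" if "f \<in> vecs k" for ms f
    using that by (induction ms) (auto intro!: vecs_closed cl)
  have ips: "ip k e (shifts S ms f) = (\<Prod>a\<leftarrow>ms. m - a) * ip k e f" if "e \<in> vecs k" "S e = sc m e" for e m ms f
    by (induction ms) (simp_all add: ip_simps adj(1) norm[OF that] algebra_simps)
  have main: "\<exists>r\<ge>0. ip k v (H v) = of_real r" if "v \<in> vecs k" "shifts S ms v = 0" for ms v
    using that
  proof (induction ms arbitrary: v)
    case Nil
    then have "ip k v (H v) = 0" by (simp add: ip_simps)
    then show ?case by (intro exI[of _ 0]) simp
  next
    case (Cons m ms)
    define g where "g = shifts S ms v"
    have g: "g \<in> vecs k" unfolding g_def by (rule clS[OF Cons.prems(1)])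
    have Sg: "S g = sc m g" using Cons.prems(2) by (simp add: g_def)
    define c where "c = (\<Prod>a\<leftarrow>ms. m - a)"
    show ?case
    proof (cases "c = 0")
      case True
      then have "m \<in> set ms" unfolding c_def by (auto simp: prod_list_zero_iff)
      then obtain g' where g': "g = S g' - sc m g'" using S.shifts_member unfolding g_def by blast
      have "ip k g g = ip k g (S g' - sc m g')" by (simp only: g'[symmetric])
      also have "\<dots> = ip k g (S g') - m * ip k g g'" by (simp only: ip_simps)
      also have "\<dots> = 0" unfolding adj(1) norm[OF g Sg] by (simp add: ip_simps)
      finally have "g = 0" using ip_self_zero[OF g] by blast
      then show ?thesis using Cons.IH[OF Cons.prems(1)] by (simp add: g_def)
    next
      case False
      \<comment> \<open>\<open>e\<close> is the component of \<open>v\<close> for the eigenvalue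
        \<open>m\<close>: the remaining factors multiply it by \<open>c\<close>, so they annihilate
        the rest \<open>f\<close>.\<close>
      define e where "e = sc (1 / c) g"
      define f where "f = v - e"
      have e: "e \<in> vecs k" unfolding e_def by (intro vecs_closed g)
      have f: "f \<in> vecs k" unfolding f_def by (intro vecs_closed e Cons.prems(1))
      have Se: "S e = sc m e" unfolding e_def by (simp add: S.S_sc Sg sc_simps mult.commute)
      have "shifts S ms e = sc c e" unfolding c_def by (rule S.shifts_eigen[OF Se])
      also have "\<dots> = g" unfolding e_def sc_simps(3) using False by (simp add: sc_simps)
      finally have "shifts S ms e = g" .
      then have f0: "shifts S ms f = 0" unfolding f_def S.shifts_diff g_def by simp
      have He: "H e \<in> vecs k" by (intro cl e)
      have SHe: "S (H e) = sc m (H e)" unfolding comm Se by (rule H.S_sc)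
      \<comment> \<open>\<open>H e\<close> is again an eigenvector for \<open>m\<close>; moving the
        factors to the other side of the product shows that it is orthogonal to
        \<open>f\<close>.\<close>
      have "c * ip k (H e) f = 0" using ips[OF He SHe, of ms f] unfolding f0 c_def by (simp add: ip_simps)
      then have o: "ip k (H e) f = 0" using False by simp
      have o': "ip k f (H e) = 0" using ip_cnj[of k "H e" f] unfolding o by simp
      have "v = e + f" by (simp add: f_def)
      then have "ip k v (H v) = ip k e (H e) + ip k f (H f)"
        by (simp only: H.S_add ip_simps adj(2)[of e f] o o') simp
      moreover obtain r where "r \<ge> 0" "ip k e (H e) = of_real r" using eig[OF e Se] by blast
      moreover obtain s where "s \<ge> 0" "ip k f (H f) = of_real s" using Cons.IH[OF f f0] by blast
      ultimately show ?thesis by (intro exI[of _ "r + s"]) simp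
    qed
  qed
  obtain as where "shifts S as v = 0" using S.exists_annihilating_shifts[OF cl(1) v] by blast
  with main v show ?thesis by blast
qed

subsection \<open>Central elements\<close>

lemma A_centralI:
  assumes "c \<in> fa_carrier" "\<And>l. in_disc l \<Longrightarrow> \<exists>z. Phi c l = scal z"
  shows "A_central c"
  unfolding A_central_def
proof (intro conjI ballI assms(1))
  fix b assume b: "b \<in> fa_carrier"
  show "A_eq (fa_mult c b) (fa_mult b c)"
    unfolding A_eq_iff_Phi[OF carrier_mult[OF assms(1) b] carrier_mult[OF b assms(1)]]
  proof (intro allI impI)
    fix l assume "in_disc l"
    then obtain z where "Phi c l = scal z" using assms(2) by blast
    then show "Phi (fa_mult c b) l = Phi (fa_mult b c) l" by (simp add: Phi_mult assms(1) b scal_commute)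
  qed
qed

text \<open>\<open>x x*\<close> acts as a diagonal matrix with distinct entries, so a commuting
  matrix is diagonal; commuting with \<open>x\<close> equates its two entries.\<close>

lemma A_central_scalar:
  assumes c: "A_central c" and l: "in_disc l" shows "Phi c l = scal (m11 (Phi c l))"
proof -
  let ?C = "Phi c l" and ?X = "X2 l" and ?Y = "adj (X2 l)"
  have cc: "c \<in> fa_carrier" using c by (simp add: A_central_def)
  have cb: "Phi c l * Phi b l = Phi b l * Phi c l" if b: "b \<in> fa_carrier" for b
  proof -
    have "A_eq (fa_mult c b) (fa_mult b c)" using c b by (simp add: A_central_def)
    then have "Phi (fa_mult c b) l = Phi (fa_mult b c) l" by (rule A_eq_imp_Phi) (use b cc l in simp_all)
    then show ?thesis by (simp add: Phi_mult b cc)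
  qed
  have X: "?C * ?X = ?X * ?C" using cb[of fa_x] by (simp add: Phi_basic)
  have Y: "?C * ?Y = ?Y * ?C" using cb[of fa_xstar] by (simp add: Phi_basic)
  define T where "T = ?X * ?Y"
  have XY: "?C * T = T * ?C" unfolding T_def by (metis X Y mult.assoc)
  define u where "u = complex_of_real (uu l)"
  have u0: "u \<noteq> 0" unfolding u_def using uu_pos[OF l] by simp
  define s where "s = sqrt (1 - 4 * (cmod l)\<^sup>2)"
  have s: "0 < s" unfolding s_def using disc_sqrt[OF l] by simp
  define A where "A = complex_of_real ((1 + s) / 2)"
  define B where "B = complex_of_real ((1 - s) / 2)"
  have AB: "A - B = of_real s" unfolding A_def B_def of_real_diff[symmetric] by (simp add: field_simps)
  have AB0: "A - B \<noteq> 0" unfolding AB using s by simp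
  have P: "m11 T = A" "m12 T = 0" "m21 T = 0" "m22 T = B"
    using uu_cnj[OF l] vv_cnj[OF l] by (simp_all add: T_def A_def B_def s_def)
  have ne: "A \<noteq> B" using AB0 by simp
  have c12: "m12 ?C = 0" using arg_cong[OF XY, of m12] ne by (auto simp: P)
  have c21: "m21 ?C = 0" using arg_cong[OF XY, of m21] ne by (auto simp: P)
  have "m11 ?C * u = u * m22 ?C" using arg_cong[OF X, of m12] by (simp add: u_def)
  then have "m22 ?C = m11 ?C" using u0 by simp
  then show ?thesis using c12 c21 by (simp add: m2_eq_iff)
qed

text \<open>The scalar is the coordinate of \<open>c\<close> at \<open>1\<close>, hence polynomial,
  and \<open>N\<close> is its squared modulus; \<open>N = 0\<close> would give \<open>c = 0\<close>
  by faithfulness. So denominators act invertibly off the zeros of a nonzero polynomial.\<close>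

lemma loc_denom_scalar:
  assumes "loc_denom c"
  obtains z N where "\<And>l. in_disc l \<Longrightarrow> Phi c l = scal (z l)" "N \<noteq> 0" "\<And>l. rl N l \<noteq> 0 \<Longrightarrow> z l \<noteq> 0"
proof -
  have c: "A_central c" "\<not> A_eq c fa_zero" and cc: "c \<in> fa_carrier"
    using assms by (auto simp: loc_denom_def A_central_def)
  obtain a b d e where r: "rpoly a" and
    w: "\<And>l. in_disc l \<Longrightarrow> Phi c l = comb l (a l) (b l) (d l) (e l)" using Phi_comb[OF cc] by blast
  have sc: "Phi c l = scal (a l)" if l: "in_disc l" for l
  proof -
    define f where "f = m11 (Phi c l)"
    have "comb l (a l) (b l) (d l) (e l) = scal f" using A_central_scalar[OF c(1) l] w[OF l] by (simp add: f_def)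
    then have "scal (a l - f) + scal (b l) * X2 l + scal (d l) * adj (X2 l) + scal (e l) * (X2 l * adj (X2 l)) = 0"
      by (simp add: comb_def scal_simps algebra_simps)
    from X2_independent[OF l this] have "a l = f" by simp
    then show ?thesis using A_central_scalar[OF c(1) l] by (simp add: f_def)
  qed
  obtain h k where hk: "\<And>l. a l = Complex (rl h l) (rl k l)" using rpolyE[OF r] by blast
  define N where "N = h * h + k * k"
  have N: "rl N l = (cmod (a l))\<^sup>2" for l
    unfolding N_def hk cmod_power2 by (simp add: evr.ev_add evr.ev_mult power2_eq_square)
  have "N \<noteq> 0"
  proof
    assume "N = 0"
    then have "a l = 0" for l using N[of l] by simp
    then have "Phi c l = Phi fa_zero l" if "in_disc l" for l using sc[OF that] by (simp add: Phi_basic scal_simps)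
    then have "A_eq c fa_zero" using A_eq_iff_Phi[OF cc, of fa_zero] by simp
    then show False using c(2) by blast
  qed
  moreover have "a l \<noteq> 0" if "rl N l \<noteq> 0" for l using that N[of l] by auto
  ultimately show ?thesis using that[of a N] sc by blast
qed

text \<open>An element of \<open>A\<close> that acts as the function \<open>f\<close> in all representations considered: as a scalar
  in the two-dimensional ones, and on joint eigenvectors of \<open>x\<^sup>2\<close> and its adjoint in arbitrary ones.\<close>
definition lifts :: "fa \<Rightarrow> (complex \<Rightarrow> complex) \<Rightarrow> bool" where
  "lifts p f \<longleftrightarrow> p \<in> fa_carrier \<and> (\<forall>l. in_disc l \<longrightarrow> Phi p l = scal (f l)) \<and>
    (\<forall>k \<pi> v l. star_rep k \<pi> \<longrightarrow> v \<in> vecs k \<longrightarrow> op k (\<pi> (fa_mult fa_x fa_x)) v = sc l v \<longrightarrow>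
      op k (\<pi> (fa_mult fa_xstar fa_xstar)) v = sc (cnj l) v \<longrightarrow> op k (\<pi> p) v = sc (f l) v)"

lemma star_rep_simps:
  assumes "star_rep k \<pi>"
  shows "p \<in> fa_carrier \<Longrightarrow> \<pi> p \<in> carrier_mat k k" "\<pi> fa_one = 1\<^sub>m k"
    "p \<in> fa_carrier \<Longrightarrow> q \<in> fa_carrier \<Longrightarrow> op k (\<pi> (fa_add p q)) v = op k (\<pi> p) v + op k (\<pi> q) v"
    "p \<in> fa_carrier \<Longrightarrow> q \<in> fa_carrier \<Longrightarrow> op k (\<pi> (fa_mult p q)) v = op k (\<pi> p) (op k (\<pi> q) v)"
    "p \<in> fa_carrier \<Longrightarrow> op k (\<pi> (fa_smult a p)) v = sc a (op k (\<pi> p) v)"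
    "p \<in> fa_carrier \<Longrightarrow> ip k v (op k (\<pi> p) w) = ip k (op k (\<pi> (fa_star p)) v) w"
proof -
  show c: "\<pi> p \<in> carrier_mat k k" if "p \<in> fa_carrier" for p using assms that by (simp add: star_rep_def)
  show "\<pi> fa_one = 1\<^sub>m k" using assms by (simp add: star_rep_def)
  show "op k (\<pi> (fa_add p q)) v = op k (\<pi> p) v + op k (\<pi> q) v" if "p \<in> fa_carrier" "q \<in> fa_carrier"
  proof -
    have "\<pi> (fa_add p q) = \<pi> p + \<pi> q" using assms that unfolding star_rep_def by blast
    then show ?thesis by (simp add: op_add c that)
  qed
  show "op k (\<pi> (fa_mult p q)) v = op k (\<pi> p) (op k (\<pi> q) v)" if "p \<in> fa_carrier" "q \<in> fa_carrier"
  proof -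
    have "\<pi> (fa_mult p q) = \<pi> p * \<pi> q" using assms that unfolding star_rep_def by blast
    then show ?thesis by (simp add: op_mult c that)
  qed
  show "op k (\<pi> (fa_smult a p)) v = sc a (op k (\<pi> p) v)" if "p \<in> fa_carrier"
  proof -
    have "\<pi> (fa_smult a p) = a \<cdot>\<^sub>m \<pi> p" using assms that unfolding star_rep_def by blast
    then show ?thesis by (simp add: op_smult c that)
  qed
  show "ip k v (op k (\<pi> p) w) = ip k (op k (\<pi> (fa_star p)) v) w" if "p \<in> fa_carrier"
  proof -
    have "\<pi> (fa_star p) = mat_adjoint (\<pi> p)" using assms that unfolding star_rep_def by blast
    then show ?thesis by (simp add: ip_adjoint c that)
  qed
qed

lemma star_rep_A_eq:
  assumes "star_rep k \<pi>" "A_eq p q" "p \<in> fa_carrier" "q \<in> fa_carrier"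
  shows "op k (\<pi> p) v = op k (\<pi> q) v"
proof -
  have "p = fa_add (fa_diff p q) q" by (simp add: fun_eq_iff fa_add_def fa_diff_def)
  then have "op k (\<pi> p) v = op k (\<pi> (fa_diff p q)) v + op k (\<pi> q) v"
    using star_rep_simps(3)[OF assms(1), of "fa_diff p q" q v] assms(3,4) by simp
  moreover have "\<pi> (fa_diff p q) = 0\<^sub>m k k" using assms(1,2) by (simp add: star_rep_def A_eq_def)
  moreover have "op k (0\<^sub>m k k) v = 0" by (simp add: poly_eq_iff)
  ultimately show ?thesis by simp
qed

lemma lifts_const: "lifts (fa_smult a fa_one) (\<lambda>l. a)"
  unfolding lifts_def
  by (auto simp: Phi_smult Phi_basic star_rep_simps op_one)

lemma lifts_add: assumes "lifts p f" "lifts q g" shows "lifts (fa_add p q) (\<lambda>l. f l + g l)"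
  using assms unfolding lifts_def by (auto simp: Phi_add scal_simps star_rep_simps sc_simps)

lemma lifts_mult: assumes "lifts p f" "lifts q g" shows "lifts (fa_mult p q) (\<lambda>l. f l * g l)"
  using assms unfolding lifts_def
  by (auto simp: Phi_mult scal_simps star_rep_simps sc_simps op_linear mult.commute)

lemma lifts_id: "lifts (fa_mult fa_x fa_x) (\<lambda>l. l)"
  and lifts_cnj: "lifts (fa_mult fa_xstar fa_xstar) (\<lambda>l. cnj l)"
  unfolding lifts_def by (auto simp: Phi_mult Phi_basic X2_sq X2_adj_sq)

text \<open>\<open>x^2\<close> and \<open>x*^2\<close> act as \<open>l\<close> and
  \<open>cnj l\<close>, and linear combinations of these give \<open>Re l\<close> and
  \<open>Im l\<close>.\<close>

lemma lifts_real_poly: "\<exists>p. lifts p (\<lambda>l. of_real (rl h l))"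
proof -
  have re: "\<exists>p. lifts p (\<lambda>l. of_real (Re l))"
  proof -
    have "(1/2) * (l + cnj l) = of_real (Re l)" for l by (simp add: complex_eq_iff)
    then show ?thesis using lifts_mult[OF lifts_const[of "1/2"] lifts_add[OF lifts_id lifts_cnj]] by auto
  qed
  have im: "\<exists>p. lifts p (\<lambda>l. of_real (Im l))"
  proof -
    have "(- \<i> / 2) * (l + (-1) * cnj l) = of_real (Im l)" for l by (simp add: complex_eq_iff)
    then show ?thesis
      using lifts_mult[OF lifts_const[of "- \<i> / 2"] lifts_add[OF lifts_id lifts_mult[OF lifts_const[of "-1"] lifts_cnj]]]
      by auto
  qed
  have inner: "\<exists>p. lifts p (\<lambda>l. of_real (poly q (Re l)))" for q
  proof (induction q)
    case 0 then show ?case using lifts_const[of 0] by auto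
  next
    case (pCons a q)
    obtain p where "lifts p (\<lambda>l. of_real (poly q (Re l)))" using pCons by blast
    moreover obtain p' where "lifts p' (\<lambda>l. of_real (Re l))" using re by blast
    ultimately have "lifts (fa_add (fa_smult (of_real a) fa_one) (fa_mult p' p)) (\<lambda>l. of_real a + of_real (Re l) * of_real (poly q (Re l)))"
      by (intro lifts_add lifts_mult lifts_const)
    then show ?case by auto
  qed
  show ?thesis
  proof (induction h)
    case 0 then show ?case using lifts_const[of 0] by auto
  next
    case (pCons a h)
    obtain p where "lifts p (\<lambda>l. of_real (rl h l))" using pCons by blast
    moreover obtain p' where "lifts p' (\<lambda>l. of_real (Im l))" using im by blast
    moreover obtain q where "lifts q (\<lambda>l. of_real (poly a (Re l)))" using inner by blast
    ultimately have "lifts (fa_add q (fa_mult p' p)) (\<lambda>l. of_real (poly a (Re l)) + of_real (Im l) * of_real (rl h l))"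
      by (intro lifts_add lifts_mult)
    then show ?case by auto
  qed
qed

lemma lifts_carrier: "lifts p f \<Longrightarrow> p \<in> fa_carrier"
  and lifts_Phi: "lifts p f \<Longrightarrow> in_disc l \<Longrightarrow> Phi p l = scal (f l)"
  by (simp_all add: lifts_def)

text \<open>The root of the discriminant \<open>1 - 4|l|\<^sup>2\<close> that exists in \<open>A\<close> although not in its centre.\<close>
definition W :: fa where "W = fa_diff fa_one (fa_smult 2 (fa_mult fa_xstar fa_x))"

lemma W_carrier [simp]: "W \<in> fa_carrier" by (simp add: W_def)

text \<open>With \<open>T = x* x\<close> the relation gives \<open>T^2 = T - |l|^2\<close>, so the
  square of \<open>1 - 2 T\<close> is \<open>1 - 4 |l|^2\<close>.\<close>

lemma Phi_W: assumes l: "in_disc l"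
  shows "adj (Phi W l) = Phi W l" "Phi W l * Phi W l = scal (of_real (rl disc_poly l))"
proof -
  let ?X = "X2 l" and ?Y = "adj (X2 l)"
  have W: "Phi W l = 1 - scal 2 * (?Y * ?X)" by (simp add: W_def Phi_diff Phi_smult Phi_mult Phi_basic)
  have ad: "adj (A - B) = adj A - adj B" for A B by (simp add: m2_eq_iff)
  show "adj (Phi W l) = Phi W l" unfolding W ad by (simp add: adj_simps scal_commute)
  have xy: "?X * ?Y = 1 - ?Y * ?X" using X2_relation[OF l] by (simp add: algebra_simps)
  have "(?Y * ?X) * (?Y * ?X) = ?Y * (?X * ?Y) * ?X" by (simp only: mult.assoc)
  also have "\<dots> = ?Y * ?X - (?Y * ?Y) * (?X * ?X)" unfolding xy by (simp add: algebra_simps)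
  also have "\<dots> = ?Y * ?X - scal (cnj l * l)" unfolding X2_sq[OF l] X2_adj_sq[OF l] by (simp only: scal_simps)
  finally have sq: "(?Y * ?X) * (?Y * ?X) = ?Y * ?X - scal (cnj l * l)" .
  have "Phi W l * Phi W l = 1 - scal 4 * (?Y * ?X) + scal 4 * ((?Y * ?X) * (?Y * ?X))"
    unfolding W by (simp add: m2_eq_iff algebra_simps)
  also have "\<dots> = scal (1 - 4 * (cnj l * l))" unfolding sq by (simp add: m2_eq_iff algebra_simps)
  also have "1 - 4 * (cnj l * l) = of_real (rl disc_poly l)"
    unfolding rv_disc_poly by (simp add: complex_eq_iff power2_eq_square)
  finally show "Phi W l * Phi W l = scal (of_real (rl disc_poly l))" .
qed

subsection \<open>Sums of squares\<close>

definition sosf :: "(complex \<Rightarrow> m2) \<Rightarrow> bool" where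
  "sosf F \<longleftrightarrow> (\<exists>as. set as \<subseteq> fa_carrier \<and> (\<forall>l. in_disc l \<longrightarrow> F l = (\<Sum>a\<leftarrow>as. adj (Phi a l) * Phi a l)))"

lemma sum_squares_carrier:
  "set as \<subseteq> fa_carrier \<Longrightarrow> foldr (\<lambda>a acc. fa_add (fa_mult (fa_star a) a) acc) as fa_zero \<in> fa_carrier"
  by (induction as) auto

lemma Phi_sum_squares:
  "set as \<subseteq> fa_carrier \<Longrightarrow> Phi (foldr (\<lambda>a acc. fa_add (fa_mult (fa_star a) a) acc) as fa_zero) l
    = (\<Sum>a\<leftarrow>as. adj (Phi a l) * Phi a l)"
  by (induction as) (simp_all add: Phi_basic Phi_add Phi_mult Phi_star sum_squares_carrier)

lemma A_sos_iff_sosf: assumes "y \<in> fa_carrier" shows "A_sos y \<longleftrightarrow> sosf (Phi y)"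
proof -
  have "A_eq y (foldr (\<lambda>a acc. fa_add (fa_mult (fa_star a) a) acc) as fa_zero) \<longleftrightarrow>
      (\<forall>l. in_disc l \<longrightarrow> Phi y l = (\<Sum>a\<leftarrow>as. adj (Phi a l) * Phi a l))" if as: "set as \<subseteq> fa_carrier" for as
    unfolding A_eq_iff_Phi[OF assms sum_squares_carrier[OF as]] Phi_sum_squares[OF as] ..
  then show ?thesis unfolding A_sos_def sosf_def by blast
qed

lemma sosf_add: assumes "sosf F" "sosf G" shows "sosf (\<lambda>l. F l + G l)"
proof -
  obtain as bs where "set as \<subseteq> fa_carrier" "set bs \<subseteq> fa_carrier"
    "\<And>l. in_disc l \<Longrightarrow> F l = (\<Sum>a\<leftarrow>as. adj (Phi a l) * Phi a l)"
    "\<And>l. in_disc l \<Longrightarrow> G l = (\<Sum>a\<leftarrow>bs. adj (Phi a l) * Phi a l)"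
    using assms unfolding sosf_def by blast
  then show ?thesis unfolding sosf_def by (intro exI[of _ "as @ bs"]) auto
qed

lemma sosf_cong: "sosf F \<Longrightarrow> (\<And>l. in_disc l \<Longrightarrow> F l = G l) \<Longrightarrow> sosf G"
  unfolding sosf_def by (elim exE conjE, intro exI conjI) auto

lemma sosf_square: "a \<in> fa_carrier \<Longrightarrow> sosf (\<lambda>l. adj (Phi a l) * Phi a l)"
  unfolding sosf_def by (intro exI[of _ "[a]"]) auto

text \<open>\<open>p * p\<close> is realised by the square of \<open>p b\<close>, and
  \<open>disc_poly * (p * p)\<close> by that of \<open>W p b\<close>. The factor \<open>b\<close> is
  carried through the induction because \<open>W\<close> is not central and has to stand to the left
  of it.\<close>

lemma sosf_disc_cone:
  assumes "q \<in> disc_cone" and b: "b \<in> fa_carrier"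
  shows "sosf (\<lambda>l. adj (Phi b l) * scal (of_real (rl q l)) * Phi b l)"
  using assms(1)
proof (induction rule: disc_cone.induct)
  case (square p)
  obtain p' where p': "lifts p' (\<lambda>l. of_real (rl p l))" using lifts_real_poly by blast
  have c: "fa_mult p' b \<in> fa_carrier" using lifts_carrier[OF p'] b by simp
  show ?case
  proof (rule sosf_cong[OF sosf_square[OF c]])
    fix l assume l: "in_disc l"
    define r where "r = complex_of_real (rl p l)"
    have P: "Phi (fa_mult p' b) l = scal r * Phi b l"
      using lifts_carrier[OF p'] b by (simp add: Phi_mult lifts_Phi[OF p' l] r_def)
    have r: "cnj r = r" "of_real (rl (p * p) l) = r * r" by (simp_all add: r_def evr.ev_mult)
    show "adj (Phi (fa_mult p' b) l) * Phi (fa_mult p' b) l = adj (Phi b l) * scal (of_real (rl (p * p) l)) * Phi b l"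
      unfolding P r(2) adj_simps r(1) scal_simps by (simp only: mult.assoc)
  qed
next
  case (disc p)
  obtain p' where p': "lifts p' (\<lambda>l. of_real (rl p l))" using lifts_real_poly by blast
  have c: "fa_mult W (fa_mult p' b) \<in> fa_carrier" using lifts_carrier[OF p'] b by simp
  show ?case
  proof (rule sosf_cong[OF sosf_square[OF c]])
    fix l assume l: "in_disc l"
    define r where "r = complex_of_real (rl p l)"
    define g where "g = complex_of_real (rl disc_poly l)"
    have P: "Phi (fa_mult W (fa_mult p' b)) l = Phi W l * (scal r * Phi b l)"
      using lifts_carrier[OF p'] b by (simp add: Phi_mult lifts_Phi[OF p' l] r_def)
    have r: "cnj r = r" "of_real (rl (disc_poly * (p * p)) l) = g * (r * r)" by (simp_all add: r_def g_def evr.ev_mult)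
    have "adj (Phi (fa_mult W (fa_mult p' b)) l) * Phi (fa_mult W (fa_mult p' b)) l
      = adj (Phi b l) * (scal r * (Phi W l * Phi W l) * scal r) * Phi b l"
      unfolding P adj_simps r(1) Phi_W(1)[OF l] by (simp only: mult.assoc)
    also have "scal r * (Phi W l * Phi W l) * scal r = scal (g * (r * r))"
      unfolding Phi_W(2)[OF l] g_def[symmetric] scal_simps(5)[symmetric] by (simp add: mult_ac)
    finally show "adj (Phi (fa_mult W (fa_mult p' b)) l) * Phi (fa_mult W (fa_mult p' b)) l
      = adj (Phi b l) * scal (of_real (rl (disc_poly * (p * p)) l)) * Phi b l" unfolding r(2) .
  qed
next
  case (add p q)
  show ?case
    by (rule sosf_cong[OF sosf_add[OF add.IH]]) (simp add: evr.ev_add scal_simps distrib_left distrib_right)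
qed

subsection \<open>The two-dimensional representations are *-representations\<close>

definition tomat :: "m2 \<Rightarrow> complex mat" where
  "tomat A = mat 2 2 (\<lambda>(i, j). if i = 0 then (if j = 0 then m11 A else m12 A) else (if j = 0 then m21 A else m22 A))"

lemma tomat_carrier: "tomat A \<in> carrier_mat 2 2" by (simp add: tomat_def)

lemma lessThan_2: "i < 2 \<longleftrightarrow> i = 0 \<or> i = (1::nat)" by auto

lemma tomat_simps: "tomat 0 = 0\<^sub>m 2 2" "tomat 1 = 1\<^sub>m 2" "tomat (A + B) = tomat A + tomat B"
  "tomat (scal z * A) = z \<cdot>\<^sub>m tomat A" "tomat (A * B) = tomat A * tomat B"
proof -
  show "tomat 0 = 0\<^sub>m 2 2" "tomat 1 = 1\<^sub>m 2" "tomat (A + B) = tomat A + tomat B" "tomat (scal z * A) = z \<cdot>\<^sub>m tomat A"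
    by (rule eq_matI; auto simp: tomat_def lessThan_2)+
  show "tomat (A * B) = tomat A * tomat B"
    by (rule eq_matI) (auto simp: tomat_def lessThan_2 scalar_prod_def numeral_2_eq_2)
qed

lemma tomat_adj: "tomat (adj A) = mat_adjoint (tomat A)"
proof (rule eq_matI)
  fix i j assume "i < dim_row (mat_adjoint (tomat A))" "j < dim_col (mat_adjoint (tomat A))"
  then have ij: "i < 2" "j < 2" by (simp_all add: mat_adjoint_def tomat_def)
  show "tomat (adj A) $$ (i, j) = mat_adjoint (tomat A) $$ (i, j)"
    unfolding mat_adjoint_index[OF tomat_carrier ij] using ij by (auto simp: tomat_def lessThan_2)
qed (simp_all add: mat_adjoint_def tomat_def)

lemma star_rep_Phi: assumes l: "in_disc l" shows "star_rep 2 (\<lambda>p. tomat (Phi p l))"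
  unfolding star_rep_def
proof (intro conjI ballI allI impI)
  fix a p assume p: "p \<in> fa_carrier"
  show "tomat (Phi (fa_smult a p) l) = a \<cdot>\<^sub>m tomat (Phi p l)"
    unfolding Phi_smult[OF p] by (rule tomat_simps)
qed (simp_all add: tomat_carrier Phi_basic Phi_add Phi_mult Phi_star Phi_ideal[OF _ l] tomat_simps tomat_adj)

lemma psd_mat_tomat: assumes "psd_mat 2 (tomat A)" shows "psd2 A"
  unfolding psd2_def
proof (intro allI)
  fix v w :: complex
  define x where "x = vec 2 (\<lambda>i. if i = 0 then v else w)"
  have x: "x \<in> carrier_vec 2" by (simp add: x_def)
  have "conjugate x \<bullet> (tomat A *\<^sub>v x) = cnj v * (m11 A * v + m12 A * w) + cnj w * (m21 A * v + m22 A * w)"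
    by (simp add: x_def tomat_def scalar_prod_def numeral_2_eq_2)
  moreover have "conjugate x \<bullet> (tomat A *\<^sub>v x) \<in> \<real>" "0 \<le> Re (conjugate x \<bullet> (tomat A *\<^sub>v x))"
    using assms x unfolding psd_mat_def by auto
  ultimately show "\<exists>r\<ge>0. cnj v * (m11 A * v + m12 A * w) + cnj w * (m21 A * v + m22 A * w) = complex_of_real r"
    by (metis of_real_Re)
qed

lemma hermitian_Phi: assumes "A_hermitian y" "in_disc l" shows "adj (Phi y l) = Phi y l"
  using A_eq_imp_Phi[of "fa_star y" y l] assms by (simp add: A_hermitian_def Phi_star)

subsection \<open>Positivity in all representations\<close>

lemma lifts_commute: assumes p: "lifts p f" and q: "q \<in> fa_carrier" shows "A_eq (fa_mult p q) (fa_mult q p)"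
proof (subst A_eq_iff_Phi)
  show "\<forall>l. in_disc l \<longrightarrow> Phi (fa_mult p q) l = Phi (fa_mult q p) l"
    unfolding Phi_mult[OF lifts_carrier[OF p] q] Phi_mult[OF q lifts_carrier[OF p]]
    by (intro allI impI) (simp only: lifts_Phi[OF p] scal_commute)
qed (use lifts_carrier[OF p] q in simp_all)

text \<open>\<open>x^2\<close> commutes with its adjoint \<open>T\<close>, which therefore preserves
  the eigenspace. So \<open>d = T e - cnj m e\<close> lies in it, and
  \<open>ip k d d = ip k e (S d) - m * ip k e d = 0\<close>, where \<open>S\<close> is the operator
  of \<open>x^2\<close>.\<close>

lemma star_rep_normal_eigen:
  assumes \<pi>: "star_rep k \<pi>" and e: "e \<in> vecs k" and Se: "op k (\<pi> (fa_mult fa_x fa_x)) e = sc m e"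
  shows "op k (\<pi> (fa_mult fa_xstar fa_xstar)) e = sc (cnj m) e"
proof -
  let ?S = "op k (\<pi> (fa_mult fa_x fa_x))" and ?T = "op k (\<pi> (fa_mult fa_xstar fa_xstar))"
  have st: "fa_star (fa_mult fa_x fa_x) = fa_mult fa_xstar fa_xstar"
    "fa_star (fa_mult fa_xstar fa_xstar) = fa_mult fa_x fa_x"
    by (simp_all add: fa_gen_mon fa_mult_mon fa_star_alt)
  have adj: "ip k f (?S g) = ip k (?T f) g" "ip k f (?T g) = ip k (?S f) g" for f g
    using star_rep_simps(6)[OF \<pi>, of "fa_mult fa_x fa_x" f g] star_rep_simps(6)[OF \<pi>, of "fa_mult fa_xstar fa_xstar" f g]
    by (simp_all add: st)
  have "A_eq (fa_mult (fa_mult fa_x fa_x) (fa_mult fa_xstar fa_xstar)) (fa_mult (fa_mult fa_xstar fa_xstar) (fa_mult fa_x fa_x))"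
    by (rule lifts_commute[OF lifts_id]) simp
  then have comm: "?S (?T f) = ?T (?S f)" for f
    using star_rep_A_eq[OF \<pi>, of "fa_mult (fa_mult fa_x fa_x) (fa_mult fa_xstar fa_xstar)" _ f]
    by (simp add: star_rep_simps(4)[OF \<pi>, of "fa_mult fa_x fa_x"] star_rep_simps(4)[OF \<pi>, of "fa_mult fa_xstar fa_xstar"])
  define d where "d = ?T e - sc (cnj m) e"
  have d: "d \<in> vecs k" unfolding d_def by (intro vecs_closed e)
  have STe: "?S (?T e) = sc m (?T e)" unfolding comm Se by (rule op_linear)
  have "ip k d g = ip k (?T e) g - m * ip k e g" for g unfolding d_def by (simp only: ip_simps complex_cnj_cnj)
  then have "ip k d d = ip k (?T e) d - m * ip k e d" .
  also have "ip k (?T e) d = ip k e (?S d)" using adj(1)[of e d] by simp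
  also have "?S d = sc m d" unfolding d_def
  proof -
    have "?S (?T e - sc (cnj m) e) + ?S (sc (cnj m) e) = ?S (?T e)" unfolding op_linear(1)[symmetric] by simp
    then have "?S (?T e - sc (cnj m) e) = sc m (?T e) - sc (cnj m) (sc m e)"
      unfolding STe op_linear(2) Se by (simp add: algebra_simps)
    then show "?S (?T e - sc (cnj m) e) = sc m (?T e - sc (cnj m) e)" by (simp add: sc_simps mult.commute)
  qed
  finally have "ip k d d = 0" by (simp add: ip_simps)
  then have "d = 0" using ip_self_zero[OF d] by blast
  then show ?thesis by (simp add: d_def)
qed

text \<open>\<open>W* W\<close> equals a lift of \<open>disc_poly\<close> in \<open>A\<close>, so
  the squared length of \<open>W e\<close> is \<open>rl disc_poly m\<close> times that of
  \<open>e\<close>.\<close>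

lemma star_rep_eigenvalue_in_disc:
  assumes \<pi>: "star_rep k \<pi>" and e: "e \<in> vecs k" "e \<noteq> 0" and Se: "op k (\<pi> (fa_mult fa_x fa_x)) e = sc m e"
  shows "0 \<le> rl disc_poly m"
proof -
  note Te = star_rep_normal_eigen[OF \<pi> e(1) Se]
  obtain p where p: "lifts p (\<lambda>l. of_real (rl disc_poly l))" using lifts_real_poly by blast
  note pc = lifts_carrier[OF p]
  have star_star: "fa_star (fa_star W) = W" by (rule ext) (simp add: fa_star_def rev_map comp_def)
  have "A_eq (fa_mult (fa_star W) W) p"
    by (subst A_eq_iff_Phi) (simp_all add: pc Phi_mult Phi_star lifts_Phi[OF p] Phi_W)
  then have "op k (\<pi> (fa_mult (fa_star W) W)) e = op k (\<pi> p) e"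
    by (rule star_rep_A_eq[OF \<pi>]) (simp_all add: pc)
  also have "\<dots> = sc (of_real (rl disc_poly m)) e" using p \<pi> e(1) Se Te unfolding lifts_def by blast
  finally have "ip k e (op k (\<pi> (fa_star W)) (op k (\<pi> W) e)) = of_real (rl disc_poly m) * ip k e e"
    using \<pi> by (simp add: star_rep_simps(4) ip_simps)
  moreover have "ip k e (op k (\<pi> (fa_star W)) (op k (\<pi> W) e)) = ip k (op k (\<pi> W) e) (op k (\<pi> W) e)"
    using star_rep_simps(6)[OF \<pi>, of "fa_star W"] unfolding star_star by simp
  moreover obtain r where r: "r \<ge> 0" "ip k (op k (\<pi> W) e) (op k (\<pi> W) e) = of_real r" using ip_self_nonneg by blast
  moreover obtain s where s: "s \<ge> 0" "ip k e e = of_real s" using ip_self_nonneg by blast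
  moreover have "s \<noteq> 0" using s e ip_self_zero[OF e(1)] by auto
  ultimately have "complex_of_real (rl disc_poly m * s) = of_real r" by simp
  then have "rl disc_poly m * s = r" by (simp only: of_real_eq_iff)
  then show ?thesis using r(1) s(1) \<open>s \<noteq> 0\<close> by (metis less_eq_real_def mult_neg_pos not_le)
qed

lemma A_pos_of_tr_det:
  assumes y: "A_hermitian y"
    and t: "\<And>l. in_disc l \<Longrightarrow> tr2 (Phi y l) = of_real (rl t l)" "\<And>l. 0 \<le> rl disc_poly l \<Longrightarrow> 0 \<le> rl t l"
    and n: "\<And>l. in_disc l \<Longrightarrow> det2 (Phi y l) = of_real (rl n l)" "\<And>l. 0 \<le> rl disc_poly l \<Longrightarrow> 0 \<le> rl n l"
  shows "A_pos y"
  unfolding A_pos_def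
proof (intro allI impI)
  fix k \<pi> assume \<pi>: "star_rep k \<pi>"
  have yc: "y \<in> fa_carrier" and yh: "A_eq (fa_star y) y" using y by (auto simp: A_hermitian_def)
  let ?S = "op k (\<pi> (fa_mult fa_x fa_x))" and ?T = "op k (\<pi> (fa_mult fa_xstar fa_xstar))" and ?H = "op k (\<pi> y)"
  obtain p q where p: "lifts p (\<lambda>l. of_real (rl t l))" and q: "lifts q (\<lambda>l. of_real (rl n l))"
    using lifts_real_poly by meson
  note pc = lifts_carrier[OF p] and qc = lifts_carrier[OF q]
  have "A_eq (fa_add (fa_mult y y) q) (fa_mult p y)"
  proof (subst A_eq_iff_Phi)
    show "\<forall>l. in_disc l \<longrightarrow> Phi (fa_add (fa_mult y y) q) l = Phi (fa_mult p y) l"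
    proof (intro allI impI)
      fix l assume l: "in_disc l"
      have "Phi y l * Phi y l + scal (of_real (rl n l)) = scal (of_real (rl t l)) * Phi y l"
        using cayley_hamilton2[of "Phi y l"] unfolding t(1)[OF l] n(1)[OF l] .
      then show "Phi (fa_add (fa_mult y y) q) l = Phi (fa_mult p y) l"
        using yc pc qc by (simp add: Phi_add Phi_mult lifts_Phi[OF p l] lifts_Phi[OF q l])
    qed
  qed (use yc pc qc in simp_all)
  then have ch: "?H (?H e) + op k (\<pi> q) e = op k (\<pi> p) (?H e)" for e
    using star_rep_A_eq[OF \<pi>, of "fa_add (fa_mult y y) q" _ e] by (simp add: yc pc qc star_rep_simps[OF \<pi>])
  have "A_eq (fa_mult (fa_mult fa_x fa_x) y) (fa_mult y (fa_mult fa_x fa_x))"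
    by (rule lifts_commute[OF lifts_id yc])
  then have comm: "?S (?H f) = ?H (?S f)" for f
    using star_rep_A_eq[OF \<pi>, of "fa_mult (fa_mult fa_x fa_x) y" _ f]
    by (simp add: yc star_rep_simps(4)[OF \<pi>, of _ y] star_rep_simps(4)[OF \<pi>, of y])
  have Hadj: "ip k f (?H g) = ip k (?H f) g" for f g
    using star_rep_simps(6)[OF \<pi> yc, of f g] star_rep_A_eq[OF \<pi> yh, of f] yc by simp
  have st: "fa_star (fa_mult fa_x fa_x) = fa_mult fa_xstar fa_xstar"
    by (simp add: fa_gen_mon fa_mult_mon fa_star_alt)
  have Sadj: "ip k f (?S g) = ip k (?T f) g" for f g
    using star_rep_simps(6)[OF \<pi>, of "fa_mult fa_x fa_x" f g] by (simp add: st)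
  show "psd_mat k (\<pi> y)"
  proof (rule psd_mat_iff_ip)
    show "\<pi> y \<in> carrier_mat k k" by (rule star_rep_simps(1)[OF \<pi> yc])
    fix f assume f: "f \<in> vecs k"
    show "\<exists>r\<ge>0. ip k f (?H f) = complex_of_real r"
    proof (rule positive_on_eigenvectors[of ?S ?H k ?T])
      fix e m assume e: "e \<in> vecs k" and Se: "?S e = sc m e"
      show "?T e = sc (cnj m) e" by (rule star_rep_normal_eigen[OF \<pi> e Se])
      show "\<exists>r\<ge>0. ip k e (?H e) = complex_of_real r"
      proof (cases "e = 0")
        case True then show ?thesis by (intro exI[of _ 0]) (simp add: ip_simps)
      next
        case False
        have m: "0 \<le> rl disc_poly m" by (rule star_rep_eigenvalue_in_disc[OF \<pi> e False Se])
        define \<tau> where "\<tau> = rl t m"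
        define \<nu> where "\<nu> = rl n m"
        have nn: "0 \<le> \<tau>" "0 \<le> \<nu>" unfolding \<tau>_def \<nu>_def using t(2)[OF m] n(2)[OF m] by auto
        have He: "?H e \<in> vecs k" by (rule vecs_closed)
        \<comment> \<open>\<open>y\<close> preserves the eigenspace, so the lift \<open>p\<close> of
          \<open>t\<close>, which \<open>ch\<close> applies to \<open>y e\<close>, acts there as
          \<open>\<tau>\<close>.\<close>
        have SHe: "?S (?H e) = sc m (?H e)" unfolding comm Se by (rule op_linear)
        have pe: "op k (\<pi> p) (?H e) = sc (of_real \<tau>) (?H e)" unfolding \<tau>_def
          using p \<pi> He SHe star_rep_normal_eigen[OF \<pi> He SHe] unfolding lifts_def by blast
        have qe: "op k (\<pi> q) e = sc (of_real \<nu>) e" unfolding \<nu>_def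
          using q \<pi> e Se star_rep_normal_eigen[OF \<pi> e Se] unfolding lifts_def by blast
        obtain a where a: "0 \<le> a" "ip k (?H e) (?H e) = of_real a" using ip_self_nonneg by blast
        obtain b where b: "0 \<le> b" "ip k e e = of_real b" using ip_self_nonneg by blast
        \<comment> \<open>Pairing with \<open>e\<close> gives
          \<open>|y e|^2 + \<nu> |e|^2 = \<tau> (e, y e)\<close>; for \<open>\<tau> = 0\<close> this
          forces \<open>y e = 0\<close>.\<close>
        have "ip k e (?H (?H e) + op k (\<pi> q) e) = ip k e (op k (\<pi> p) (?H e))" unfolding ch ..
        then have eq: "of_real (a + \<nu> * b) = of_real \<tau> * ip k e (?H e)"
          unfolding pe qe by (simp add: ip_simps Hadj[of e "?H e"] a b)
        show ?thesis
        proof (cases "\<tau> = 0")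
          case True
          then have "complex_of_real (a + \<nu> * b) = 0" using eq by simp
          then have "a + \<nu> * b = 0" by (simp only: of_real_eq_0_iff)
          then have "a = 0" using a(1) mult_nonneg_nonneg[OF nn(2) b(1)] by linarith
          then have "?H e = 0" using ip_self_zero[OF He] a(2) by simp
          then show ?thesis by (intro exI[of _ 0]) (simp add: ip_simps)
        next
          case False
          then have "ip k e (?H e) = of_real ((a + \<nu> * b) / \<tau>)" using eq by (simp add: field_simps)
          moreover have "0 \<le> (a + \<nu> * b) / \<tau>" using nn a b by simp
          ultimately show ?thesis by blast
        qed
      qed
    qed (unfold_locales, simp_all add: op_linear vecs_closed Sadj Hadj comm f)
  qed
qed

subsection \<open>The three implications\<close>

lemma A_pos_imp_sos_multiple:
  assumes y: "A_hermitian y" and pos: "A_pos y"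
  shows "\<exists>c. loc_denom c \<and> A_sos (fa_mult (fa_mult (fa_star c) c) y)"
proof -
  have yc: "y \<in> fa_carrier" using y by (simp add: A_hermitian_def)
  note adjY = hermitian_Phi[OF y]
  obtain t n where t: "\<And>l. in_disc l \<Longrightarrow> tr2 (Phi y l) = of_real (rl t l)"
    and n: "\<And>l. in_disc l \<Longrightarrow> det2 (Phi y l) = of_real (rl n l)" using hermitian_tr_det[OF yc adjY] by blast
  have psd: "psd2 (Phi y l)" if "in_disc l" for l
    using pos star_rep_Phi[OF that] psd_mat_tomat unfolding A_pos_def by blast
  have tn: "0 \<le> rl t l" "0 \<le> rl n l" if "in_disc l" for l
    using psd2_tr_det(1,2)[OF psd[OF that] adjY[OF that]] unfolding t[OF that] n[OF that] by simp_all
  \<comment> \<open>A nonzero real polynomial is nonzero somewhere in the disc, so its lift is an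
    admissible denominator.\<close>
  have dn: "loc_denom c" if c: "lifts c (\<lambda>l. of_real (rl h l))" and h: "h \<noteq> 0" for c h
  proof -
    have cc: "c \<in> fa_carrier" by (rule lifts_carrier[OF c])
    have "A_central c" by (rule A_centralI[OF cc]) (use lifts_Phi[OF c] in blast)
    moreover have "\<not> A_eq c fa_zero"
    proof
      assume "A_eq c fa_zero"
      then have z: "\<And>l. in_disc l \<Longrightarrow> Phi c l = 0" using A_eq_imp_Phi[of c fa_zero] cc by (simp add: Phi_basic)
      obtain l where l: "in_disc l" "rl h l \<noteq> 0" using nonzero_in_disc[OF h] by blast
      have "m11 (Phi c l) = of_real (rl h l)" unfolding lifts_Phi[OF c l(1)] by simp
      then show False using z[OF l(1)] l(2) by simp
    qed
    ultimately show ?thesis by (simp add: loc_denom_def)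
  qed
  show ?thesis
  proof (cases "t = 0")
    case True
    \<comment> \<open>A positive matrix of trace 0 vanishes, so \<open>y = 0\<close> in
      \<open>A\<close>, and the constant 1 serves as denominator.\<close>
    have Y0: "Phi y l = 0" if "in_disc l" for l
      using psd2_tr_det(3)[OF psd[OF that] adjY[OF that]] t[OF that] True by simp
    obtain c where c: "lifts c (\<lambda>l. of_real (rl 1 l))" using lifts_real_poly by blast
    have "loc_denom c" using dn[OF c] by simp
    moreover have "A_sos (fa_mult (fa_mult (fa_star c) c) y)"
    proof -
      have "fa_mult (fa_mult (fa_star c) c) y \<in> fa_carrier" using lifts_carrier[OF c] yc by simp
      then show ?thesis unfolding A_sos_iff_sosf[OF \<open>fa_mult (fa_mult (fa_star c) c) y \<in> fa_carrier\<close>] sosf_def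
        using lifts_carrier[OF c] yc by (intro exI[of _ "[]"]) (simp add: Phi_mult Y0)
    qed
    ultimately show ?thesis by blast
  next
    case False
    have closed: "0 \<le> rv h x y" if "\<And>l. in_disc l \<Longrightarrow> 0 \<le> rl h l" "0 \<le> rv disc_poly x y" for h x y
      using nonneg_on_closed_disc[OF one_neq_zero _ that(2)] that(1) by blast
    have "\<exists>D. D \<noteq> 0 \<and> D * D * t \<in> disc_cone"
      using disc_positivstellensatz[OF closed[OF tn(1)]] by blast
    then obtain D where D: "D \<noteq> 0" "D * D * t \<in> disc_cone" by blast
    have "0 \<le> rl (t * n) l" if "in_disc l" for l
      unfolding evr.ev_mult using tn[OF that] by (rule mult_nonneg_nonneg)
    then have "\<exists>E. E \<noteq> 0 \<and> E * E * (t * n) \<in> disc_cone"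
      using disc_positivstellensatz[OF closed] by blast
    then obtain E where E: "E \<noteq> 0" "E * E * (t * n) \<in> disc_cone" by blast
    \<comment> \<open>\<open>(DEt)\<^sup>2y = D\<^sup>2E\<^sup>2t(y\<^sup>2 + n) = (Ey)(D\<^sup>2t)(Ey) + D(E\<^sup>2tn)D\<close>\<close>
    obtain c where c: "lifts c (\<lambda>l. of_real (rl (D * E * t) l))" using lifts_real_poly by blast
    obtain d where d: "lifts d (\<lambda>l. of_real (rl D l))" using lifts_real_poly by blast
    obtain e where e: "lifts e (\<lambda>l. of_real (rl E l))" using lifts_real_poly by blast
    note cc = lifts_carrier[OF c] and dc = lifts_carrier[OF d] and ec = lifts_carrier[OF e]
    have "loc_denom c" using dn[OF c] False D E by simp
    moreover have cyc: "fa_mult (fa_mult (fa_star c) c) y \<in> fa_carrier" using cc yc by simp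
    have "sosf (Phi (fa_mult (fa_mult (fa_star c) c) y))"
    proof (rule sosf_cong[OF sosf_add])
      show "sosf (\<lambda>l. adj (Phi (fa_mult e y) l) * scal (of_real (rl (D * D * t) l)) * Phi (fa_mult e y) l)"
        by (rule sosf_disc_cone[OF D(2)]) (use ec yc in simp)
      show "sosf (\<lambda>l. adj (Phi d l) * scal (of_real (rl (E * E * (t * n)) l)) * Phi d l)"
        by (rule sosf_disc_cone[OF E(2) dc])
      fix l assume l: "in_disc l"
      let ?Y = "Phi y l"
      define \<alpha> where "\<alpha> = complex_of_real (rl D l)"
      define \<beta> where "\<beta> = complex_of_real (rl E l)"
      define \<tau> where "\<tau> = complex_of_real (rl t l)"
      define \<nu> where "\<nu> = complex_of_real (rl n l)"
      have r: "cnj \<alpha> = \<alpha>" "cnj \<beta> = \<beta>" "cnj \<tau> = \<tau>" by (simp_all add: \<alpha>_def \<beta>_def \<tau>_def)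
      have v: "Phi (fa_mult e y) l = scal \<beta> * ?Y" "Phi d l = scal \<alpha>" "Phi c l = scal (\<alpha> * \<beta> * \<tau>)"
        "of_real (rl (D * D * t) l) = \<alpha> * \<alpha> * \<tau>" "of_real (rl (E * E * (t * n)) l) = \<beta> * \<beta> * (\<tau> * \<nu>)"
        using ec yc by (simp_all add: Phi_mult lifts_Phi[OF e l] lifts_Phi[OF d l] lifts_Phi[OF c l] \<alpha>_def \<beta>_def \<tau>_def \<nu>_def evr.ev_mult)
      have ch: "?Y * ?Y + scal \<nu> = scal \<tau> * ?Y"
        using cayley_hamilton2[of ?Y] unfolding t[OF l] n[OF l] \<tau>_def \<nu>_def .
      have "adj (Phi (fa_mult e y) l) * scal (of_real (rl (D * D * t) l)) * Phi (fa_mult e y) l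
        + adj (Phi d l) * scal (of_real (rl (E * E * (t * n)) l)) * Phi d l
        = scal (\<alpha> * \<alpha> * \<beta> * \<beta> * \<tau>) * (?Y * ?Y + scal \<nu>)"
        unfolding v adj_simps r adjY[OF l] by (simp add: m2_eq_iff algebra_simps)
      also have "\<dots> = scal ((\<alpha> * \<beta> * \<tau>) * (\<alpha> * \<beta> * \<tau>)) * ?Y"
        unfolding ch by (simp add: m2_eq_iff mult_ac)
      also have "\<dots> = Phi (fa_mult (fa_mult (fa_star c) c) y) l"
      proof -
        have k: "cnj (\<alpha> * \<beta> * \<tau>) = \<alpha> * \<beta> * \<tau>" by (simp add: r)
        have "Phi (fa_mult (fa_mult (fa_star c) c) y) l = adj (Phi c l) * Phi c l * ?Y"
          using cc yc by (simp add: Phi_mult Phi_star)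
        then show ?thesis unfolding v(3) adj_simps k by (simp only: scal_simps(5))
      qed
      finally show "adj (Phi (fa_mult e y) l) * scal (of_real (rl (D * D * t) l)) * Phi (fa_mult e y) l
        + adj (Phi d l) * scal (of_real (rl (E * E * (t * n)) l)) * Phi d l
        = Phi (fa_mult (fa_mult (fa_star c) c) y) l" .
    qed
    then have "A_sos (fa_mult (fa_mult (fa_star c) c) y)" using A_sos_iff_sosf[OF cyc] by blast
    ultimately show ?thesis by blast
  qed
qed

section \<open>Sums of squares in the localization\<close>

abbreviation loc_sum :: "(fa \<times> fa) list \<Rightarrow> fa \<times> fa" where
  "loc_sum fs \<equiv> foldr (\<lambda>f acc. loc_add (loc_mult (loc_star f) f) acc) fs (fa_zero, fa_one)"

lemma loc_sum_Cons:
  "loc_sum ((a, c) # fs) = (fa_add (fa_mult (fa_mult (fa_star a) a) (snd (loc_sum fs)))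
     (fa_mult (fst (loc_sum fs)) (fa_mult (fa_star c) c)), fa_mult (fa_mult (fa_star c) c) (snd (loc_sum fs)))"
  by (simp add: loc_add_def loc_mult_def loc_star_def case_prod_unfold)

lemma loc_sum_carrier:
  "(\<forall>(a, c)\<in>set fs. a \<in> fa_carrier \<and> c \<in> fa_carrier) \<Longrightarrow>
    fst (loc_sum fs) \<in> fa_carrier \<and> snd (loc_sum fs) \<in> fa_carrier"
proof (induction fs)
  case (Cons f fs)
  obtain a c where f: "f = (a, c)" by (cases f)
  then have "a \<in> fa_carrier" "c \<in> fa_carrier" "fst (loc_sum fs) \<in> fa_carrier \<and> snd (loc_sum fs) \<in> fa_carrier"
    using Cons by auto
  then show ?case unfolding f loc_sum_Cons by simp
qed simp

text \<open>Each summand of \<open>c* c y\<close> is divided by the same \<open>c\<close>.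
  \<open>loc_add\<close> multiplies denominators, so powers of \<open>c* c\<close> accumulate; these
  are scalars in each representation, where the required identity is checked.\<close>

lemma sos_multiple_imp_loc_sos:
  assumes yc: "y \<in> fa_carrier" and c: "loc_denom c" and sos: "A_sos (fa_mult (fa_mult (fa_star c) c) y)"
  shows "loc_sos y"
proof -
  have cc: "c \<in> fa_carrier" using c by (simp add: loc_denom_def A_central_def)
  obtain z N where z: "\<And>l. in_disc l \<Longrightarrow> Phi c l = scal (z l)" and N: "N \<noteq> 0" "\<And>l. rl N l \<noteq> 0 \<Longrightarrow> z l \<noteq> 0"
    using loc_denom_scalar[OF c] by blast
  define s where "s = fa_mult (fa_star c) c"
  have sc: "s \<in> fa_carrier" using cc by (simp add: s_def)
  have s: "Phi s l = scal (cnj (z l) * z l)" if "in_disc l" for l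
    unfolding s_def using cc z[OF that] by (simp add: Phi_mult Phi_star adj_simps scal_simps)
  have sd: "loc_denom s"
    unfolding loc_denom_def
  proof
    show "A_central s" by (rule A_centralI[OF sc]) (use s in blast)
    show "\<not> A_eq s fa_zero"
    proof
      assume "A_eq s fa_zero"
      then have 0: "\<And>l. in_disc l \<Longrightarrow> Phi s l = 0" using A_eq_imp_Phi[of s fa_zero] sc by (simp add: Phi_basic)
      obtain l where l: "in_disc l" "rl N l \<noteq> 0" using nonzero_in_disc[OF N(1)] by blast
      have "m11 (Phi s l) \<noteq> 0" unfolding s[OF l(1)] using N(2)[OF l(2)] by simp
      then show False using 0[OF l(1)] by simp
    qed
  qed
  obtain as where as: "set as \<subseteq> fa_carrier"
    "\<And>l. in_disc l \<Longrightarrow> Phi (fa_mult s y) l = (\<Sum>a\<leftarrow>as. adj (Phi a l) * Phi a l)"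
    using sos A_sos_iff_sosf[of "fa_mult s y"] sc yc unfolding s_def[symmetric] sosf_def by auto
  define fs where "fs = map (\<lambda>a. (a, c)) as"
  have fsc: "\<forall>(a, c)\<in>set fs. a \<in> fa_carrier \<and> c \<in> fa_carrier" using as(1) cc by (auto simp: fs_def)
  \<comment> \<open>\<open>d\<close> is the scalar of the accumulated denominator: the numerator
    times \<open>c* c\<close> is the given sum of squares times \<open>d\<close>.\<close>
  have key: "\<exists>d. Phi (snd (loc_sum fs)) l = scal d \<and>
      Phi (fst (loc_sum fs)) l * Phi s l = (\<Sum>a\<leftarrow>as. adj (Phi a l) * Phi a l) * scal d" if l: "in_disc l" for l
    using as(1) unfolding fs_def
  proof (induction as)
    case Nil show ?case by (intro exI[of _ 1]) (simp add: Phi_basic scal_simps)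
  next
    case (Cons a as)
    define b where "b = fst (loc_sum (map (\<lambda>a. (a, c)) as))"
    define e where "e = snd (loc_sum (map (\<lambda>a. (a, c)) as))"
    have be: "b \<in> fa_carrier" "e \<in> fa_carrier"
      using loc_sum_carrier[of "map (\<lambda>a. (a, c)) as"] Cons.prems cc by (auto simp: b_def e_def)
    have ac: "a \<in> fa_carrier" using Cons.prems by simp
    obtain d where d: "Phi e l = scal d" "Phi b l * Phi s l = (\<Sum>a\<leftarrow>as. adj (Phi a l) * Phi a l) * scal d"
      using Cons unfolding b_def e_def by auto
    have ls: "loc_sum (map (\<lambda>a. (a, c)) (a # as)) = (fa_add (fa_mult (fa_mult (fa_star a) a) e) (fa_mult b s), fa_mult s e)"
      unfolding list.map loc_sum_Cons b_def e_def s_def ..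
    have "Phi (fa_add (fa_mult (fa_mult (fa_star a) a) e) (fa_mult b s)) l * Phi s l
      = (adj (Phi a l) * Phi a l * Phi e l + Phi b l * Phi s l) * Phi s l"
      using ac be sc by (simp add: Phi_add Phi_mult Phi_star)
    also have "\<dots> = (adj (Phi a l) * Phi a l + (\<Sum>a\<leftarrow>as. adj (Phi a l) * Phi a l)) * (scal d * Phi s l)"
      unfolding d by (simp only: distrib_right mult.assoc)
    also have "scal d * Phi s l = scal (cnj (z l) * z l * d)" unfolding s[OF l] by (simp add: scal_simps(5)[symmetric] mult.commute)
    finally have 1: "Phi (fa_add (fa_mult (fa_mult (fa_star a) a) e) (fa_mult b s)) l * Phi s l
      = (\<Sum>a\<leftarrow>a # as. adj (Phi a l) * Phi a l) * scal (cnj (z l) * z l * d)" by simp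
    have 2: "Phi (fa_mult s e) l = scal (cnj (z l) * z l * d)"
      using sc be d(1) s[OF l] by (simp add: Phi_mult scal_simps)
    show ?case unfolding ls fst_conv snd_conv using 1 2 by blast
  qed
  have nc: "fst (loc_sum fs) \<in> fa_carrier" "snd (loc_sum fs) \<in> fa_carrier" using loc_sum_carrier[OF fsc] by auto
  have "loc_eq (y, fa_one) (loc_sum fs)"
    unfolding loc_eq_def case_prod_unfold fst_conv snd_conv
  proof (intro exI conjI)
    show "loc_denom s" by (rule sd)
    show "A_eq (fa_mult s (fa_diff (fa_mult y (snd (loc_sum fs))) (fa_mult (fst (loc_sum fs)) fa_one))) fa_zero"
    proof (subst A_eq_iff_Phi)
      show "\<forall>l. in_disc l \<longrightarrow> Phi (fa_mult s (fa_diff (fa_mult y (snd (loc_sum fs))) (fa_mult (fst (loc_sum fs)) fa_one))) l = Phi fa_zero l"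
      proof (intro allI impI)
        fix l assume l: "in_disc l"
        obtain d where d: "Phi (snd (loc_sum fs)) l = scal d"
          "Phi (fst (loc_sum fs)) l * Phi s l = (\<Sum>a\<leftarrow>as. adj (Phi a l) * Phi a l) * scal d" using key[OF l] by blast
        have "Phi s l * Phi y l = (\<Sum>a\<leftarrow>as. adj (Phi a l) * Phi a l)" using as(2)[OF l] sc yc by (simp add: Phi_mult)
        moreover have "Phi s l * Phi (fst (loc_sum fs)) l = Phi (fst (loc_sum fs)) l * Phi s l"
          unfolding s[OF l] scal_commute ..
        moreover have "Phi (fa_mult s (fa_diff (fa_mult y (snd (loc_sum fs))) (fa_mult (fst (loc_sum fs)) fa_one))) l
          = Phi s l * Phi y l * Phi (snd (loc_sum fs)) l - Phi s l * Phi (fst (loc_sum fs)) l"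
          using nc sc yc by (simp add: Phi_mult Phi_diff Phi_basic right_diff_distrib mult.assoc)
        ultimately show "Phi (fa_mult s (fa_diff (fa_mult y (snd (loc_sum fs))) (fa_mult (fst (loc_sum fs)) fa_one))) l = Phi fa_zero l"
          using d by (simp add: Phi_basic)
      qed
    qed (use nc sc yc in simp_all)
  qed
  moreover have "\<forall>(a, c)\<in>set fs. a \<in> fa_carrier \<and> loc_denom c" using as(1) c by (auto simp: fs_def)
  ultimately show ?thesis unfolding loc_sos_def by blast
qed

text \<open>\<open>N\<close> collects one polynomial for each denominator; off its zeros every
  \<open>c* c\<close> acts as a positive scalar, so the numerators obtained by cross-multiplication
  stay positive.\<close>

lemma loc_sum_psd:
  assumes "\<forall>(a, c)\<in>set fs. a \<in> fa_carrier \<and> loc_denom c"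
  shows "\<exists>N. N \<noteq> 0 \<and> (\<forall>l. in_disc l \<longrightarrow> rl N l \<noteq> 0 \<longrightarrow>
    (\<exists>d>0. Phi (snd (loc_sum fs)) l = scal (of_real d) \<and> psd2 (Phi (fst (loc_sum fs)) l)))"
  using assms
proof (induction fs)
  case Nil
  have "\<exists>d>0. (1::m2) = scal (of_real d)" by (intro exI[of _ 1]) (simp add: scal_simps)
  then show ?case by (intro exI[of _ 1]) (simp add: Phi_basic psd2_zero)
next
  case (Cons f fs)
  obtain a c where f: "f = (a, c)" by (cases f)
  have ac: "a \<in> fa_carrier" "loc_denom c" "c \<in> fa_carrier" using Cons.prems f by (auto simp: loc_denom_def A_central_def)
  obtain N where N: "N \<noteq> 0" "\<And>l. in_disc l \<Longrightarrow> rl N l \<noteq> 0 \<Longrightarrow>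
    \<exists>d>0. Phi (snd (loc_sum fs)) l = scal (of_real d) \<and> psd2 (Phi (fst (loc_sum fs)) l)" using Cons by auto
  obtain z M where z: "\<And>l. in_disc l \<Longrightarrow> Phi c l = scal (z l)" and M: "M \<noteq> 0" "\<And>l. rl M l \<noteq> 0 \<Longrightarrow> z l \<noteq> 0"
    using loc_denom_scalar[OF ac(2)] by blast
  have "\<forall>(a, c)\<in>set fs. a \<in> fa_carrier \<and> c \<in> fa_carrier"
    using Cons.prems by (auto simp: loc_denom_def A_central_def)
  note bd = loc_sum_carrier[OF this]
  show ?case
  proof (intro exI[of _ "N * M"] conjI allI impI)
    show "N * M \<noteq> 0" using N M by simp
    fix l assume l: "in_disc l" and nz: "rl (N * M) l \<noteq> 0"
    then have nz': "rl N l \<noteq> 0" "rl M l \<noteq> 0" by (auto simp: evr.ev_mult)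
    obtain d where d: "d > 0" "Phi (snd (loc_sum fs)) l = scal (of_real d)" "psd2 (Phi (fst (loc_sum fs)) l)"
      using N(2)[OF l nz'(1)] by blast
    define w where "w = (cmod (z l))\<^sup>2"
    have w: "0 < w" "cnj (z l) * z l = of_real w"
      using M(2)[OF nz'(2)] by (simp_all add: w_def complex_norm_square[symmetric] mult.commute[of "cnj _"])
    have s: "Phi (fa_mult (fa_star c) c) l = scal (of_real w)"
      using ac z[OF l] by (simp add: Phi_mult Phi_star adj_simps scal_simps(5)[symmetric] w)
    have 1: "w * d > 0" using w d by simp
    have 2: "Phi (snd (loc_sum (f # fs))) l = scal (of_real (w * d))"
      unfolding f loc_sum_Cons snd_conv using ac bd d s by (simp add: Phi_mult[of "fa_mult (fa_star c) c"] scal_simps)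
    have "Phi (fst (loc_sum (f # fs))) l = scal (of_real d) * (adj (Phi a l) * Phi a l)
      + scal (of_real w) * Phi (fst (loc_sum fs)) l"
      unfolding f loc_sum_Cons fst_conv using ac bd d
      by (simp add: Phi_add Phi_mult[of _ "fa_mult (fa_star c) c"] s Phi_mult[of _ "snd (loc_sum fs)"]
          Phi_mult[of "fa_star a"] Phi_star scal_commute)
    then have 3: "psd2 (Phi (fst (loc_sum (f # fs))) l)"
      using d w by (auto intro!: psd2_add psd2_scal psd2_adj_mult)
    show "\<exists>d>0. Phi (snd (loc_sum (f # fs))) l = scal (of_real d) \<and> psd2 (Phi (fst (loc_sum (f # fs))) l)"
      using 1 2 3 by blast
  qed
qed

lemma loc_sos_imp_A_pos:
  assumes y: "A_hermitian y" and sos: "loc_sos y"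
  shows "A_pos y"
proof -
  have yc: "y \<in> fa_carrier" using y by (simp add: A_hermitian_def)
  note adjY = hermitian_Phi[OF y]
  obtain t n where t: "\<And>l. in_disc l \<Longrightarrow> tr2 (Phi y l) = of_real (rl t l)"
    and n: "\<And>l. in_disc l \<Longrightarrow> det2 (Phi y l) = of_real (rl n l)" using hermitian_tr_det[OF yc adjY] by blast
  obtain fs where fs: "\<forall>(a, c)\<in>set fs. a \<in> fa_carrier \<and> loc_denom c" "loc_eq (y, fa_one) (loc_sum fs)"
    using sos unfolding loc_sos_def by blast
  have "\<forall>(a, c)\<in>set fs. a \<in> fa_carrier \<and> c \<in> fa_carrier" using fs(1) by (auto simp: loc_denom_def A_central_def)
  note nc = loc_sum_carrier[OF this]
  obtain s where s: "loc_denom s" and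
    eq: "A_eq (fa_mult s (fa_diff (fa_mult y (snd (loc_sum fs))) (fa_mult (fst (loc_sum fs)) fa_one))) fa_zero"
    using fs(2) unfolding loc_eq_def case_prod_unfold by auto
  have sc: "s \<in> fa_carrier" using s by (simp add: loc_denom_def A_central_def)
  obtain z M where z: "\<And>l. in_disc l \<Longrightarrow> Phi s l = scal (z l)" and M: "M \<noteq> 0" "\<And>l. rl M l \<noteq> 0 \<Longrightarrow> z l \<noteq> 0"
    using loc_denom_scalar[OF s] by blast
  obtain N where N: "N \<noteq> 0" "\<And>l. in_disc l \<Longrightarrow> rl N l \<noteq> 0 \<Longrightarrow>
    \<exists>d>0. Phi (snd (loc_sum fs)) l = scal (of_real d) \<and> psd2 (Phi (fst (loc_sum fs)) l)"
    using loc_sum_psd[OF fs(1)] by blast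
  have psd: "psd2 (Phi y l)" if l: "in_disc l" and nz: "rl (N * M) l \<noteq> 0" for l
  proof -
    have nz': "rl N l \<noteq> 0" "rl M l \<noteq> 0" using nz by (auto simp: evr.ev_mult)
    obtain d where d: "d > 0" "Phi (snd (loc_sum fs)) l = scal (of_real d)" "psd2 (Phi (fst (loc_sum fs)) l)"
      using N(2)[OF l nz'(1)] by blast
    have "Phi (fa_mult s (fa_diff (fa_mult y (snd (loc_sum fs))) (fa_mult (fst (loc_sum fs)) fa_one))) l = Phi fa_zero l"
      by (rule A_eq_imp_Phi[OF eq]) (use sc nc yc l in simp_all)
    \<comment> \<open>Off the zeros of \<open>N * M\<close> the scalars of \<open>s\<close> and of
      the common denominator can be cancelled one after the other.\<close>
    then have 0: "scal (z l) * (Phi y l * scal (of_real d) - Phi (fst (loc_sum fs)) l) = 0"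
      using nc sc yc by (simp add: Phi_mult Phi_diff Phi_basic z[OF l] d)
    have inv: "scal (inverse a) * (scal a * A) = A" if "a \<noteq> 0" for a A using that by (simp add: m2_eq_iff)
    have "Phi y l * scal (of_real d) - Phi (fst (loc_sum fs)) l = 0"
      using inv[OF M(2)[OF nz'(2)], of "Phi y l * scal (of_real d) - Phi (fst (loc_sum fs)) l"] unfolding 0 by simp
    then have "scal (of_real d) * Phi y l = Phi (fst (loc_sum fs)) l" by (simp add: scal_commute)
    then have "Phi y l = scal (of_real (inverse d)) * Phi (fst (loc_sum fs)) l"
      using inv[of "of_real d" "Phi y l"] d(1) by simp
    then show ?thesis using psd2_scal[OF d(3), of "inverse d"] d(1) by simp
  qed
  have NM: "N * M \<noteq> 0" using N M by simp
  show ?thesis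
  proof (rule A_pos_of_tr_det[OF y t _ n])
    show "0 \<le> rl t l" if "0 \<le> rl disc_poly l" for l
    proof (rule nonneg_on_closed_disc[OF NM _ that])
      fix l assume l: "in_disc l" "rl (N * M) l \<noteq> 0"
      show "0 \<le> rl t l" using psd2_tr_det(1)[OF psd[OF l] adjY[OF l(1)]] unfolding t[OF l(1)] by simp
    qed
    show "0 \<le> rl n l" if "0 \<le> rl disc_poly l" for l
    proof (rule nonneg_on_closed_disc[OF NM _ that])
      fix l assume l: "in_disc l" "rl (N * M) l \<noteq> 0"
      show "0 \<le> rl n l" using psd2_tr_det(2)[OF psd[OF l] adjY[OF l(1)]] unfolding n[OF l(1)] by simp
    qed
  qed
qed

theorem mainTheorem1:
  assumes "A_hermitian y"
  shows "(A_pos y \<longleftrightarrow> loc_sos y) \<and>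
         (loc_sos y \<longleftrightarrow> (\<exists>c. loc_denom c \<and> A_sos (fa_mult (fa_mult (fa_star c) c) y)))"
  using A_pos_imp_sos_multiple[OF assms] sos_multiple_imp_loc_sos[of y] loc_sos_imp_A_pos[OF assms] assms
  unfolding A_hermitian_def by blast

end
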